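(* Let $\mathcal{F}$ be a monotone class of graphs. Then the following are equivalent: (1) $\mathcal{F}$ is small-distance sketchable; (2) there is a function $f:\mathbb{N}\to\mathbb{N}$ such that for every $r\in\mathbb{N}$, $\mathcal{F}$ admits a disjunctive distance-$(r,r)$ labelling scheme of size $f(r)$; (3) $\mathcal{F}$ is first-order sketchable; (4) $\mathcal{F}$ has bounded expansion.
   Context: A class of graphs is a set of finite graphs closed under isomorphism; monotone means closed under subgraphs. $\mathsf{dist}_G(x,y)$ is the length of a shortest path ($\infty$ if none). For a family $f=(f_G)_{G\in\mathcal{F}}$ of partial functions $f_G:V(G)\times V(G)\to\{0,1,*\}$, an $f$-sketch for $\mathcal{F}$ is a function $D:\{0,1\}^*\times\{0,1\}^*\to\{0,1\}$ such that for every $G\in\mathcal{F}$ there is a probability distribution over $\mathsf{sk}:V(G)\to\{0,1\}^*$ with $\Pr[D(\mathsf{sk}(x),\mathsf{sk}(y))=f_G(x,y)]\ge 2/3$ whenever $f_G(x,y)\ne*$; its size is the maximum length of $\mathsf{sk}(x)$ (over graphs with $n$ vertices, functions in the support, and vertices); $\mathcal{F}$ is $f$-sketchable if there is an $f$-sketch whose size does not depend on $n$. Small-distance sketchable: for every $r\in\mathbb{N}$, $\mathcal{F}$ is $f$-sketchable for $f_G(x,y)=1$ if $\mathsf{dist}_G(x,y)\le r$ and $0$ otherwise (the size may depend on $r$). Disjunctive distance-$(r,r)$ labelling scheme of size $f(r)$: each vertex $x$ of each $G\in\mathcal{F}$ (vertex set $[n]$) is deterministically assigned a label $(p(x)\mid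 q(x))$ with a prefix $p(x)\in\{0,1\}^s$ and equality codes $q(x)\in\mathbb{N}^k$ with $s,k\le f(r)$; the decoder chooses, depending only on $p(x),p(y)$, a set $S$ of index pairs and outputs $1$ iff $q(x)_i=q(y)_j$ for some $(i,j)\in S$; the output must be $1$ iff $\mathsf{dist}_G(x,y)\le r$. First-order sketchable: for every first-order formula $\phi(x,y)$ with two free variables over a relational vocabulary $\{E',R_1,\dots,R_k\}$ with $E'$ binary symmetric and each $R_i$ unary, $\mathcal{F}$ is $f$-sketchable for every family $f$ obtained as follows: for each $G=(V,E)\in\mathcal{F}$ choose any structure with domain $V$ in which $E'$ is interpreted as $E$ and each $R_i$ as an arbitrary subset of $V$, and let $f_G(u,v)=1$ iff $\phi(u,v)$ holds in this structure (and $0$ otherwise). Bounded expansion: a depth-$r$ minor of $G$ is a graph obtained from a subgraph of $G$ by contracting pairwise disjoint connected subgraphs of radius at most $r$; $\mathcal{F}$ has bounded expansion if there is a function $g$ such that every depth-$r$ minor of every graph of $\mathcal{F}$ has average degree at most $g(r)$, for all $r\ge 0$. *)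

theory Defs
  imports "HOL-Probability.Probability_Mass_Function" "Graph_Theory.Graph_Theory"
begin

section \<open>Graph classes\<close>

text \<open>
  A finite simple graph is a digraph in the sense of the locale \<open>pair_graph\<close>: finite, loopless,
  without parallel arcs and with a symmetric arc set, so that an edge \<open>uv\<close> is the pair of arcs
  \<open>(u, v)\<close>, \<open>(v, u)\<close>. A class of graphs lives on a fixed vertex type; the type of natural numbers
  suffices, since every finite graph is isomorphic to one on it.
\<close>

definition graph_class :: "'a pair_pre_digraph set \<Rightarrow> bool" where
  "graph_class \<F> \<longleftrightarrow>
     (\<forall>G\<in>\<F>. pair_graph G) \<and>
     (\<forall>G\<in>\<F>. \<forall>H :: 'a pair_pre_digraph.
        pair_graph H \<and> digraph_iso (with_proj G) (with_proj H) \<longrightarrow> H \<in> \<F>)"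

definition monotone_class :: "'a pair_pre_digraph set \<Rightarrow> bool" where
  "monotone_class \<F> \<longleftrightarrow>
     (\<forall>G\<in>\<F>. \<forall>H. pair_graph H \<and> subgraph (with_proj H) (with_proj G) \<longrightarrow> H \<in> \<F>)"

definition graph_dist :: "'a pair_pre_digraph \<Rightarrow> 'a \<Rightarrow> 'a \<Rightarrow> ereal" where
  "graph_dist G x y = wf_digraph.\<mu> (with_proj G) (\<lambda>_. 1) x y"


section \<open>Sketches\<close>

text \<open>
  A family \<open>f\<close> of partial functions \<open>V(G) \<times> V(G) \<rightarrow> {0, 1, *}\<close> is a function into \<open>bool option\<close>, with
  \<open>None\<close> for \<open>*\<close>. Since \<open>V(G)\<close> is finite, there are only countably many functions
  \<open>V(G) \<rightarrow> {0, 1}*\<close>, so every probability distribution over them is given by a \<open>pmf\<close>; the values of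
  \<open>sk\<close> outside \<open>V(G)\<close> are irrelevant. The function \<open>s\<close> bounds the size in terms of the number of
  vertices.
\<close>

definition is_sketch ::
  "'a pair_pre_digraph set \<Rightarrow> ('a pair_pre_digraph \<Rightarrow> 'a \<Rightarrow> 'a \<Rightarrow> bool option) \<Rightarrow>
   (bool list \<Rightarrow> bool list \<Rightarrow> bool) \<Rightarrow> (nat \<Rightarrow> nat) \<Rightarrow> bool" where
  "is_sketch \<F> f D s \<longleftrightarrow>
     (\<forall>G\<in>\<F>. \<exists>P :: ('a \<Rightarrow> bool list) pmf.
        (\<forall>sk\<in>set_pmf P. \<forall>x\<in>pverts G. length (sk x) \<le> s (card (pverts G))) \<and>
        (\<forall>x\<in>pverts G. \<forall>y\<in>pverts G. \<forall>b. f G x y = Some b \<longrightarrow>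
           measure_pmf.prob P {sk. D (sk x) (sk y) = b} \<ge> 2 / 3))"

definition sketchable ::
  "'a pair_pre_digraph set \<Rightarrow> ('a pair_pre_digraph \<Rightarrow> 'a \<Rightarrow> 'a \<Rightarrow> bool option) \<Rightarrow> bool" where
  "sketchable \<F> f \<longleftrightarrow> (\<exists>D c. is_sketch \<F> f D (\<lambda>_. c))"

definition small_distance_sketchable :: "'a pair_pre_digraph set \<Rightarrow> bool" where
  "small_distance_sketchable \<F> \<longleftrightarrow>
     (\<forall>r :: nat. sketchable \<F> (\<lambda>G x y. Some (graph_dist G x y \<le> ereal (real r))))"


section \<open>Disjunctive labelling schemes\<close>

text \<open>
  A label is a pair of a prefix \<open>p\<close> and a list \<open>q\<close> of equality codes; \<open>S\<close> maps the two prefixes to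
  the set of index pairs that are compared (indices start at \<open>0\<close>).
\<close>

definition disjunctive_output ::
  "(bool list \<Rightarrow> bool list \<Rightarrow> (nat \<times> nat) set) \<Rightarrow>
   bool list \<times> nat list \<Rightarrow> bool list \<times> nat list \<Rightarrow> bool" where
  "disjunctive_output S l l' \<longleftrightarrow>
     (\<exists>(i, j) \<in> S (fst l) (fst l'). snd l ! i = snd l' ! j)"

definition disjunctive_distance_scheme :: "'a pair_pre_digraph set \<Rightarrow> nat \<Rightarrow> nat \<Rightarrow> bool" where
  "disjunctive_distance_scheme \<F> r t \<longleftrightarrow>
     (\<exists>s k S. s \<le> t \<and> k \<le> t \<and> (\<forall>p p'. S p p' \<subseteq> {..<k} \<times> {..<k}) \<and>
        (\<forall>G\<in>\<F>. \<exists>p q.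
           (\<forall>x\<in>pverts G. length (p x) = s \<and> length (q x) = k) \<and>
           (\<forall>x\<in>pverts G. \<forall>y\<in>pverts G.
              disjunctive_output S (p x, q x) (p y, q y) \<longleftrightarrow> graph_dist G x y \<le> ereal (real r))))"


section \<open>First-order logic over one binary and several unary relation symbols\<close>

text \<open>
  Variables are natural numbers; \<open>Edge\<close> is the symbol \<open>E'\<close> and \<open>Pred i\<close> the unary symbol \<open>R\<^sub>i\<close>.
  The remaining connectives and the universal quantifier are definable.
\<close>

datatype fo_formula =
    Equal nat nat
  | Edge nat nat
  | Pred nat nat
  | Neg fo_formula
  | Conj fo_formula fo_formula
  | Exists nat fo_formula

primrec free_vars :: "fo_formula \<Rightarrow> nat set" where
  "free_vars (Equal x y) = {x, y}"
| "free_vars (Edge x y) = {x, y}"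
| "free_vars (Pred i x) = {x}"
| "free_vars (Neg \<phi>) = free_vars \<phi>"
| "free_vars (Conj \<phi> \<psi>) = free_vars \<phi> \<union> free_vars \<psi>"
| "free_vars (Exists x \<phi>) = free_vars \<phi> - {x}"

primrec unary_symbols :: "fo_formula \<Rightarrow> nat set" where
  "unary_symbols (Equal x y) = {}"
| "unary_symbols (Edge x y) = {}"
| "unary_symbols (Pred i x) = {i}"
| "unary_symbols (Neg \<phi>) = unary_symbols \<phi>"
| "unary_symbols (Conj \<phi> \<psi>) = unary_symbols \<phi> \<union> unary_symbols \<psi>"
| "unary_symbols (Exists x \<phi>) = unary_symbols \<phi>"

primrec fo_sat :: "'a set \<Rightarrow> 'a rel \<Rightarrow> (nat \<Rightarrow> 'a set) \<Rightarrow> (nat \<Rightarrow> 'a) \<Rightarrow> fo_formula \<Rightarrow> bool" where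
  "fo_sat V E R \<sigma> (Equal x y) \<longleftrightarrow> \<sigma> x = \<sigma> y"
| "fo_sat V E R \<sigma> (Edge x y) \<longleftrightarrow> (\<sigma> x, \<sigma> y) \<in> E"
| "fo_sat V E R \<sigma> (Pred i x) \<longleftrightarrow> \<sigma> x \<in> R i"
| "fo_sat V E R \<sigma> (Neg \<phi>) \<longleftrightarrow> \<not> fo_sat V E R \<sigma> \<phi>"
| "fo_sat V E R \<sigma> (Conj \<phi> \<psi>) \<longleftrightarrow> fo_sat V E R \<sigma> \<phi> \<and> fo_sat V E R \<sigma> \<psi>"
| "fo_sat V E R \<sigma> (Exists x \<phi>) \<longleftrightarrow> (\<exists>a\<in>V. fo_sat V E R (\<sigma>(x := a)) \<phi>)"

text \<open>
  The two free variables of \<open>\<phi>(x, y)\<close> are the variables \<open>0\<close> and \<open>1\<close>. The unary relations \<open>R G\<close> are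
  chosen arbitrarily for each graph \<open>G\<close> of the class.
\<close>

definition first_order_sketchable :: "'a pair_pre_digraph set \<Rightarrow> bool" where
  "first_order_sketchable \<F> \<longleftrightarrow>
     (\<forall>k \<phi>. free_vars \<phi> \<subseteq> {0, 1} \<and> unary_symbols \<phi> \<subseteq> {1..k} \<longrightarrow>
        (\<forall>R. (\<forall>G\<in>\<F>. \<forall>i\<in>{1..k}. R G i \<subseteq> pverts G) \<longrightarrow>
           sketchable \<F>
             (\<lambda>G u v. Some (fo_sat (pverts G) (parcs G) (R G) ((\<lambda>_. v)(0 := u)) \<phi>))))"


section \<open>Bounded expansion\<close>

definition radius :: "'a pair_pre_digraph \<Rightarrow> ereal" where
  "radius G = (INF c\<in>pverts G. SUP v\<in>pverts G. graph_dist G c v)"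

text \<open>
  Contraction of the disjoint vertex sets in \<open>P\<close>, discarding loops and parallel edges. The vertices
  of the resulting graph are sets of vertices of \<open>G\<close>; an uncontracted vertex \<open>v\<close> becomes \<open>{v}\<close>.
\<close>

definition contract :: "'a pair_pre_digraph \<Rightarrow> 'a set set \<Rightarrow> 'a set pair_pre_digraph" where
  "contract G P =
     (let W = P \<union> {{v} | v. v \<in> pverts G - \<Union>P}
      in \<lparr> pverts = W,
           parcs = {(A, B). A \<in> W \<and> B \<in> W \<and> A \<noteq> B \<and> (\<exists>a\<in>A. \<exists>b\<in>B. (a, b) \<in> parcs G)} \<rparr>)"

definition depth_minor ::
  "nat \<Rightarrow> 'a set pair_pre_digraph \<Rightarrow> 'a pair_pre_digraph \<Rightarrow> bool" where
  "depth_minor r H G \<longleftrightarrow>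
     (\<exists>G' \<B>. pair_graph G' \<and> subgraph (with_proj G') (with_proj G) \<and>
        (\<forall>B\<in>\<B>. pair_graph B \<and> subgraph (with_proj B) (with_proj G') \<and>
           Digraph_Component.connected (with_proj B) \<and> radius B \<le> ereal (real r)) \<and>
        (\<forall>B\<in>\<B>. \<forall>C\<in>\<B>. B \<noteq> C \<longrightarrow> pverts B \<inter> pverts C = {}) \<and>
        H = contract G' (pverts ` \<B>))"

text \<open>The degree of a vertex is its out-degree, as edges are pairs of opposite arcs.\<close>

definition average_degree :: "'a pair_pre_digraph \<Rightarrow> real" where
  "average_degree G =
     (\<Sum>v\<in>pverts G. real (out_degree (with_proj G) v)) / real (card (pverts G))"

definition bounded_expansion :: "'a pair_pre_digraph set \<Rightarrow> bool" where
  "bounded_expansion \<F> \<longleftrightarrow>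
     (\<exists>g :: nat \<Rightarrow> real. \<forall>r. \<forall>G\<in>\<F>. \<forall>H. depth_minor r H G \<longrightarrow> average_degree H \<le> g r)"

end

theory Submission
  imports Defs "HOL-Probability.Product_PMF"
begin

text \<open>
  Hashing the equality codes turns a scheme that compares a bounded number of codes into a
  constant-size sketch. Conversely, take a shallow minor of a graph of the class and keep only the
  edges between branch sets that join prescribed depths. By monotonicity any subset of them may be
  deleted, and distances between the centres reveal which ones were; a counting argument then
  bounds their number, hence the density of the minor.

  Bounded expansion yields bounded sets \<open>R x\<close> such that every walk of length at most \<open>r\<close> between \<open>x\<close>
  and \<open>y\<close> meets \<open>R x \<inter> R y\<close>. Comparing distances to the common members decides whether the distance
  is at most \<open>r\<close>. For first-order formulas, isolate the vertices of \<open>R x \<inter> R y\<close>: then \<open>x\<close> and \<open>y\<close> are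
  far apart, and by a locality argument in the style of Gaifman their joint type is determined by
  the type of \<open>x\<close> and the type of \<open>y\<close>.
\<close>

section \<open>Hashing and counting\<close>

text \<open>The success probability 2/3 is matched from both sides. Hashing brings the chance of a
  false equality down to 1/3. Conversely, among the subsets of m pairs, those that differ from a
  given one in at most m/3 pairs number at most (27/4)^(m/3), exponentially fewer than 2^m. Deleting
  a cross edge need not be visible by itself, since the remaining cross edges may offer an equally
  short detour. Prescribing one depth on either side of a bipartition of the branch sets rules this
  out: a detour crosses at least three times, so a single distance threshold separates the two
  cases. The first-order case looks circular. Isolating vertices of the hitting sets adds unary
  predicates; their number depends on the size of the hitting sets, hence on the radius that
  locality demands. The locality theorem therefore fixes radius and number of rounds from the
  quantifier depth and the number of matched pairs alone, before the number of predicates is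
  known.\<close>

lemma hash_collision:
  fixes Q :: "nat set" and M :: nat
  assumes "finite Q" "a \<in> Q" "c \<in> Q" "a \<noteq> c" "M > 0"
  shows "measure_pmf.prob (Pi_pmf Q 0 (\<lambda>_. pmf_of_set {..<M})) {h. h a = h c} \<le> 1 / M"
proof -
  let ?H = "Pi_pmf Q 0 (\<lambda>_. pmf_of_set {..<M})"
  \<comment> \<open>Only the coordinates \<open>a\<close> and \<open>c\<close> are constrained. The
    boxes for the possible common values t cover the collision, and by independence each has
    probability 1 / M^2.\<close>
  let ?B = "\<lambda>t x. if x \<in> {a, c} then {t} else UNIV"
  have range: "h a < M" if "h \<in> set_pmf ?H" for h
    using that assms by (auto simp: set_Pi_pmf PiE_dflt_def lessThan_empty_iff)
  have "measure_pmf.prob ?H {h. h a = h c} = measure_pmf.prob ?H ({h. h a = h c} \<inter> set_pmf ?H)"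
    by (rule measure_Int_set_pmf[symmetric])
  also have "\<dots> \<le> measure_pmf.prob ?H (\<Union>t<M. Pi Q (?B t))"
  proof (intro measure_pmf.finite_measure_mono subsetI)
    fix h assume "h \<in> {h. h a = h c} \<inter> set_pmf ?H"
    then have "h a \<in> {..<M}" using range[of h] by simp
    moreover have "h \<in> Pi Q (?B (h a))"
      using \<open>h \<in> {h. h a = h c} \<inter> set_pmf ?H\<close> by (auto simp: Pi_def)
    ultimately show "h \<in> (\<Union>t<M. Pi Q (?B t))" by (rule UN_I)
  qed simp
  also have "\<dots> \<le> (\<Sum>t<M. measure_pmf.prob ?H (Pi Q (?B t)))"
    by (intro measure_pmf.finite_measure_subadditive_finite) auto
  also have "\<dots> = (\<Sum>t<M. (1 / M) * (1 / M))"
  proof (rule sum.cong[OF refl])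
    fix t assume t: "t \<in> {..<M}"
    have "measure_pmf.prob ?H (Pi Q (?B t)) = (\<Prod>x\<in>Q. measure_pmf.prob (pmf_of_set {..<M}) (?B t x))"
      by (rule measure_Pi_pmf_Pi[OF assms(1)])
    also have "\<dots> = (\<Prod>x\<in>{a, c}. measure_pmf.prob (pmf_of_set {..<M}) (?B t x))"
      using assms by (intro prod.mono_neutral_right) auto
    also have "\<dots> = (1 / M) * (1 / M)"
      using assms t by (simp add: measure_pmf_single pmf_of_set lessThan_empty_iff)
    finally show "measure_pmf.prob ?H (Pi Q (?B t)) = (1 / M) * (1 / M)" .
  qed
  also have "\<dots> = 1 / M" using assms(5) by simp
  finally show ?thesis .
qed

text \<open>Random hashing of the equality codes to a range quadratic in their number creates a false
  equality with probability at most \<open>1/3\<close>.\<close>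

lemma equality_scheme_sketchable:
  fixes PP :: "'p :: countable set" and \<F> :: "'a pair_pre_digraph set"
  assumes PP: "finite PP" and fin: "\<And>G. G \<in> \<F> \<Longrightarrow> finite (pverts G)"
    and scheme: "\<And>G. G \<in> \<F> \<Longrightarrow> \<exists>p (q :: 'a \<Rightarrow> nat list). \<forall>x\<in>pverts G. p x \<in> PP \<and> length (q x) = k \<and>
      (\<forall>y\<in>pverts G. \<forall>b. f G x y = Some b \<longrightarrow>
         b = D (p x) (p y) {(i, j). i < k \<and> j < k \<and> q x ! i = q y ! j})"
  shows "sketchable \<F> f"
proof -
  \<comment> \<open>A union bound over k * k pairs of codes, each colliding with probability at most
    1 / M, leaves at most 1/3; the summand 1 keeps the range nonempty when k = 0.\<close>
  define M where "M = 3 * (k * k) + 1"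
  define Z where "Z = PP \<times> {xs. set xs \<subseteq> {..<M} \<and> length xs = k}"
  have finZ: "finite Z" unfolding Z_def using PP finite_lists_length_eq[of "{..<M}" k] by auto
  \<comment> \<open>Unary coding: the length of the bit string is the number of the pair. Sizes stay
    bounded because \<open>Z\<close> is finite.\<close>
  define enc :: "'p \<times> nat list \<Rightarrow> bool list" where "enc z = replicate (to_nat z) True" for z
  define dec :: "bool list \<Rightarrow> 'p \<times> nat list" where "dec l = from_nat (length l)" for l
  have dec_enc: "dec (enc z) = z" for z by (simp add: dec_def enc_def)
  define D' where "D' l l' = D (fst (dec l)) (fst (dec l'))
    {(i, j). i < k \<and> j < k \<and> snd (dec l) ! i = snd (dec l') ! j}" for l l'
  define c where "c = Max (insert 0 (to_nat ` Z))"
  have enc_len: "length (enc z) \<le> c" if "z \<in> Z" for z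
    unfolding c_def enc_def using that finZ by (auto intro!: Max_ge)
  have "is_sketch \<F> f D' (\<lambda>_. c)"
    unfolding is_sketch_def
  proof
    fix G assume G: "G \<in> \<F>"
    obtain p and q :: "'a \<Rightarrow> nat list" where *: "\<forall>x\<in>pverts G. p x \<in> PP \<and> length (q x) = k \<and>
      (\<forall>y\<in>pverts G. \<forall>b. f G x y = Some b \<longrightarrow>
         b = D (p x) (p y) {(i, j). i < k \<and> j < k \<and> q x ! i = q y ! j})"
      using scheme[OF G] by (elim exE)
    have pq: "\<And>x. x \<in> pverts G \<Longrightarrow> p x \<in> PP"
      "\<And>x. x \<in> pverts G \<Longrightarrow> length (q x) = k"
      using * by simp_all
    have decode: "b = D (p x) (p y) {(i, j). i < k \<and> j < k \<and> q x ! i = q y ! j}"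
      if "x \<in> pverts G" "y \<in> pverts G" "f G x y = Some b" for x y b
      using * that by blast
    define Q where "Q = (\<Union>x\<in>pverts G. set (q x))"
    have finQ: "finite Q" using fin[OF G] by (auto simp: Q_def)
    define H where "H = Pi_pmf Q 0 (\<lambda>_. pmf_of_set {..<M})"
    define sk where "sk h x = enc (p x, map h (q x))" for h x
    have range: "h a < M" if "h \<in> set_pmf H" "a \<in> Q" for h a
      using that finQ by (auto simp: H_def set_Pi_pmf PiE_dflt_def M_def lessThan_empty_iff)
    show "\<exists>P. (\<forall>sk\<in>set_pmf P. \<forall>x\<in>pverts G. length (sk x) \<le> c) \<and>
      (\<forall>x\<in>pverts G. \<forall>y\<in>pverts G. \<forall>b. f G x y = Some b \<longrightarrow>
         2 / 3 \<le> measure_pmf.prob P {sk. D' (sk x) (sk y) = b})"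
    proof (intro exI[of _ "map_pmf sk H"] conjI ballI allI impI)
      fix s x assume s: "s \<in> set_pmf (map_pmf sk H)" and x: "x \<in> pverts G"
      from s obtain h where h: "h \<in> set_pmf H" "s = sk h" by auto
      have "(p x, map h (q x)) \<in> Z"
        using pq(1,2)[OF x] range[OF h(1)] x by (auto simp: Z_def Q_def)
      then show "length (s x) \<le> c" unfolding h(2) sk_def by (rule enc_len)
    next
      fix x y b assume xy: "x \<in> pverts G" "y \<in> pverts G" "f G x y = Some b"
      have inQ: "q x ! i \<in> Q" "q y ! i \<in> Q" if "i < k" for i
        using that xy pq(2) by (auto simp: Q_def intro!: nth_mem)
      define bad :: "nat \<times> nat \<Rightarrow> (nat \<Rightarrow> nat) set" where "bad = (\<lambda>(i, j). {h. q x ! i \<noteq> q y ! j \<and> h (q x ! i) = h (q y ! j)})"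
      let ?I = "{..<k} \<times> {..<k}"
      have "measure_pmf.prob H (\<Union>ij\<in>?I. bad ij) \<le> (\<Sum>ij\<in>?I. measure_pmf.prob H (bad ij))"
        by (intro measure_pmf.finite_measure_subadditive_finite) auto
      also have "\<dots> \<le> (\<Sum>ij\<in>?I. 1 / real M)"
      proof (rule sum_mono)
        fix ij assume "ij \<in> ?I"
        then obtain i j where ij: "ij = (i, j)" "i < k" "j < k" by auto
        show "measure_pmf.prob H (bad ij) \<le> 1 / real M"
        proof (cases "q x ! i = q y ! j")
          case True
          then show ?thesis by (simp add: bad_def ij)
        next
          case False
          then show ?thesis
            using hash_collision[OF finQ inQ(1)[OF ij(2)] inQ(2)[OF ij(3)] False, of M]
            by (simp add: bad_def ij H_def M_def)
        qed
      qed
      also have "\<dots> = real (k * k) / real M" by simp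
      also have "\<dots> \<le> 1 / 3"
      proof -
        have "0 < M" "3 * (k * k) \<le> M" by (simp_all add: M_def)
        then have "0 < real M" "3 * real (k * k) \<le> real M" by linarith+
        then show ?thesis by (simp add: field_simps del: of_nat_mult)
      qed
      finally have bad: "measure_pmf.prob H (\<Union>ij\<in>?I. bad ij) \<le> 1 / 3" .
      \<comment> \<open>Off the bad event, hashing preserves the equality pattern of the codes, and
        the decoder uses nothing else of them.\<close>
      have "- (\<Union>ij\<in>?I. bad ij) \<subseteq> {h. D' (sk h x) (sk h y) = b}"
      proof
        fix h assume h: "h \<in> - (\<Union>ij\<in>?I. bad ij)"
        have "map h (q x) ! i = map h (q y) ! j \<longleftrightarrow> q x ! i = q y ! j" if "i < k" "j < k" for i j
        proof -
          have "(i, j) \<in> ?I" using that by simp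
          then have "h \<notin> bad (i, j)" using h UN_I by (metis ComplD)
          then show ?thesis using pq(2)[OF xy(1)] pq(2)[OF xy(2)] that by (simp add: bad_def) metis
        qed
        then have "{(i, j). i < k \<and> j < k \<and> map h (q x) ! i = map h (q y) ! j} =
            {(i, j). i < k \<and> j < k \<and> q x ! i = q y ! j}" by (intro Collect_cong) auto
        then show "h \<in> {h. D' (sk h x) (sk h y) = b}"
          using decode[OF xy] by (simp add: D'_def sk_def dec_enc)
      qed
      then have "measure_pmf.prob H (- (\<Union>ij\<in>?I. bad ij)) \<le> measure_pmf.prob H {h. D' (sk h x) (sk h y) = b}"
        by (intro measure_pmf.finite_measure_mono) auto
      moreover have "measure_pmf.prob H (- (\<Union>ij\<in>?I. bad ij)) = 1 - measure_pmf.prob H (\<Union>ij\<in>?I. bad ij)"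
        using measure_pmf.prob_compl[of "\<Union>ij\<in>?I. bad ij" H] by (simp add: Compl_eq_Diff_UNIV)
      ultimately have "2 / 3 \<le> measure_pmf.prob H {h. D' (sk h x) (sk h y) = b}" using bad by simp
      then show "2 / 3 \<le> measure_pmf.prob (map_pmf sk H) {s. D' (s x) (s y) = b}"
        by (simp add: vimage_def)
    qed
  qed
  then show ?thesis unfolding sketchable_def by blast
qed

section \<open>Counting the subsets of pairs that sketches can encode\<close>

lemma sum_weighted_subsets:
  fixes x :: real
  assumes "finite Q"
  shows "(\<Sum>E\<in>Pow Q. x ^ card E) = (1 + x) ^ card Q"
  using assms
proof (induction Q rule: finite_induct)
  case (insert q Q)
  have "(\<Sum>E\<in>Pow (insert q Q). x ^ card E) =
      (\<Sum>E\<in>Pow Q. x ^ card E) + (\<Sum>E\<in>insert q ` Pow Q. x ^ card E)"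
    unfolding Pow_insert using insert.hyps by (intro sum.union_disjoint) auto
  also have "(\<Sum>E\<in>insert q ` Pow Q. x ^ card E) = (\<Sum>E\<in>Pow Q. x ^ card (insert q E))"
  proof -
    have "inj_on (insert q) (Pow Q)"
    proof (rule inj_onI)
      fix A B assume "A \<in> Pow Q" "B \<in> Pow Q" "insert q A = insert q B"
      then show "A = B" using insert.hyps(2) insert_ident[of q A B] by blast
    qed
    then show ?thesis by (simp only: sum.reindex comp_def)
  qed
  also have "\<dots> = (\<Sum>E\<in>Pow Q. x * x ^ card E)"
  proof (intro sum.cong refl)
    fix E assume "E \<in> Pow Q"
    then have "q \<notin> E" "finite E" using insert.hyps finite_subset[of E Q] by auto
    then show "x ^ card (insert q E) = x * x ^ card E" by simp
  qed
  also have "\<dots> = x * (\<Sum>E\<in>Pow Q. x ^ card E)" by (simp only: sum_distrib_left)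
  finally show ?case using insert.hyps by (simp add: insert.IH algebra_simps)
qed simp

text \<open>Give a subset E the weight (1/2)^card E: all subsets together weigh (3/2)^m, and each
  one counted here weighs at least (1/2)^(m/3). The base 1/2 optimises this bound. Cubing avoids the
  fractional exponent; what matters is that 27/4 lies below 8 = 2^3.\<close>

lemma card_small_subsets:
  assumes "finite Q"
  shows "real (card {E. E \<subseteq> Q \<and> 3 * card E \<le> card Q}) ^ 3 \<le> (27 / 4) ^ card Q"
proof -
  let ?S = "{E. E \<subseteq> Q \<and> 3 * card E \<le> card Q}" and ?m = "card Q"
  define t where "t = ?m div 3"
  have "real (card ?S) * (1 / 2) ^ t = (\<Sum>E\<in>?S. (1 / 2 :: real) ^ t)" by simp
  also have "\<dots> \<le> (\<Sum>E\<in>?S. (1 / 2) ^ card E)"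
    by (intro sum_mono power_decreasing) (auto simp: t_def)
  also have "\<dots> \<le> (\<Sum>E\<in>Pow Q. (1 / 2) ^ card E)"
    using assms by (intro sum_mono2) auto
  also have "\<dots> = (3 / 2) ^ ?m" by (simp add: sum_weighted_subsets[OF assms])
  finally have "real (card ?S) \<le> (3 / 2) ^ ?m * 2 ^ t" by (simp add: field_simps power_divide)
  then have "real (card ?S) ^ 3 \<le> ((3 / 2) ^ ?m * 2 ^ t) ^ 3" by (intro power_mono) auto
  also have "\<dots> = ((3 / 2) ^ 3) ^ ?m * 2 ^ (3 * t)"
    by (simp only: power_mult_distrib power_mult[symmetric] mult.commute[of _ 3])
  also have "\<dots> = (27 / 8) ^ ?m * 2 ^ (3 * t)"
    by (simp add: power_divide)
  also have "\<dots> \<le> (27 / 8) ^ ?m * 2 ^ ?m"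
    by (intro mult_left_mono power_increasing) (auto simp: t_def)
  also have "\<dots> = (27 / 4) ^ ?m" by (simp add: power_mult_distrib[symmetric])
  finally show ?thesis .
qed

text \<open>First moment: the expected number of wrongly decoded pairs is at most card Q / 3, so
  some sketch in the support does no worse.\<close>

lemma exists_good_sketch:
  fixes P :: "('a \<Rightarrow> bool list) pmf"
  assumes Q: "finite Q"
    and P: "\<And>x y. (x, y) \<in> Q \<Longrightarrow> measure_pmf.prob P {sk. D (sk x) (sk y) \<longleftrightarrow> (x, y) \<in> T} \<ge> 2 / 3"
  shows "\<exists>sk\<in>set_pmf P. 3 * card {(x, y) \<in> Q. D (sk x) (sk y) \<noteq> ((x, y) \<in> T)} \<le> card Q"
proof (rule ccontr)
  define err where "err sk = {(x, y) \<in> Q. D (sk x) (sk y) \<noteq> ((x, y) \<in> T)}" for sk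
  assume neg: "\<not> ?thesis"
  have large: "card Q + 1 \<le> 3 * card (err sk)" if "sk \<in> set_pmf P" for sk
  proof -
    have "\<not> 3 * card (err sk) \<le> card Q"
      using neg that unfolding err_def by blast
    then show ?thesis by simp
  qed
  have err_sum: "real (card (err sk)) = (\<Sum>z\<in>Q. indicator {sk. D (sk (fst z)) (sk (snd z)) \<noteq> (z \<in> T)} sk)" for sk
  proof -
    have "err sk = {z \<in> Q. D (sk (fst z)) (sk (snd z)) \<noteq> (z \<in> T)}" by (auto simp: err_def)
    then show ?thesis using Q by (simp add: indicator_def sum.If_cases Int_def)
  qed
  have int: "integrable (measure_pmf P) (indicator A :: _ \<Rightarrow> real)" for A
    by (rule measure_pmf.integrable_const_bound[of _ 1]) (auto simp: indicator_def)
  have "measure_pmf.expectation P (\<lambda>sk. real (card (err sk))) =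
      (\<Sum>z\<in>Q. measure_pmf.prob P {sk. D (sk (fst z)) (sk (snd z)) \<noteq> (z \<in> T)})"
    unfolding err_sum using int by (subst Bochner_Integration.integral_sum) auto
  also have "\<dots> \<le> (\<Sum>z\<in>Q. 1 / 3)"
  proof (rule sum_mono)
    fix z assume "z \<in> Q"
    then have "measure_pmf.prob P {sk. D (sk (fst z)) (sk (snd z)) \<longleftrightarrow> z \<in> T} \<ge> 2 / 3"
      using P[of "fst z" "snd z"] by simp
    moreover have "{sk. D (sk (fst z)) (sk (snd z)) \<noteq> (z \<in> T)} =
        UNIV - {sk. D (sk (fst z)) (sk (snd z)) \<longleftrightarrow> z \<in> T}" by auto
    ultimately show "measure_pmf.prob P {sk. D (sk (fst z)) (sk (snd z)) \<noteq> (z \<in> T)} \<le> 1 / 3"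
      using measure_pmf.prob_compl[of "{sk. D (sk (fst z)) (sk (snd z)) \<longleftrightarrow> z \<in> T}" P] by simp
  qed
  finally have upper: "measure_pmf.expectation P (\<lambda>sk. real (card (err sk))) \<le> card Q / 3" by simp
  have "integrable (measure_pmf P) (\<lambda>sk. real (card (err sk)))"
    unfolding err_sum using int by (intro Bochner_Integration.integrable_sum) auto
  \<comment> \<open>By integrality, an error count above card Q / 3 is at least (card Q + 1) / 3;
    this gap survives taking expectations.\<close>
  moreover have "(card Q + 1) / 3 \<le> real (card (err sk))" if "sk \<in> set_pmf P" for sk
  proof -
    have "real (card Q + 1) \<le> real (3 * card (err sk))" using large[OF that] by (simp only: of_nat_le_iff)
    then show ?thesis by simp
  qed
  ultimately have "(card Q + 1) / 3 \<le> measure_pmf.expectation P (\<lambda>sk. real (card (err sk)))"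
    by (intro measure_pmf.integral_ge_const) (simp_all add: AE_measure_pmf_iff)
  with upper show False by simp
qed

text \<open>Were \<open>Q\<close> large, the sketches of its \<open>2 ^ card Q\<close> subsets could not be told apart: a fixed
  assignment of sketches serves only those subsets that differ in at most a third of \<open>Q\<close> from the
  one it decodes to.\<close>

lemma sketchable_pairs_sparse:
  fixes Z :: "'a set"
  assumes Z: "finite Z" and Q: "Q \<subseteq> Z \<times> Z"
    and sketch: "\<And>T. T \<subseteq> Q \<Longrightarrow> \<exists>P :: ('a \<Rightarrow> bool list) pmf.
      (\<forall>sk\<in>set_pmf P. \<forall>x\<in>Z. length (sk x) \<le> c) \<and>
      (\<forall>x y. (x, y) \<in> Q \<longrightarrow> measure_pmf.prob P {sk. D (sk x) (sk y) \<longleftrightarrow> (x, y) \<in> T} \<ge> 2 / 3)"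
  shows "card Q \<le> 13 * (c + 1) * card Z"
proof -
  have finQ: "finite Q" using Q Z finite_subset by blast
  let ?m = "card Q" and ?n = "card Z"
  define err where "err T sk = {(x, y) \<in> Q. D (sk x) (sk y) \<noteq> ((x, y) \<in> T)}" for T sk
  have ex: "\<exists>sk. (\<forall>x\<in>Z. length (sk x) \<le> c) \<and> 3 * card (err T sk) \<le> ?m" if T: "T \<subseteq> Q" for T
  proof -
    obtain P :: "('a \<Rightarrow> bool list) pmf" where P: "\<forall>sk\<in>set_pmf P. \<forall>x\<in>Z. length (sk x) \<le> c"
      "\<forall>x y. (x, y) \<in> Q \<longrightarrow> measure_pmf.prob P {sk. D (sk x) (sk y) \<longleftrightarrow> (x, y) \<in> T} \<ge> 2 / 3"
      using sketch[OF T] by blast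
    with exists_good_sketch[OF finQ, of P D T] show ?thesis unfolding err_def by blast
  qed
  define s where "s T = (SOME sk. (\<forall>x\<in>Z. length (sk x) \<le> c) \<and> 3 * card (err T sk) \<le> ?m)" for T
  have s: "\<forall>x\<in>Z. length (s T x) \<le> c" "3 * card (err T (s T)) \<le> ?m" if "T \<subseteq> Q" for T
    using someI_ex[OF ex[OF that]] unfolding s_def by blast+
  let ?L = "{l :: bool list. length l \<le> c}" and ?S = "{E. E \<subseteq> Q \<and> 3 * card E \<le> ?m}"
  \<comment> \<open>A subset is recovered from the sketch assignment and the set of pairs decoded
    wrongly, so \<open>\<Phi>\<close> is injective; restricting the assignment to \<open>Z\<close>
    makes the range finite.\<close>
  define \<Phi> where "\<Phi> T = (restrict (s T) Z, err T (s T))" for T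
  have finL: "finite ?L" using finite_lists_length_le[of "UNIV :: bool set" c] by simp
  have "inj_on \<Phi> (Pow Q)"
  proof (rule inj_onI)
    fix T T' assume T: "T \<in> Pow Q" "T' \<in> Pow Q" "\<Phi> T = \<Phi> T'"
    have "z \<in> T \<longleftrightarrow> z \<in> T'" if z: "z \<in> Q" for z
    proof -
      obtain x y where xy: "z = (x, y)" "x \<in> Z" "y \<in> Z" using z Q by auto
      have "restrict (s T) Z = restrict (s T') Z" and err: "err T (s T) = err T' (s T')"
        using T(3) by (auto simp: \<Phi>_def)
      then have "s T x = s T' x" "s T y = s T' y" using xy by (metis restrict_apply')+
      moreover have "z \<in> err T (s T) \<longleftrightarrow> z \<in> err T' (s T')" by (simp only: err)
      ultimately show ?thesis using z xy by (auto simp: err_def)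
    qed
    with T(1,2) show "T = T'" by blast
  qed
  moreover have "\<Phi> ` Pow Q \<subseteq> (Z \<rightarrow>\<^sub>E ?L) \<times> ?S"
    using s by (auto simp: \<Phi>_def err_def)
  moreover have "finite ((Z \<rightarrow>\<^sub>E ?L) \<times> ?S)"
    using Z finL finQ by (intro finite_cartesian_product finite_PiE) auto
  ultimately have "card (Pow Q) \<le> card ((Z \<rightarrow>\<^sub>E ?L) \<times> ?S)"
    by (rule card_inj_on_le)
  then have "2 ^ ?m \<le> card ?L ^ ?n * card ?S"
    using Z finQ by (simp add: card_Pow card_cartesian_product card_funcsetE)
  also have "\<dots> \<le> (2 ^ (c + 1)) ^ ?n * card ?S"
  proof -
    have "card ?L = (\<Sum>i\<le>c. 2 ^ i)" using card_lists_length_le[of "UNIV :: bool set" c] by simp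
    also have "\<dots> \<le> 2 ^ (c + 1)" by (induction c) auto
    finally show ?thesis by (intro mult_le_mono1 power_mono) auto
  qed
  finally have "real (2 ^ ?m) \<le> real ((2 ^ (c + 1)) ^ ?n * card ?S)" by (simp only: of_nat_le_iff)
  then have "(2 :: real) ^ ?m \<le> 2 ^ ((c + 1) * ?n) * real (card ?S)"
    by (simp only: power_mult of_nat_mult of_nat_power of_nat_numeral)
  then have "((2 :: real) ^ ?m) ^ 3 \<le> (2 ^ ((c + 1) * ?n) * real (card ?S)) ^ 3"
    by (intro power_mono) auto
  then have "(8 :: real) ^ ?m \<le> 8 ^ ((c + 1) * ?n) * real (card ?S) ^ 3"
    by (simp only: power_mult_distrib power_mult[symmetric] mult.commute[of _ 3])
       (simp only: power_mult, simp)
  also have "\<dots> \<le> 8 ^ ((c + 1) * ?n) * (27 / 4) ^ ?m"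
    using card_small_subsets[OF finQ] by (intro mult_left_mono) auto
  finally have "(32 / 27 * (27 / 4) :: real) ^ ?m \<le> 8 ^ ((c + 1) * ?n) * (27 / 4) ^ ?m" by simp
  then have *: "(32 / 27 :: real) ^ ?m \<le> 8 ^ ((c + 1) * ?n)"
    unfolding power_mult_distrib by (rule mult_right_le_imp_le) simp
  show ?thesis
  proof (rule ccontr)
    assume "\<not> ?thesis"
    then have lt: "13 * ((c + 1) * ?n) < ?m" by (simp only: not_le mult.assoc)
    \<comment> \<open>32/27 is 8 divided by 27/4, and 13 is the least exponent for which its power
      reaches 8.\<close>
    have "(8 :: real) ^ ((c + 1) * ?n) \<le> ((32 / 27) ^ 13) ^ ((c + 1) * ?n)"
      by (intro power_mono) (simp_all add: power_divide)
    also have "\<dots> = (32 / 27) ^ (13 * ((c + 1) * ?n))" by (simp only: power_mult)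
    also have "\<dots> < (32 / 27) ^ ?m" using lt by (intro power_strict_increasing) auto
    finally show False using * by simp
  qed
qed

section \<open>Bounded distances\<close>

text \<open>The reflexive closure allows idle steps, so its powers express distance at most
  \<open>d\<close> rather than walks of exact length.\<close>

abbreviation reach :: "'a rel \<Rightarrow> nat \<Rightarrow> 'a rel" where
  "reach E d \<equiv> (E\<^sup>=) ^^ d"

lemma reach_mono: "d \<le> e \<Longrightarrow> reach E d \<subseteq> reach E e"
proof (induction e)
  case (Suc e)
  then show ?case
    by (cases "d = Suc e") (auto simp: le_Suc_eq)
qed simp

lemma reach_mono_rel: "E \<subseteq> F \<Longrightarrow> reach E d \<subseteq> reach F d"
  by (induction d) (auto intro: relpow_Suc_I)

lemma reach_add: "(x, y) \<in> reach E d \<Longrightarrow> (y, z) \<in> reach E e \<Longrightarrow> (x, z) \<in> reach E (d + e)"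
  by (auto simp: relpow_add)

lemma reach_sym: "sym E \<Longrightarrow> (x, y) \<in> reach E d \<Longrightarrow> (y, x) \<in> reach E d"
proof (induction d arbitrary: y)
  case (Suc d)
  then obtain z where "(x, z) \<in> reach E d" "(z, y) \<in> E\<^sup>=" by auto
  with Suc have "(z, x) \<in> reach E d" "(y, z) \<in> E\<^sup>=" by (auto dest: symD)
  then show ?case by (rule relpow_Suc_I2[rotated])
qed simp

lemma reach_refl: "(x, x) \<in> reach E d"
  by (induction d) auto

section \<open>Locality of back-and-forth equivalence\<close>

text \<open>The domain, the edges and the unary predicates.\<close>

type_synonym 'a struct = "'a set \<times> 'a rel \<times> (nat \<Rightarrow> 'a set)"

text \<open>\<open>P\<close> is a partial isomorphism for the first \<kappa> predicates. Positions
  are relations instead of tuples, so order and repetition of moves do not matter and a position can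
  be shrunk.\<close>

definition atomic_match :: "nat \<Rightarrow> 'a struct \<Rightarrow> 'a struct \<Rightarrow> 'a rel \<Rightarrow> bool" where
  "atomic_match \<kappa> A B P \<longleftrightarrow>
     (\<forall>(a, b)\<in>P. \<forall>i<\<kappa>. a \<in> snd (snd A) i \<longleftrightarrow> b \<in> snd (snd B) i) \<and>
     (\<forall>(a, b)\<in>P. \<forall>(a', b')\<in>P. (a = a' \<longleftrightarrow> b = b') \<and>
        ((a, a') \<in> fst (snd A) \<longleftrightarrow> (b, b') \<in> fst (snd B)))"

lemma atomic_match_pairD:
  assumes "atomic_match \<kappa> A B P" "(a, b) \<in> P" "(a', b') \<in> P"
  shows "(a = a' \<longleftrightarrow> b = b') \<and> ((a, a') \<in> fst (snd A) \<longleftrightarrow> (b, b') \<in> fst (snd B))"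
proof -
  have "\<forall>(a, b)\<in>P. \<forall>(a', b')\<in>P. (a = a' \<longleftrightarrow> b = b') \<and>
      ((a, a') \<in> fst (snd A) \<longleftrightarrow> (b, b') \<in> fst (snd B))"
    using assms(1) by (simp add: atomic_match_def)
  from bspec[OF this assms(2)] show ?thesis using assms(3) by auto
qed

lemma atomic_match_predD:
  assumes "atomic_match \<kappa> A B P" "(a, b) \<in> P" "i < \<kappa>"
  shows "a \<in> snd (snd A) i \<longleftrightarrow> b \<in> snd (snd B) i"
  using assms unfolding atomic_match_def by auto

lemma atomic_matchI:
  assumes "\<And>a b i. (a, b) \<in> P \<Longrightarrow> i < \<kappa> \<Longrightarrow> a \<in> snd (snd A) i \<longleftrightarrow> b \<in> snd (snd B) i"
    and "\<And>a b a' b'. (a, b) \<in> P \<Longrightarrow> (a', b') \<in> P \<Longrightarrow>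
      (a = a' \<longleftrightarrow> b = b') \<and> ((a, a') \<in> fst (snd A) \<longleftrightarrow> (b, b') \<in> fst (snd B))"
  shows "atomic_match \<kappa> A B P"
  unfolding atomic_match_def
proof (intro conjI ballI)
  fix p assume "p \<in> P"
  then show "case p of (a, b) \<Rightarrow> \<forall>i<\<kappa>. a \<in> snd (snd A) i \<longleftrightarrow> b \<in> snd (snd B) i"
    using assms(1) by (cases p) blast
next
  fix p assume "p \<in> P"
  then show "case p of (a, b) \<Rightarrow> \<forall>(a', b')\<in>P. (a = a' \<longleftrightarrow> b = b') \<and>
      ((a, a') \<in> fst (snd A) \<longleftrightarrow> (b, b') \<in> fst (snd B))"
    using assms(2) by (cases p) blast
qed

text \<open>The duplicator wins the Ehrenfeucht-Fraisse game of \<open>n\<close> rounds from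
  position \<open>P\<close>. For a single pair this says that its two elements have the same rank
  \<open>n\<close> type.\<close>

fun ef_equiv :: "nat \<Rightarrow> nat \<Rightarrow> 'a struct \<Rightarrow> 'a struct \<Rightarrow> 'a rel \<Rightarrow> bool" where
  "ef_equiv \<kappa> 0 A B P \<longleftrightarrow> atomic_match \<kappa> A B P"
| "ef_equiv \<kappa> (Suc n) A B P \<longleftrightarrow> atomic_match \<kappa> A B P \<and>
     (\<forall>a\<in>fst A. \<exists>b\<in>fst B. ef_equiv \<kappa> n A B (insert (a, b) P)) \<and>
     (\<forall>b\<in>fst B. \<exists>a\<in>fst A. ef_equiv \<kappa> n A B (insert (a, b) P))"

lemma ef_equiv_atomic: "ef_equiv \<kappa> n A B P \<Longrightarrow> atomic_match \<kappa> A B P"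
  by (cases n) auto

lemma atomic_match_subset:
  assumes "atomic_match \<kappa> A B P" "Q \<subseteq> P"
  shows "atomic_match \<kappa> A B Q"
proof (rule atomic_matchI)
  show "a \<in> snd (snd A) i \<longleftrightarrow> b \<in> snd (snd B) i" if "(a, b) \<in> Q" "i < \<kappa>" for a b i
    using atomic_match_predD[OF assms(1)] assms(2) that by blast
  show "(a = a' \<longleftrightarrow> b = b') \<and> ((a, a') \<in> fst (snd A) \<longleftrightarrow> (b, b') \<in> fst (snd B))"
    if "(a, b) \<in> Q" "(a', b') \<in> Q" for a b a' b'
    by (rule atomic_match_pairD[OF assms(1)]) (use assms(2) that in blast)+
qed

lemma ef_equiv_subset: "ef_equiv \<kappa> n A B P \<Longrightarrow> Q \<subseteq> P \<Longrightarrow> ef_equiv \<kappa> n A B Q"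
proof (induction n arbitrary: P Q)
  case 0
  then show ?case by (simp add: atomic_match_subset)
next
  case (Suc n)
  have "atomic_match \<kappa> A B Q"
    using Suc.prems by (auto intro: atomic_match_subset)
  moreover have "ef_equiv \<kappa> n A B (insert x Q)" if "ef_equiv \<kappa> n A B (insert x P)" for x
    by (rule Suc.IH[OF that]) (use Suc.prems in blast)
  ultimately show ?case
    using Suc.prems(1) by simp meson
qed

lemma ef_equiv_sym: "ef_equiv \<kappa> n A B P \<Longrightarrow> ef_equiv \<kappa> n B A (P\<inverse>)"
proof (induction n arbitrary: P)
  case 0
  then show ?case by (auto simp: atomic_match_def)
next
  case (Suc n)
  have ins: "(insert (a, b) P)\<inverse> = insert (b, a) (P\<inverse>)" for a b by auto
  have "atomic_match \<kappa> B A (P\<inverse>)"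
    using Suc.prems by (auto simp: atomic_match_def)
  moreover have "ef_equiv \<kappa> n B A (insert (b, a) (P\<inverse>))" if "ef_equiv \<kappa> n A B (insert (a, b) P)" for a b
    using Suc.IH[OF that] by (simp only: ins)
  ultimately show ?case
    using Suc.prems by simp meson
qed

lemma ef_equiv_refl: "ef_equiv \<kappa> n A A (Id_on S)"
proof (induction n arbitrary: S)
  case 0
  then show ?case by (auto simp: atomic_match_def)
next
  case (Suc n)
  have "ef_equiv \<kappa> n A A (insert (x, x) (Id_on S))" for x
    using Suc[of "insert x S"] by (simp add: Id_on_def)
  moreover have "atomic_match \<kappa> A A (Id_on S)"
    by (auto simp: atomic_match_def)
  ultimately show ?case unfolding ef_equiv.simps by blast
qed

text \<open>Triples record through which middle element a pair is composed; each round adds one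
  triple, so the induction applies again.\<close>

lemma ef_equiv_trans:
  "ef_equiv \<kappa> n A B ((\<lambda>(x, y, z). (x, y)) ` T) \<Longrightarrow> ef_equiv \<kappa> n B C ((\<lambda>(x, y, z). (y, z)) ` T)
   \<Longrightarrow> ef_equiv \<kappa> n A C ((\<lambda>(x, y, z). (x, z)) ` T)"
proof (induction n arbitrary: T)
  case 0
  then show ?case by (fastforce simp: atomic_match_def)
next
  case (Suc n)
  have at: "atomic_match \<kappa> A C ((\<lambda>(x, y, z). (x, z)) ` T)"
    using ef_equiv_atomic[OF Suc.prems(1)] ef_equiv_atomic[OF Suc.prems(2)]
    by (fastforce simp: atomic_match_def)
  have IH: "ef_equiv \<kappa> n A C (insert (a, c) ((\<lambda>(x, y, z). (x, z)) ` T))"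
    if "ef_equiv \<kappa> n A B (insert (a, b) ((\<lambda>(x, y, z). (x, y)) ` T))"
       "ef_equiv \<kappa> n B C (insert (b, c) ((\<lambda>(x, y, z). (y, z)) ` T))" for a b c
    using Suc.IH[of "insert (a, b, c) T"] that by (simp only: image_insert case_prod_conv)
  show ?case
    unfolding ef_equiv.simps
  proof (intro conjI at ballI)
    fix a assume "a \<in> fst A"
    with Suc.prems(1) obtain b where "b \<in> fst B"
      "ef_equiv \<kappa> n A B (insert (a, b) ((\<lambda>(x, y, z). (x, y)) ` T))" by auto
    moreover from this Suc.prems(2) obtain c where "c \<in> fst C"
      "ef_equiv \<kappa> n B C (insert (b, c) ((\<lambda>(x, y, z). (y, z)) ` T))"
      unfolding ef_equiv.simps by blast
    ultimately show "\<exists>c\<in>fst C. ef_equiv \<kappa> n A C (insert (a, c) ((\<lambda>(x, y, z). (x, z)) ` T))"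
      using IH by blast
  next
    fix c assume "c \<in> fst C"
    with Suc.prems(2) obtain b where "b \<in> fst B"
      "ef_equiv \<kappa> n B C (insert (b, c) ((\<lambda>(x, y, z). (y, z)) ` T))"
      unfolding ef_equiv.simps by blast
    moreover from this Suc.prems(1) obtain a where "a \<in> fst A"
      "ef_equiv \<kappa> n A B (insert (a, b) ((\<lambda>(x, y, z). (x, y)) ` T))"
      unfolding ef_equiv.simps by blast
    ultimately show "\<exists>a\<in>fst A. ef_equiv \<kappa> n A C (insert (a, c) ((\<lambda>(x, y, z). (x, z)) ` T))"
      using IH by blast
  qed
qed

lemma ef_equiv_down: "ef_equiv \<kappa> n A B P \<Longrightarrow> m \<le> n \<Longrightarrow> ef_equiv \<kappa> m A B P"
proof (induction n arbitrary: m P)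
  case (Suc n)
  then show ?case
    by (cases m) (auto, meson+)
qed simp

text \<open>One round is spent per step of the walk: its next vertex is played and answered by a
  neighbour. Edges lie inside the domain, so the next vertex is a legal move.\<close>

lemma ef_equiv_reach:
  assumes "ef_equiv \<kappa> n A B P" "d \<le> n" "fst (snd A) \<subseteq> fst A \<times> fst A"
    "(a, b) \<in> P" "(a', b') \<in> P" "(a, a') \<in> reach (fst (snd A)) d"
  shows "(b, b') \<in> reach (fst (snd B)) d"
  using assms
proof (induction d arbitrary: n P a b)
  case 0
  from ef_equiv_atomic[OF 0(1)] 0(4-) show ?case by (auto simp: atomic_match_def)
next
  case (Suc d)
  then obtain m where m: "n = Suc m" "d \<le> m" by (cases n) auto
  from relpow_Suc_D2[OF Suc.prems(6)] obtain z
    where z: "(a, z) \<in> (fst (snd A))\<^sup>=" "(z, a') \<in> reach (fst (snd A)) d" by blast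
  show ?case
  proof (cases "z = a")
    case True
    have "(b, b') \<in> reach (fst (snd B)) d"
      by (rule Suc.IH[OF Suc.prems(1) _ Suc.prems(3,4,5)]) (use Suc.prems(2) z True in auto)
    then show ?thesis by (rule subsetD[OF reach_mono, rotated]) simp
  next
    case False
    with z Suc.prems(3) have az: "(a, z) \<in> fst (snd A)" "z \<in> fst A" by auto
    with Suc.prems(1) m obtain w where w: "ef_equiv \<kappa> m A B (insert (z, w) P)" by auto
    from ef_equiv_atomic[OF w] az Suc.prems(4) have "(b, w) \<in> fst (snd B)"
      by (auto simp: atomic_match_def)
    moreover have "(w, b') \<in> reach (fst (snd B)) d"
      by (rule Suc.IH[OF w m(2) Suc.prems(3)]) (use Suc.prems z in auto)
    ultimately show ?thesis by (intro relpow_Suc_I2[of b w]) auto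
  qed
qed

text \<open>The elements of \<open>Y\<close> are played one after another, at one round each, and
  \<open>n\<close> rounds remain.\<close>

lemma ef_equiv_transfer:
  assumes "finite Y" "ef_equiv \<kappa> (n + card Y) A B P" "Y \<subseteq> fst A"
  shows "\<exists>g. g ` Y \<subseteq> fst B \<and> ef_equiv \<kappa> n A B (P \<union> (\<lambda>y. (y, g y)) ` Y)"
  using assms
proof (induction Y arbitrary: n rule: finite_induct)
  case (insert y Y)
  then have "ef_equiv \<kappa> (Suc n + card Y) A B P" by simp
  from insert.IH[OF this] insert.prems obtain g
    where g: "g ` Y \<subseteq> fst B" "ef_equiv \<kappa> (Suc n) A B (P \<union> (\<lambda>y. (y, g y)) ` Y)" by auto
  from g(2) insert.prems obtain b
    where b: "b \<in> fst B" "ef_equiv \<kappa> n A B (insert (y, b) (P \<union> (\<lambda>y. (y, g y)) ` Y))" by auto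
  have 1: "P \<union> (\<lambda>z. (z, (g(y := b)) z)) ` insert y Y = insert (y, b) (P \<union> (\<lambda>y. (y, g y)) ` Y)"
    using insert.hyps by auto
  have "(g(y := b)) ` insert y Y \<subseteq> fst B" using b(1) g(1) insert.hyps by auto
  with b(2) show ?case unfolding 1[symmetric] by blast
qed auto

text \<open>A triple \<open>(c, a, b)\<close> in \<open>C\<close> states that the element \<open>a\<close> of \<open>A\<close> was matched with the element \<open>b\<close>
  of \<open>B\<close> and that the pair belongs to the cluster \<open>c\<close>.\<close>

definition clusters_match ::
  "nat \<Rightarrow> nat \<Rightarrow> nat \<Rightarrow> 'a struct \<Rightarrow> 'a struct \<Rightarrow> (nat \<times> 'a \<times> 'a) set \<Rightarrow> bool" where
  "clusters_match \<kappa> r N A B C \<longleftrightarrow>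
     (\<forall>c a b. (c, a, b) \<in> C \<longrightarrow> a \<in> fst A \<and> b \<in> fst B) \<and>
     (\<forall>c a b c' a' b'. (c, a, b) \<in> C \<longrightarrow> (c', a', b') \<in> C \<longrightarrow> c \<noteq> c' \<longrightarrow>
        (a, a') \<notin> reach (fst (snd A)) r \<and> (b, b') \<notin> reach (fst (snd B)) r) \<and>
     (\<forall>c. ef_equiv \<kappa> N A B {(a, b). (c, a, b) \<in> C})"

lemma clusters_match_swap:
  assumes "clusters_match \<kappa> r N A B C"
  shows "clusters_match \<kappa> r N B A ((\<lambda>(c, a, b). (c, b, a)) ` C)"
proof -
  have mem: "(c, a, b) \<in> (\<lambda>(c, a, b). (c, b, a)) ` C \<longleftrightarrow> (c, b, a) \<in> C" for c a b
    by (auto simp: image_iff) force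
  have "ef_equiv \<kappa> N B A ({(a, b). (c, a, b) \<in> C}\<inverse>)" for c
    using assms by (intro ef_equiv_sym) (auto simp: clusters_match_def)
  then show ?thesis
    using assms unfolding clusters_match_def mem by (simp add: converse_unfold)
qed

definition graph_struct :: "'a struct \<Rightarrow> bool" where
  "graph_struct A \<longleftrightarrow> sym (fst (snd A)) \<and> fst (snd A) \<subseteq> fst A \<times> fst A"

text \<open>Suppose all elements of \<open>B\<close> of the type of \<open>a\<close> were near a cluster. A maximum scattered set of
  them is bounded by the number of cluster elements, and each of its parts near one cluster can be
  copied to \<open>A\<close>. There \<open>a\<close> extends the copy, so \<open>A\<close> has a larger scattered set of this type; but the
  type of the empty tuple determines the maximum size.\<close>

lemma distant_witness:
  assumes A: "graph_struct A" and B: "graph_struct B"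
    and C: "finite C" "card C \<le> l" "clusters_match \<kappa> r N A B C"
    and r: "r \<ge> 4 * R" and N: "N \<ge> N' + 2 * R + Suc l"
    and a: "a \<in> fst A" "\<And>c x y. (c, x, y) \<in> C \<Longrightarrow> (x, a) \<notin> reach (fst (snd A)) (3 * R)"
  shows "\<exists>b\<in>fst B. ef_equiv \<kappa> N' A B {(a, b)} \<and> (\<forall>(c, x, y)\<in>C. (y, b) \<notin> reach (fst (snd B)) R)"
proof (rule ccontr)
  assume neg: "\<not> ?thesis"
  let ?EA = "fst (snd A)" and ?EB = "fst (snd B)"
  have symA: "sym ?EA" and symB: "sym ?EB" and subA: "?EA \<subseteq> fst A \<times> fst A" and subB: "?EB \<subseteq> fst B \<times> fst B"
    using A B by (auto simp: graph_struct_def)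
  define T where "T = {b \<in> fst B. ef_equiv \<kappa> N' A B {(a, b)}}"
  have near: "\<exists>p\<in>C. (snd (snd p), b) \<in> reach ?EB R" if "b \<in> T" for b
    using neg that unfolding T_def by fastforce
  \<comment> \<open>Distance above 2 * R prevents a triple of \<open>C\<close> from being near two
    points of \<open>Y\<close>; hence \<open>w\<close> is injective on \<open>Y\<close> and card Y
    \<le> l.\<close>
  define scattered where
    "scattered Y \<longleftrightarrow> finite Y \<and> Y \<subseteq> T \<and> (\<forall>y\<in>Y. \<forall>y'\<in>Y. y \<noteq> y' \<longrightarrow> (y, y') \<notin> reach ?EB (2 * R))" for Y
  obtain w where w: "\<And>b. b \<in> T \<Longrightarrow> w b \<in> C \<and> (snd (snd (w b)), b) \<in> reach ?EB R"
    using near by metis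
  have inj: "inj_on w Y" if "scattered Y" for Y
  proof (rule inj_onI, rule ccontr)
    fix y y' assume y: "y \<in> Y" "y' \<in> Y" "w y = w y'" "y \<noteq> y'"
    then have "(y, snd (snd (w y))) \<in> reach ?EB R" "(snd (snd (w y)), y') \<in> reach ?EB R"
      using w that reach_sym[OF symB] by (metis (no_types, lifting) scattered_def subsetD)+
    from reach_add[OF this] have "(y, y') \<in> reach ?EB (2 * R)" by (simp add: mult_2)
    with y that show False by (auto simp: scattered_def)
  qed
  have bound: "card Y \<le> l" if "scattered Y" for Y
  proof -
    have "card Y \<le> card C"
      using inj[OF that] that w C(1) by (intro card_inj_on_le[of w]) (auto simp: scattered_def)
    with C(2) show ?thesis by simp
  qed
  have "scattered {}" by (simp add: scattered_def)
  then obtain Y where Y: "scattered Y" and max: "\<And>Z. scattered Z \<Longrightarrow> card Z \<le> card Y"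
    using ex_has_greatest_nat[of scattered "{}" card "Suc l"] bound
    by (metis le_imp_less_Suc)
  have finY: "finite Y" and YT: "Y \<subseteq> T" using Y by (auto simp: scattered_def)
  \<comment> \<open>Each cluster has its own game, so \<open>Y\<close> is copied cluster by cluster.
    This takes at most \<open>l\<close> rounds; of the remaining ones, \<open>N'\<close> preserve
    the type and 2 * R reveal distances.\<close>
  define Yc where "Yc c = {y \<in> Y. fst (w y) = c}" for c
  define Q where "Q c g \<longleftrightarrow> g ` Yc c \<subseteq> fst A \<and>
      ef_equiv \<kappa> (N' + 2 * R) B A ({(x, y). (c, x, y) \<in> C}\<inverse> \<union> (\<lambda>y. (y, g y)) ` Yc c)" for c g
  have ex: "\<exists>g. Q c g" for c
  proof -
    have "ef_equiv \<kappa> N A B {(x, y). (c, x, y) \<in> C}" using C(3) by (auto simp: clusters_match_def)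
    moreover have "card (Yc c) \<le> l"
      using bound[OF Y] card_mono[OF finY, of "Yc c"] by (auto simp: Yc_def)
    ultimately have "ef_equiv \<kappa> (N' + 2 * R + card (Yc c)) A B {(x, y). (c, x, y) \<in> C}"
      using N by (elim ef_equiv_down) auto
    from ef_equiv_transfer[OF _ ef_equiv_sym[OF this]] finY YT show ?thesis
      by (auto simp: Q_def Yc_def T_def)
  qed
  define G where "G c = (SOME g. Q c g)" for c
  have "Q c (G c)" for c
    unfolding G_def by (rule someI_ex[OF ex])
  then have G: "\<And>c. G c ` Yc c \<subseteq> fst A"
    "\<And>c. ef_equiv \<kappa> (N' + 2 * R) B A ({(x, y). (c, x, y) \<in> C}\<inverse> \<union> (\<lambda>y. (y, G c y)) ` Yc c)"
    unfolding Q_def by blast+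
  define g where "g y = G (fst (w y)) y" for y
  have gA: "g y \<in> fst A" if "y \<in> Y" for y
    using G(1)[of "fst (w y)"] that by (auto simp: g_def Yc_def)
  have gtype: "ef_equiv \<kappa> N' A A {(a, g y)}" if "y \<in> Y" for y
  proof -
    have "ef_equiv \<kappa> (N' + 2 * R) B A {(y, g y)}"
      using G(2)[of "fst (w y)"] by (rule ef_equiv_subset) (use that in \<open>auto simp: g_def Yc_def\<close>)
    then have "ef_equiv \<kappa> N' B A {(y, g y)}" by (rule ef_equiv_down) simp
    moreover have "ef_equiv \<kappa> N' A B {(a, y)}" using that YT by (auto simp: T_def)
    ultimately show ?thesis using ef_equiv_trans[of \<kappa> N' A B "{(a, y, g y)}" A] by simp
  qed
  have gnear: "(fst (snd (w y)), g y) \<in> reach ?EA R" if "y \<in> Y" for y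
  proof (rule ef_equiv_reach[OF G(2)[of "fst (w y)"] _ subB])
    obtain c x z where cxz: "w y = (c, x, z)" by (cases "w y") auto
    have "w y \<in> C" using w that YT by blast
    with cxz show "(snd (snd (w y)), fst (snd (w y))) \<in> {(x, z). (fst (w y), x, z) \<in> C}\<inverse> \<union> (\<lambda>y'. (y', G (fst (w y)) y')) ` Yc (fst (w y))"
      by auto
    show "(y, g y) \<in> {(x, z). (fst (w y), x, z) \<in> C}\<inverse> \<union> (\<lambda>y'. (y', G (fst (w y)) y')) ` Yc (fst (w y))"
      using that by (auto simp: Yc_def g_def)
    show "(snd (snd (w y)), y) \<in> reach ?EB R" using w that YT by blast
  qed simp
  have gfar: "(g y, g y') \<notin> reach ?EA (2 * R)" if y: "y \<in> Y" "y' \<in> Y" "y \<noteq> y'" for y y'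
  proof
    assume close: "(g y, g y') \<in> reach ?EA (2 * R)"
    show False
    proof (cases "fst (w y) = fst (w y')")
      case True
      have "(y, y') \<in> reach ?EB (2 * R)"
        by (rule ef_equiv_reach[OF ef_equiv_sym[OF G(2)[of "fst (w y)"]] _ subA _ _ close])
           (use y True in \<open>auto simp: Yc_def g_def\<close>)
      with Y y show False by (auto simp: scattered_def)
    next
      case False
      obtain c x z where 1: "w y = (c, x, z)" by (cases "w y") auto
      obtain c' x' z' where 2: "w y' = (c', x', z')" by (cases "w y'") auto
      have C12: "(c, x, z) \<in> C" "(c', x', z') \<in> C" using w y YT 1 2 by (metis subsetD)+
      have "(x, g y) \<in> reach ?EA R" "(x', g y') \<in> reach ?EA R" using gnear y 1 2 by force+
      \<comment> \<open>The origin of r \<ge> 4 * R: copies from different clusters within 2 * R of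
        each other would bring the clusters within 4 * R.\<close>
      then have "(x, x') \<in> reach ?EA (R + 2 * R + R)"
        using close reach_add reach_sym[OF symA] by metis
      then have "(x, x') \<in> reach ?EA r" using reach_mono[of "R + 2 * R + R" r] r by auto
      with C12 C(3) False 1 2 show False unfolding clusters_match_def by fastforce
    qed
  qed
  have gfar_a: "(g y, a) \<notin> reach ?EA (2 * R)" if y: "y \<in> Y" for y
  proof
    assume close: "(g y, a) \<in> reach ?EA (2 * R)"
    obtain c x z where 1: "w y = (c, x, z)" by (cases "w y") auto
    then have "(c, x, z) \<in> C" using w y YT by (metis subsetD)
    moreover have "(x, a) \<in> reach ?EA (R + 2 * R)"
      using gnear[OF y] close 1 reach_add by (metis fst_conv snd_conv)
    ultimately show False using a(2)[of c x z] by simp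
  qed
  have gY: "inj_on g Y"
    by (rule inj_onI) (metis gfar reach_refl)
  define Z where "Z = insert a (g ` Y)"
  have "a \<notin> g ` Y" using gfar_a reach_refl by (metis imageE)
  then have cardZ: "card Z = Suc (card Y)" using finY gY by (simp add: Z_def card_image)
  have ZA: "Z \<subseteq> fst A" using gA a by (auto simp: Z_def)
  have Ztype: "ef_equiv \<kappa> N' A A {(a, z)}" if "z \<in> Z" for z
    using ef_equiv_refl[of \<kappa> N' A "{a}"] gtype that by (auto simp: Z_def Id_on_def)
  have Zfar: "(z, z') \<notin> reach ?EA (2 * R)" if "z \<in> Z" "z' \<in> Z" "z \<noteq> z'" for z z'
    using that gfar gfar_a reach_sym[OF symA] unfolding Z_def by blast
  \<comment> \<open>The enlarged scattered set lies in \<open>A\<close>. The game from the empty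
    position carries it back to \<open>B\<close> in at most l + 1 rounds, where it exceeds the
    maximum.\<close>
  have "ef_equiv \<kappa> N A B {}"
    using C(3) by (auto simp: clusters_match_def intro: ef_equiv_subset)
  then have "ef_equiv \<kappa> (N' + 2 * R + card Z) A B {}"
    by (rule ef_equiv_down) (use cardZ bound[OF Y] N in auto)
  from ef_equiv_transfer[OF _ this ZA] finY obtain h where h: "h ` Z \<subseteq> fst B"
    "ef_equiv \<kappa> (N' + 2 * R) A B ((\<lambda>y. (y, h y)) ` Z)" by (auto simp: Z_def)
  have hT: "h z \<in> T" if "z \<in> Z" for z
  proof -
    have "ef_equiv \<kappa> N' A B {(z, h z)}"
      by (rule ef_equiv_subset[OF ef_equiv_down[OF h(2), of N']]) (use that in auto)
    with Ztype[OF that] have "ef_equiv \<kappa> N' A B {(a, h z)}"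
      using ef_equiv_trans[of \<kappa> N' A A "{(a, z, h z)}" B] by simp
    with h(1) that show ?thesis by (auto simp: T_def)
  qed
  have hfar: "(h z, h z') \<notin> reach ?EB (2 * R)" if "z \<in> Z" "z' \<in> Z" "z \<noteq> z'" for z z'
    using ef_equiv_reach[OF ef_equiv_sym[OF h(2)] _ subB, of "2 * R" "h z" z "h z'" z'] that Zfar
    by auto
  have hinj: "inj_on h Z" by (rule inj_onI) (metis hfar reach_refl)
  have "scattered (h ` Z)"
    unfolding scattered_def
  proof (intro conjI ballI impI)
    fix y y' assume "y \<in> h ` Z" "y' \<in> h ` Z" "y \<noteq> y'"
    then show "(y, y') \<notin> reach ?EB (2 * R)" using hfar by auto
  qed (use hT finY in \<open>auto simp: Z_def\<close>)
  from max[OF this] card_image[OF hinj] cardZ show False by simp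
qed

text \<open>Induction on the rounds. A new element within 3 * R of a cluster joins it and is
  answered in the game of that cluster; any other opens a cluster of its own, with an answer from
  \<open>distant_witness\<close>. Both ways, different clusters stay more than R apart. As \<kappa>
  is quantified after \<open>r\<close> and \<open>N\<close>, it may depend on them.\<close>

theorem ef_locality:
  "\<exists>r N. \<forall>\<kappa>. \<forall>A B :: 'a struct. \<forall>C. graph_struct A \<longrightarrow> graph_struct B \<longrightarrow> finite C \<longrightarrow> card C \<le> l \<longrightarrow>
     clusters_match \<kappa> r N A B C \<longrightarrow> ef_equiv \<kappa> q A B (snd ` C)"
proof (induction q arbitrary: l)
  case 0
  have "ef_equiv \<kappa> 0 A B (snd ` C)" if "clusters_match \<kappa> 1 0 A B C" for \<kappa> and A B :: "'a struct" and C
  proof -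
    have 1: "atomic_match \<kappa> A B {(a, b). (c, a, b) \<in> C}" for c
      using that by (auto simp: clusters_match_def)
    have 2: "a \<noteq> a' \<and> b \<noteq> b' \<and> (a, a') \<notin> fst (snd A) \<and> (b, b') \<notin> fst (snd B)"
      if *: "(c, a, b) \<in> C" "(c', a', b') \<in> C" "c \<noteq> c'" for c a b c' a' b'
    proof -
      have "(a, a') \<notin> reach (fst (snd A)) 1 \<and> (b, b') \<notin> reach (fst (snd B)) 1"
        using \<open>clusters_match \<kappa> 1 0 A B C\<close> * unfolding clusters_match_def by blast
      then show ?thesis by auto
    qed
    have "atomic_match \<kappa> A B (snd ` C)"
    proof (rule atomic_matchI)
      fix a b i assume "(a, b) \<in> snd ` C" "i < \<kappa>"
      then obtain c where "(c, a, b) \<in> C" by auto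
      then show "a \<in> snd (snd A) i \<longleftrightarrow> b \<in> snd (snd B) i"
        using atomic_match_predD[OF 1[of c], of a b i] \<open>i < \<kappa>\<close> by simp
    next
      fix a b a' b' assume "(a, b) \<in> snd ` C" "(a', b') \<in> snd ` C"
      then obtain c c' where c: "(c, a, b) \<in> C" "(c', a', b') \<in> C" by auto
      show "(a = a' \<longleftrightarrow> b = b') \<and> ((a, a') \<in> fst (snd A) \<longleftrightarrow> (b, b') \<in> fst (snd B))"
      proof (cases "c = c'")
        case True
        then show ?thesis using c atomic_match_pairD[OF 1[of c], of a b a' b'] by simp
      next
        case False
        with 2[OF c] show ?thesis by blast
      qed
    qed
    then show ?thesis by simp
  qed
  then show ?case by blast
next
  case (Suc q)
  obtain R N' where IH: "\<And>\<kappa> (A :: 'a struct) B C. graph_struct A \<Longrightarrow> graph_struct B \<Longrightarrow> finite C \<Longrightarrow>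
      card C \<le> Suc l \<Longrightarrow> clusters_match \<kappa> R N' A B C \<Longrightarrow> ef_equiv \<kappa> q A B (snd ` C)"
    using Suc.IH[of "Suc l"] by blast
  \<comment> \<open>An element that joins a cluster is within 3 * R of one of its members and must
    stay beyond R of all others. In \<open>N\<close>, one round answers the move, 3 * R transfer its
    distance to the cluster, and l + 1 pay for the scattered set in
    \<open>distant_witness\<close>.\<close>
  define r where "r = 4 * R + 1"
  define N where "N = Suc (N' + 3 * R + Suc l)"
  have down: "ef_equiv \<kappa> N' A B {(a, b). (c, a, b) \<in> C}" if "clusters_match \<kappa> r N A B C"
    for \<kappa> and A B :: "'a struct" and C c
  proof (rule ef_equiv_down)
    show "ef_equiv \<kappa> N A B {(a, b). (c, a, b) \<in> C}" using that by (auto simp: clusters_match_def)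
  qed (simp add: N_def)
  have forth: "\<exists>b\<in>fst B. ef_equiv \<kappa> q A B (insert (a, b) (snd ` C))"
    if A: "graph_struct A" and B: "graph_struct B" and C: "finite C" "card C \<le> l"
      and m: "clusters_match \<kappa> r N A B C" and a: "a \<in> fst A" for \<kappa> and A B :: "'a struct" and C a
  proof -
    have inC: "x \<in> fst A" "y \<in> fst B" if "(c, x, y) \<in> C" for c x y
      using m that unfolding clusters_match_def by blast+
    have farA: "(x, x') \<notin> reach (fst (snd A)) r" and farB: "(y, y') \<notin> reach (fst (snd B)) r"
      if "(c, x, y) \<in> C" "(c', x', y') \<in> C" "c \<noteq> c'" for c x y c' x' y'
      using m that unfolding clusters_match_def by blast+
    have symA: "sym (fst (snd A))" and symB: "sym (fst (snd B))" and subA: "fst (snd A) \<subseteq> fst A \<times> fst A"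
      using A B by (auto simp: graph_struct_def)
    have extend: "ef_equiv \<kappa> q A B (insert (a, b) (snd ` C))"
      if b: "b \<in> fst B" and eq: "ef_equiv \<kappa> N' A B (insert (a, b) {(x, y). (c, x, y) \<in> C})"
        and fA: "\<And>c' x y. (c', x, y) \<in> C \<Longrightarrow> c' \<noteq> c \<Longrightarrow> (x, a) \<notin> reach (fst (snd A)) R"
        and fB: "\<And>c' x y. (c', x, y) \<in> C \<Longrightarrow> c' \<noteq> c \<Longrightarrow> (y, b) \<notin> reach (fst (snd B)) R" for b c
    proof -
      have Rr: "R \<le> r" by (simp add: r_def)
      have sub: "reach (fst (snd A)) R \<subseteq> reach (fst (snd A)) r"
        "reach (fst (snd B)) R \<subseteq> reach (fst (snd B)) r"
        by (rule reach_mono[OF Rr])+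
      have cl: "ef_equiv \<kappa> N' A B {(x, y). (c', x, y) \<in> insert (c, a, b) C}" for c'
      proof (cases "c' = c")
        case True
        then have "{(x, y). (c', x, y) \<in> insert (c, a, b) C} = insert (a, b) {(x, y). (c, x, y) \<in> C}" by auto
        with eq show ?thesis by simp
      next
        case False
        then have "{(x, y). (c', x, y) \<in> insert (c, a, b) C} = {(x, y). (c', x, y) \<in> C}" by auto
        with down[OF m] show ?thesis by simp
      qed
      have far: "(x, x') \<notin> reach (fst (snd A)) R \<and> (y, y') \<notin> reach (fst (snd B)) R"
        if "(c1, x, y) \<in> insert (c, a, b) C" "(c2, x', y') \<in> insert (c, a, b) C" "c1 \<noteq> c2" for c1 x y c2 x' y'
      proof (cases "(c1, x, y) \<in> C"; cases "(c2, x', y') \<in> C")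
        assume "(c1, x, y) \<in> C" "(c2, x', y') \<in> C"
        with that(3) farA farB sub show ?thesis by (meson subsetD)
      next
        assume 1: "(c1, x, y) \<in> C" "(c2, x', y') \<notin> C"
        with that have "(c2, x', y') = (c, a, b)" by simp
        with 1 that(3) fA[OF 1(1)] fB[OF 1(1)] show ?thesis by simp
      next
        assume 1: "(c1, x, y) \<notin> C" "(c2, x', y') \<in> C"
        with that have "(c1, x, y) = (c, a, b)" by simp
        with 1 that(3) fA[OF 1(2)] fB[OF 1(2)] reach_sym[OF symA] reach_sym[OF symB]
        show ?thesis by auto
      next
        assume "(c1, x, y) \<notin> C" "(c2, x', y') \<notin> C"
        with that show ?thesis by simp
      qed
      have inC': "x \<in> fst A \<and> y \<in> fst B" if "(c1, x, y) \<in> insert (c, a, b) C" for c1 x y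
        using that inC a b by auto
      have "clusters_match \<kappa> R N' A B (insert (c, a, b) C)"
        unfolding clusters_match_def
      proof (intro conjI allI impI)
        fix c1 x y assume "(c1, x, y) \<in> insert (c, a, b) C"
        from inC'[OF this] show "x \<in> fst A" "y \<in> fst B" by simp_all
      next
        fix c1 x y c2 x' y'
        assume "(c1, x, y) \<in> insert (c, a, b) C" "(c2, x', y') \<in> insert (c, a, b) C" "c1 \<noteq> c2"
        from far[OF this]
        show "(x, x') \<notin> reach (fst (snd A)) R" "(y, y') \<notin> reach (fst (snd B)) R" by simp_all
      qed (rule cl)
      from IH[OF A B _ _ this] C show ?thesis by (simp add: card_insert_if)
    qed
    show ?thesis
    proof (cases "\<exists>c x y. (c, x, y) \<in> C \<and> (x, a) \<in> reach (fst (snd A)) (3 * R)")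
      case True
      then obtain c x y where c: "(c, x, y) \<in> C" "(x, a) \<in> reach (fst (snd A)) (3 * R)" by blast
      have "ef_equiv \<kappa> N A B {(x, y). (c, x, y) \<in> C}" using m by (auto simp: clusters_match_def)
      then obtain b where b: "b \<in> fst B"
        "ef_equiv \<kappa> (N' + 3 * R + Suc l) A B (insert (a, b) {(x, y). (c, x, y) \<in> C})"
        using a by (auto simp: N_def)
      have yb: "(y, b) \<in> reach (fst (snd B)) (3 * R)"
        by (rule ef_equiv_reach[OF b(2) _ subA _ _ c(2)]) (use c in auto)
      have "ef_equiv \<kappa> q A B (insert (a, b) (snd ` C))"
      proof (rule extend[OF b(1)])
        show "ef_equiv \<kappa> N' A B (insert (a, b) {(x, y). (c, x, y) \<in> C})"
          by (rule ef_equiv_down[OF b(2)]) simp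
      next
        fix c' x' y' assume c': "(c', x', y') \<in> C" "c' \<noteq> c"
        have le: "reach E (3 * R + R) \<subseteq> reach E r" for E :: "'a rel" by (rule reach_mono) (simp add: r_def)
        show "(x', a) \<notin> reach (fst (snd A)) R"
          using reach_add[OF c(2), of x' R] reach_sym[OF symA, of x' a R] farA[OF c(1) c'(1)] c'(2) le
          by blast
        show "(y', b) \<notin> reach (fst (snd B)) R"
          using reach_add[OF yb, of y' R] reach_sym[OF symB, of y' b R] farB[OF c(1) c'(1)] c'(2) le
          by blast
      qed
      with b(1) show ?thesis by blast
    next
      case False
      have "\<exists>b\<in>fst B. ef_equiv \<kappa> N' A B {(a, b)} \<and> (\<forall>(c, x, y)\<in>C. (y, b) \<notin> reach (fst (snd B)) R)"
      proof (rule distant_witness[OF A B C m _ _ a])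
        show "r \<ge> 4 * R" "N \<ge> N' + 2 * R + Suc l" by (simp_all add: r_def N_def)
        show "(x, a) \<notin> reach (fst (snd A)) (3 * R)" if "(c, x, y) \<in> C" for c x y
          using False that by blast
      qed
      then obtain b where b: "b \<in> fst B" "ef_equiv \<kappa> N' A B {(a, b)}"
        and far: "\<forall>(c, x, y)\<in>C. (y, b) \<notin> reach (fst (snd B)) R" by (elim bexE conjE)
      obtain c where c: "c \<notin> fst ` C" using C(1) ex_new_if_finite[of "fst ` C"] by auto
      then have e: "{(x, y). (c, x, y) \<in> C} = {}" by force
      have "ef_equiv \<kappa> q A B (insert (a, b) (snd ` C))"
      proof (rule extend[OF b(1), of c])
        show "ef_equiv \<kappa> N' A B (insert (a, b) {(x, y). (c, x, y) \<in> C})"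
          using b(2) by (simp only: e)
      next
        fix c' x y assume "(c', x, y) \<in> C"
        moreover have "reach (fst (snd A)) R \<subseteq> reach (fst (snd A)) (3 * R)" by (rule reach_mono) simp
        ultimately show "(x, a) \<notin> reach (fst (snd A)) R" using False by blast
      next
        fix c' x y assume "(c', x, y) \<in> C"
        from bspec[OF far this] show "(y, b) \<notin> reach (fst (snd B)) R" by simp
      qed
      with b(1) show ?thesis by blast
    qed
  qed
  have "ef_equiv \<kappa> (Suc q) A B (snd ` C)"
    if H: "graph_struct A" "graph_struct B" "finite C" "card C \<le> l" "clusters_match \<kappa> r N A B C"
    for \<kappa> and A B :: "'a struct" and C
  proof -
    \<comment> \<open>Back moves are forth moves of the game with the two structures
      exchanged.\<close>
    let ?C' = "(\<lambda>(c, a, b). (c, b, a)) ` C"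
    have snd': "snd ` ?C' = (snd ` C)\<inverse>" by force
    have card': "card ?C' \<le> l" using card_image_le[OF H(3)] H(4) le_trans by blast
    have returning: "\<exists>a\<in>fst A. ef_equiv \<kappa> q A B (insert (a, b) (snd ` C))" if b: "b \<in> fst B" for b
    proof -
      obtain a where a: "a \<in> fst A" "ef_equiv \<kappa> q B A (insert (b, a) ((snd ` C)\<inverse>))"
        using forth[OF H(2,1) finite_imageI[OF H(3)] card' clusters_match_swap[OF H(5)] b]
        unfolding snd' by (elim bexE)
      have "(insert (b, a) ((snd ` C)\<inverse>))\<inverse> = insert (a, b) (snd ` C)" by auto
      with ef_equiv_sym[OF a(2)] a(1) show ?thesis by auto
    qed
    have at: "atomic_match \<kappa> A B (snd ` C)"
    proof -
      have "clusters_match \<kappa> R N' A B C"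
      proof -
        have "reach E R \<subseteq> reach E r" for E :: "'a rel"
          by (rule reach_mono) (simp add: r_def)
        then show ?thesis
          using H(5) down[OF H(5)] unfolding clusters_match_def by blast
      qed
      from IH[OF H(1-3) _ this] H(4) show ?thesis by (intro ef_equiv_atomic) simp
    qed
    show ?thesis using at forth[OF H] returning unfolding ef_equiv.simps by blast
  qed
  then show ?case by blast
qed

section \<open>Hitting sets for short walks\<close>

abbreviation walk :: "'a rel \<Rightarrow> 'a list \<Rightarrow> bool" where
  "walk E \<equiv> successively (\<lambda>u v. (u, v) \<in> E)"

lemma walk_glue: "walk E (xs @ [w]) \<Longrightarrow> walk E (w # ys) \<Longrightarrow> walk E (xs @ w # ys)"
  by (auto simp: successively_append_iff)

lemma walk_rev: "walk E p \<Longrightarrow> sym E \<Longrightarrow> walk E (rev p)"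
  unfolding successively_rev by (erule successively_mono) (auto dest: symD)

text \<open>Only the targets of arcs must avoid \<open>M\<close>, so the start \<open>v\<close> may
  lie in \<open>M\<close>; the balls used below are centred at members of \<open>M\<close>.\<close>

lemma reach_imp_walk:
  "(v, w) \<in> reach {(x, y). (x, y) \<in> E \<and> y \<notin> M} i \<Longrightarrow>
     w = v \<or> (\<exists>p. p \<noteq> [] \<and> last p = w \<and> walk E (v # p) \<and> length p \<le> i \<and> set p \<inter> M = {})"
proof (induction i arbitrary: w)
  case (Suc i)
  then obtain z where z: "(v, z) \<in> reach {(x, y). (x, y) \<in> E \<and> y \<notin> M} i"
    "z = w \<or> (z, w) \<in> E \<and> w \<notin> M" by auto
  from Suc.IH[OF z(1)] obtain q where q: "last (v # q) = z" "walk E (v # q)" "length q \<le> i" "set q \<inter> M = {}"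
    by (metis last.simps list.size(3) le0 successively.simps(2) empty_set inf_bot_left)
  show ?case
  proof (cases "z = w")
    case True
    with q show ?thesis by (cases "q = []") auto
  next
    case False
    with z have "walk E (v # q @ [w])"
      using q successively_append_iff[of _ "v # q" "[w]"] by auto
    with False z q show ?thesis by (intro disjI2 exI[of _ "q @ [w]"]) auto
  qed
qed auto

lemma walk_imp_reach:
  "walk E (v # p) \<Longrightarrow> set p \<inter> M = {} \<Longrightarrow>
     (v, last (v # p)) \<in> reach {(x, y). (x, y) \<in> E \<and> y \<notin> M} (length p)"
proof (induction p arbitrary: v)
  case (Cons x p)
  then have "(v, x) \<in> {(x, y). (x, y) \<in> E \<and> y \<notin> M}\<^sup>="
    "(x, last (x # p)) \<in> reach {(x, y). (x, y) \<in> E \<and> y \<notin> M} (length p)" by auto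
  from relpow_Suc_I2[OF this] show ?case by simp
qed simp

text \<open>Every initial part of a short walk from \<open>v\<close> ends in the ball around
  \<open>v\<close>, so the ball is reached from its centre inside itself.\<close>

lemma reach_restrict_ball:
  assumes "(v, w) \<in> reach F i" "i \<le> r" "F \<subseteq> E" "C = {w. (v, w) \<in> reach F r}"
  shows "(v, w) \<in> reach (E \<inter> C \<times> C) i"
  using assms(1,2)
proof (induction i arbitrary: w)
  case (Suc i)
  then obtain z where z: "(v, z) \<in> reach F i" "(z, w) \<in> F\<^sup>=" by auto
  have "z \<in> C" using z(1) Suc.prems(2) reach_mono[of i r F] assms(4) by auto
  moreover have "w \<in> C" using Suc.prems reach_mono[of "Suc i" r F] assms(4) by blast
  ultimately have "(z, w) \<in> (E \<inter> C \<times> C)\<^sup>=" using z(2) assms(3) by auto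
  with Suc.IH[OF z(1)] Suc.prems(2) show ?case by (auto intro: relpow_Suc_I)
qed simp

lemma walk_reach_vertices:
  "walk E (v # p) \<Longrightarrow> w \<in> set (v # p) \<Longrightarrow> set (v # p) \<subseteq> S \<Longrightarrow>
     (v, w) \<in> reach (E \<inter> S \<times> S) (length p)"
proof (induction p arbitrary: v)
  case (Cons x p)
  show ?case
  proof (cases "w = v")
    case True
    then show ?thesis by (simp only: reach_refl)
  next
    case False
    with Cons have "(x, w) \<in> reach (E \<inter> S \<times> S) (length p)" "(v, x) \<in> (E \<inter> S \<times> S)\<^sup>=" by auto
    from relpow_Suc_I2[OF this(2,1)] show ?thesis by simp
  qed
qed simp

lemma walk_vertices:
  "walk E (v # p) \<Longrightarrow> E \<subseteq> V \<times> V \<Longrightarrow> set p \<subseteq> V"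
  by (induction p arbitrary: v) (auto simp: successively_Cons)

text \<open>Branch sets of a depth-\<open>d\<close> minor, each with a centre, indexed by
  \<open>X\<close>. Adjacencies will be counted as ordered pairs of indices, so for symmetric
  \<open>E\<close> their number is the degree sum of the minor.\<close>

definition shallow_model :: "'a set \<Rightarrow> 'a rel \<Rightarrow> nat \<Rightarrow> 'b set \<Rightarrow> ('b \<Rightarrow> 'a set) \<Rightarrow> bool" where
  "shallow_model V E d X B \<longleftrightarrow> finite X \<and>
     (\<forall>x\<in>X. B x \<subseteq> V \<and> (\<exists>c\<in>B x. \<forall>w\<in>B x. (c, w) \<in> reach (E \<inter> B x \<times> B x) d)) \<and>
     (\<forall>x\<in>X. \<forall>y\<in>X. x \<noteq> y \<longrightarrow> B x \<inter> B y = {})"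

definition adjacent_pairs :: "'a rel \<Rightarrow> 'b set \<Rightarrow> ('b \<Rightarrow> 'a set) \<Rightarrow> 'b rel" where
  "adjacent_pairs E X B = {(u, v) \<in> X \<times> X. u \<noteq> v \<and> (\<exists>a\<in>B u. \<exists>b\<in>B v. (a, b) \<in> E)}"

definition shallow_sparse :: "'a set \<Rightarrow> 'a rel \<Rightarrow> nat \<Rightarrow> nat \<Rightarrow> bool" where
  "shallow_sparse V E d g \<longleftrightarrow>
     (\<forall>X B. X \<subseteq> V \<longrightarrow> shallow_model V E d X B \<longrightarrow> card (adjacent_pairs E X B) \<le> g * card X)"

lemma finite_adjacent_pairs: "finite X \<Longrightarrow> finite (adjacent_pairs E X B)"
  unfolding adjacent_pairs_def by (rule finite_subset[of _ "X \<times> X"]) auto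

text \<open>At most half of \<open>A\<close> has degree above 2 * g. A maximum independent set among
  the rest dominates it, and each member covers at most 1 + 2 * g vertices, itself included.\<close>

lemma large_independent_subset:
  fixes Q :: "'a rel"
  assumes A: "finite A" and Q: "Q \<subseteq> A \<times> A" "sym Q" "card Q \<le> g * card A"
  obtains I where "I \<subseteq> A" "\<And>u v. u \<in> I \<Longrightarrow> v \<in> I \<Longrightarrow> u \<noteq> v \<Longrightarrow> (u, v) \<notin> Q"
    "card A \<le> 2 * (1 + 2 * g) * card I"
proof -
  define A0 where "A0 = {v \<in> A. card (Q `` {v}) \<le> 2 * g}"
  have finQ: "finite (Q `` {v})" for v
    using finite_subset[of "Q `` {v}" A] Q(1) A by auto
  have "card (A - A0) * (2 * g + 1) = (\<Sum>v\<in>A - A0. 2 * g + 1)" by simp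
  also have "\<dots> \<le> (\<Sum>v\<in>A - A0. card (Q `` {v}))"
    by (intro sum_mono) (auto simp: A0_def)
  also have "\<dots> \<le> (\<Sum>v\<in>A. card (Q `` {v}))"
    using A by (intro sum_mono2) auto
  also have "\<dots> = card (Sigma A (\<lambda>v. Q `` {v}))"
    using A finQ by simp
  also have "Sigma A (\<lambda>v. Q `` {v}) = Q" using Q(1) by auto
  also note Q(3)
  finally have "card (A - A0) * (2 * g + 1) \<le> g * card A" .
  moreover have "card A = card A0 + card (A - A0)"
    using A card_mono[OF A, of A0] card_Diff_subset[of A0 A] finite_subset[of A0 A] by (auto simp: A0_def)
  ultimately have half: "card A \<le> 2 * card A0"
  proof -
    assume a: "card (A - A0) * (2 * g + 1) \<le> g * card A" "card A = card A0 + card (A - A0)"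
    show ?thesis
    proof (rule ccontr)
      assume "\<not> ?thesis"
      with a(2) have "card A < 2 * card (A - A0)" by simp
      then have "card A + 1 \<le> 2 * card (A - A0)" by simp
      from mult_le_mono1[OF this, of "2 * g + 1"] a(1)
      have "(card A + 1) * (2 * g + 1) \<le> 2 * g * card A" by (simp add: algebra_simps)
      then show False by (simp add: algebra_simps)
    qed
  qed
  define indep where "indep I \<longleftrightarrow> I \<subseteq> A0 \<and> (\<forall>u\<in>I. \<forall>v\<in>I. u \<noteq> v \<longrightarrow> (u, v) \<notin> Q)" for I
  have finA0: "finite A0" using A by (auto simp: A0_def)
  have "indep {}" by (simp add: indep_def)
  moreover have "\<forall>I. indep I \<longrightarrow> card I < Suc (card A0)"
    using card_mono[OF finA0] by (auto simp: indep_def less_Suc_eq_le)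
  ultimately obtain I where I: "indep I" and max: "\<And>J. indep J \<Longrightarrow> card J \<le> card I"
    using ex_has_greatest_nat[of indep "{}" card] by blast
  have IA: "I \<subseteq> A0" using I by (simp add: indep_def)
  have finI: "finite I" by (rule finite_subset[OF IA finA0])
  have "A0 \<subseteq> (\<Union>v\<in>I. insert v (Q `` {v}))"
  proof
    fix x assume x: "x \<in> A0"
    show "x \<in> (\<Union>v\<in>I. insert v (Q `` {v}))"
    proof (rule ccontr)
      assume neg: "\<not> ?thesis"
      then have "x \<notin> I" by auto
      moreover from neg x I Q(2) have "indep (insert x I)"
        by (auto simp: indep_def dest: symD)
      ultimately show False using max[of "insert x I"] finI by simp
    qed
  qed
  then have "card A0 \<le> card (\<Union>v\<in>I. insert v (Q `` {v}))"
    using finI finQ by (intro card_mono) auto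
  also have "\<dots> \<le> (\<Sum>v\<in>I. card (insert v (Q `` {v})))" by (rule card_UN_le[OF finI])
  also have "\<dots> \<le> (\<Sum>v\<in>I. 1 + 2 * g)"
  proof (rule sum_mono)
    fix v assume "v \<in> I"
    then have "card (Q `` {v}) \<le> 2 * g" using IA by (auto simp: A0_def)
    then show "card (insert v (Q `` {v})) \<le> 1 + 2 * g"
      using finQ[of v] by (simp add: card_insert_if)
  qed
  finally have "card A0 \<le> (1 + 2 * g) * card I" by (simp add: mult.commute)
  with half have le: "card A \<le> 2 * (1 + 2 * g) * card I" by simp
  show thesis by (rule that[OF _ _ le]) (use I in \<open>auto simp: indep_def A0_def\<close>)
qed

text \<open>Choose branch sets around the vertices of \<open>A\<close> with as many adjacencies as possible, paying for
  each adjacency with at most \<open>2 * r\<close> vertices. By maximality, short walks outside their union \<open>M\<close>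
  join only adjacent members of \<open>A\<close>; so for an independent set \<open>I\<close> of members, the balls outside \<open>M\<close>
  around them are disjoint, and with the vertices of \<open>M\<close> they form a shallow minor. As it is sparse,
  some \<open>v\<close> in \<open>I\<close> reaches few vertices of \<open>M\<close>, and these form \<open>H\<close>.\<close>

lemma sparse_hitting_vertex:
  fixes V :: "'a set"
  assumes V: "finite V" and E: "E \<subseteq> V \<times> V" "sym E" and g: "shallow_sparse V E (2 * r) g"
    and A: "A \<subseteq> V" "A \<noteq> {}" and K: "K = g * (1 + 2 * r * g) * (2 * (1 + 2 * g))"
  shows "\<exists>v\<in>A. \<exists>H. finite H \<and> card H \<le> K \<and>
    (\<forall>p. walk E (v # p) \<longrightarrow> length p \<le> r \<longrightarrow> p \<noteq> [] \<longrightarrow> last p \<in> A - {v} \<longrightarrow>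
       set (butlast p) \<inter> A = {} \<longrightarrow> set p \<inter> H \<noteq> {})"
proof -
  have finA: "finite A" using A V finite_subset by blast
  \<comment> \<open>Sparsity bounds the adjacencies by g * card A, so the last clause keeps the
    union of the branch sets linear in card A. Singletons are good, which starts the
    maximisation.\<close>
  define good where "good B \<longleftrightarrow>
     (\<forall>v\<in>A. v \<in> B v \<and> B v \<subseteq> V \<and> (\<forall>w\<in>B v. (v, w) \<in> reach (E \<inter> B v \<times> B v) (2 * r))) \<and>
     (\<forall>u\<in>A. \<forall>v\<in>A. u \<noteq> v \<longrightarrow> B u \<inter> B v = {}) \<and>
     card (\<Union>v\<in>A. B v) \<le> card A + 2 * r * card (adjacent_pairs E A B)" for B
  have "good (\<lambda>v. {v})" using A(1) by (auto simp: good_def reach_refl)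
  moreover have "card (adjacent_pairs E A B) < Suc (card (A \<times> A))" for B
    unfolding adjacent_pairs_def using finA by (intro le_imp_less_Suc card_mono) auto
  ultimately obtain B where B: "good B"
    and max: "\<And>B'. good B' \<Longrightarrow> card (adjacent_pairs E A B') \<le> card (adjacent_pairs E A B)"
    using ex_has_greatest_nat[of good "\<lambda>v. {v}" "\<lambda>B. card (adjacent_pairs E A B)"] by blast
  define Q where "Q = adjacent_pairs E A B"
  define M where "M = (\<Union>v\<in>A. B v)"
  have Bv: "v \<in> B v" "B v \<subseteq> V" "\<And>w. w \<in> B v \<Longrightarrow> (v, w) \<in> reach (E \<inter> B v \<times> B v) (2 * r)" if "v \<in> A" for v
    using B that by (auto simp: good_def)
  have Bdisj: "B u \<inter> B v = {}" if "u \<in> A" "v \<in> A" "u \<noteq> v" for u v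
    using B that by (auto simp: good_def)
  have MV: "M \<subseteq> V" using Bv by (auto simp: M_def)
  have finM: "finite M" using MV V finite_subset by blast
  have AM: "A \<subseteq> M" using Bv by (auto simp: M_def)
  have finQ: "finite Q" unfolding Q_def by (rule finite_adjacent_pairs[OF finA])
  have symQ: "sym Q" using E(2) by (auto simp: Q_def adjacent_pairs_def sym_def)
  have QA: "Q \<subseteq> A \<times> A" by (auto simp: Q_def adjacent_pairs_def)
  have Qg: "card Q \<le> g * card A"
  proof -
    have "shallow_model V E (2 * r) A B"
      unfolding shallow_model_def using finA Bv Bdisj by blast
    then show ?thesis using g A(1) by (auto simp: shallow_sparse_def Q_def)
  qed
  have cardM: "card M \<le> (1 + 2 * r * g) * card A"
  proof -
    have "card M \<le> card A + 2 * r * card Q" using B by (auto simp: good_def M_def Q_def)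
    also have "\<dots> \<le> card A + 2 * r * (g * card A)" using Qg by simp
    finally show ?thesis by (simp add: algebra_simps)
  qed
  have no_shortcut: False
    if uv: "u \<in> A" "v \<in> A" "u \<noteq> v" "(u, v) \<notin> Q" and p: "walk E (u # p @ [v])" "set p \<inter> M = {}" "length p \<le> 2 * r"
    for u v p
  proof -
    \<comment> \<open>The branch set of \<open>u\<close> absorbs the interior of the walk. The
      gained adjacency (u, v) pays for these at most 2 * r vertices, and the radius stays at most 2
      * r because the walk starts at \<open>u\<close>.\<close>
    define B' where "B' = B(u := B u \<union> set p)"
    have wp: "walk E (u # p)" "(last (u # p), v) \<in> E"
      using p(1) successively_append_iff[of _ "u # p" "[v]"] by auto
    have pV: "set p \<subseteq> V" by (rule walk_vertices[OF wp(1) E(1)])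
    have sub: "B x \<subseteq> B' x" for x by (auto simp: B'_def)
    have B'other: "B' x = B x" if "x \<noteq> u" for x using that by (simp add: B'_def)
    have rad: "(x, w) \<in> reach (E \<inter> B' x \<times> B' x) (2 * r)" if x: "x \<in> A" "w \<in> B' x" for x w
    proof (cases "w \<in> B x")
      case True
      have "reach (E \<inter> B x \<times> B x) (2 * r) \<subseteq> reach (E \<inter> B' x \<times> B' x) (2 * r)"
        using sub[of x] by (intro reach_mono_rel) auto
      with Bv(3)[OF x(1) True] show ?thesis by blast
    next
      case False
      with x have xu: "x = u" "w \<in> set p" by (auto simp: B'_def split: if_splits)
      have "set (u # p) \<subseteq> B' u" using Bv(1)[OF uv(1)] by (auto simp: B'_def)
      from walk_reach_vertices[OF wp(1) _ this, of w] xu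
      show ?thesis using reach_mono[OF p(3), of "E \<inter> B' u \<times> B' u"] by auto
    qed
    have adj_sub: "Q \<subseteq> adjacent_pairs E A B'"
      using sub by (fastforce simp: Q_def adjacent_pairs_def)
    have "last (u # p) \<in> B' u" using Bv(1)[OF uv(1)] by (auto simp: B'_def)
    moreover have "v \<in> B' v" using Bv(1)[OF uv(2)] sub by auto
    ultimately have "(u, v) \<in> adjacent_pairs E A B'" using uv wp(2) by (auto simp: adjacent_pairs_def)
    with adj_sub uv(4) have "card (insert (u, v) Q) \<le> card (adjacent_pairs E A B')"
      by (intro card_mono finite_adjacent_pairs finA) auto
    with uv(4) finQ have more: "card Q + 1 \<le> card (adjacent_pairs E A B')" by simp
    have "good B'"
      unfolding good_def
    proof (intro conjI ballI impI)
      fix x assume x: "x \<in> A"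
      then show "x \<in> B' x" "B' x \<subseteq> V" using Bv[OF x] sub pV by (auto simp: B'_def)
      show "(x, w) \<in> reach (E \<inter> B' x \<times> B' x) (2 * r)" if "w \<in> B' x" for w using rad x that by blast
    next
      fix x y assume xy: "x \<in> A" "y \<in> A" "x \<noteq> y"
      with Bdisj[OF xy] p(2) show "B' x \<inter> B' y = {}" by (auto simp: B'_def M_def)
    next
      have "(\<Union>x\<in>A. B' x) \<subseteq> M \<union> set p" by (auto simp: B'_def M_def split: if_splits)
      then have "card (\<Union>x\<in>A. B' x) \<le> card (M \<union> set p)" using finM by (intro card_mono) auto
      also have "\<dots> \<le> card M + length p" using card_Un_le[of M "set p"] card_length[of p] by linarith
      also have "\<dots> \<le> card A + 2 * r * card Q + 2 * r" using B p(3) by (auto simp: good_def M_def Q_def)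
      also have "\<dots> = card A + 2 * r * (card Q + 1)" by simp
      also have "\<dots> \<le> card A + 2 * r * card (adjacent_pairs E A B')"
        using more by (intro add_left_mono mult_le_mono2)
      finally show "card (\<Union>x\<in>A. B' x) \<le> card A + 2 * r * card (adjacent_pairs E A B')" .
    qed
    from max[OF this] more show False by (simp add: Q_def)
  qed
  obtain I where I: "I \<subseteq> A" "\<And>u v. u \<in> I \<Longrightarrow> v \<in> I \<Longrightarrow> u \<noteq> v \<Longrightarrow> (u, v) \<notin> Q"
    "card A \<le> 2 * (1 + 2 * g) * card I"
    using large_independent_subset[OF finA QA symQ Qg] by blast
  have finI: "finite I" by (rule finite_subset[OF I(1) finA])
  define F where "F = {(x, y). (x, y) \<in> E \<and> y \<notin> M}"
  define C where "C v = {w. (v, w) \<in> reach F r}" for v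
  \<comment> \<open>These are the possible first vertices in \<open>M\<close> of short walks from
    \<open>v\<close>. A walk ending in \<open>A\<close> ends in \<open>M\<close>, so it has such a
    vertex.\<close>
  define N where "N v = {m \<in> M. m \<noteq> v \<and> (\<exists>w\<in>C v. (w, m) \<in> E)}" for v
  have FE: "F \<subseteq> E" by (auto simp: F_def)
  have CD: "w = v \<or> (\<exists>p. p \<noteq> [] \<and> last p = w \<and> walk E (v # p) \<and> length p \<le> r \<and> set p \<inter> M = {})"
    if "w \<in> C v" for v w
    using that reach_imp_walk[of v w r E M] by (auto simp: C_def F_def)
  have CM: "w = v" if "w \<in> C v" "w \<in> M" for v w
    using CD[OF that(1)] that(2) by (metis disjoint_iff last_in_set)
  have CV: "C v \<subseteq> V" if "v \<in> V" for v
  proof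
    fix w assume "w \<in> C v"
    from CD[OF this] that show "w \<in> V"
      using walk_vertices[OF _ E(1)] by (metis last_in_set subsetD)
  qed
  have NI: "N v \<inter> I = {}" if v: "v \<in> I" for v
  proof (rule ccontr)
    assume "\<not> ?thesis"
    then obtain m w where m: "m \<in> I" "m \<noteq> v" "w \<in> C v" "(w, m) \<in> E" by (auto simp: N_def)
    from CD[OF m(3)] obtain p where p: "last (v # p) = w" "walk E (v # p)" "length p \<le> r" "set p \<inter> M = {}"
      by (metis last.simps list.size(3) le0 successively.simps(2) empty_set inf_bot_left)
    have "walk E (v # p @ [m])"
      using p m successively_append_iff[of _ "v # p" "[m]"] by auto
    with no_shortcut[of v m p] I v m p show False by auto
  qed
  \<comment> \<open>A common vertex of two balls of radius \<open>r\<close> would join the centres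
    by a walk with at most 2 * r interior vertices; hence the doubled radius of the branch
    sets.\<close>
  have Cdisj: "C u \<inter> C v = {}" if uv: "u \<in> I" "v \<in> I" "u \<noteq> v" for u v
  proof (rule ccontr)
    assume "\<not> ?thesis"
    then obtain w where w: "w \<in> C u" "w \<in> C v" by blast
    have "u \<in> M" "v \<in> M" using uv I AM by auto
    with w CM uv have wM: "w \<notin> M" "w \<noteq> u" "w \<noteq> v" by metis+
    with CD[OF w(1)] CD[OF w(2)] obtain p q where
      p: "p \<noteq> []" "last p = w" "walk E (u # p)" "length p \<le> r" "set p \<inter> M = {}" and
      q: "q \<noteq> []" "last q = w" "walk E (v # q)" "length q \<le> r" "set q \<inter> M = {}" by blast
    obtain p' where p': "p = p' @ [w]" using p(1,2) by (metis append_butlast_last_id)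
    obtain q' where q': "q = q' @ [w]" using q(1,2) by (metis append_butlast_last_id)
    have "walk E (rev (v # q))"
      using q(3) E(2) by (rule walk_rev)
    then have "walk E (w # rev q' @ [v])" unfolding q' by simp
    moreover have "walk E ((u # p') @ [w])" using p(3) unfolding p' by simp
    ultimately have "walk E ((u # p') @ w # rev q' @ [v])" by (rule walk_glue[rotated])
    then have "walk E (u # (p' @ w # rev q') @ [v])" by simp
    moreover have "set (p' @ w # rev q') \<inter> M = {}"
      using p(5) q(5) by (auto simp: p' q')
    moreover have "length (p' @ w # rev q') \<le> 2 * r" using p(4) q(4) by (simp add: p' q')
    ultimately show False
      using no_shortcut uv I(1) I(2)[OF uv] by blast
  qed
  have hits: "set p \<inter> N v \<noteq> {}"
    if v: "v \<in> A" and p: "walk E (v # p)" "length p \<le> r" "p \<noteq> []" "last p \<in> A - {v}" "set (butlast p) \<inter> A = {}" for v p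
  proof -
    have "last p \<in> set p \<inter> M" using p AM by auto
    then obtain p1 m p2 where s: "p = p1 @ m # p2" "m \<in> M" "\<forall>y\<in>set p1. y \<notin> M"
      using split_list_first_prop[of p "\<lambda>x. x \<in> M"] by blast
    have "m \<noteq> v" using p(4,5) v s by (cases p2 rule: rev_cases) (auto simp: butlast_append)
    have w: "walk E (v # p1)" "(last (v # p1), m) \<in> E"
      using p(1) s successively_append_iff[of _ "v # p1" "m # p2"] by auto
    have "set p1 \<inter> M = {}" using s(3) by blast
    from walk_imp_reach[OF w(1) this] have "(v, last (v # p1)) \<in> reach F (length p1)"
      unfolding F_def .
    moreover have "length p1 \<le> r" using p(2) s(1) by simp
    ultimately have "last (v # p1) \<in> C v"
      unfolding C_def mem_Collect_eq using subsetD[OF reach_mono] by blast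
    with w(2) s(1,2) \<open>m \<noteq> v\<close> have "m \<in> N v" by (auto simp: N_def)
    with s(1) show ?thesis by auto
  qed
  have finN: "finite (N v)" for v using finM by (auto simp: N_def)
  have "\<exists>v\<in>A. card (N v) \<le> K"
  proof (rule ccontr)
    assume "\<not> ?thesis"
    then have large: "K + 1 \<le> card (N v)" if "v \<in> I" for v using that I(1) by force
    \<comment> \<open>The second minor is indexed by \<open>M\<close>: balls for members of
      \<open>I\<close>, single vertices otherwise. As \<open>N v\<close> avoids \<open>I\<close>,
      every pair (v, m) with m in \<open>N v\<close> is one of its adjacencies.\<close>
    define D where "D x = (if x \<in> I then C x else {x})" for x
    have "shallow_model V E (2 * r) M D"
      unfolding shallow_model_def
    proof (intro conjI ballI impI finM)
      fix x assume x: "x \<in> M"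
      then show "D x \<subseteq> V" using MV CV by (auto simp: D_def)
      show "\<exists>c\<in>D x. \<forall>w\<in>D x. (c, w) \<in> reach (E \<inter> D x \<times> D x) (2 * r)"
      proof (rule bexI[of _ x])
        show "x \<in> D x" by (auto simp: D_def C_def reach_refl)
        show "\<forall>w\<in>D x. (x, w) \<in> reach (E \<inter> D x \<times> D x) (2 * r)"
        proof
          fix w assume w: "w \<in> D x"
          show "(x, w) \<in> reach (E \<inter> D x \<times> D x) (2 * r)"
          proof (cases "x \<in> I")
            case True
            with w have "(x, w) \<in> reach (E \<inter> C x \<times> C x) r"
              using reach_restrict_ball[of x w r F r E "C x"] FE by (auto simp: D_def C_def)
            with True reach_mono[of r "2 * r" "E \<inter> C x \<times> C x"] show ?thesis by (auto simp: D_def)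
          next
            case False
            with w show ?thesis by (simp add: D_def reach_refl)
          qed
        qed
      qed
    next
      fix x y assume "x \<in> M" "y \<in> M" "x \<noteq> y"
      then show "D x \<inter> D y = {}" using Cdisj CM by (auto simp: D_def)
    qed
    then have 1: "card (adjacent_pairs E M D) \<le> g * card M"
      using g MV by (auto simp: shallow_sparse_def)
    have "Sigma I N \<subseteq> adjacent_pairs E M D"
    proof
      fix z assume "z \<in> Sigma I N"
      then obtain v m where z: "z = (v, m)" "v \<in> I" "m \<in> N v" by auto
      with NI[OF z(2)] have "m \<notin> I" by auto
      with z I(1) AM show "z \<in> adjacent_pairs E M D" by (auto simp: adjacent_pairs_def D_def N_def)
    qed
    then have "card (Sigma I N) \<le> card (adjacent_pairs E M D)"
      by (intro card_mono finite_adjacent_pairs finM)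
    moreover have "(K + 1) * card I \<le> card (Sigma I N)"
    proof -
      have "(K + 1) * card I = (\<Sum>v\<in>I. K + 1)" by simp
      also have "\<dots> \<le> (\<Sum>v\<in>I. card (N v))" using large by (intro sum_mono) auto
      also have "\<dots> = card (Sigma I N)" using finI finN by simp
      finally show ?thesis .
    qed
    \<comment> \<open>\<open>K\<close> multiplies the losses: g adjacencies per vertex of
      \<open>M\<close>, 1 + 2 * r * g vertices of \<open>M\<close> per member of \<open>A\<close>, 2
      * (1 + 2 * g) members of \<open>A\<close> per member of \<open>I\<close>.\<close>
    ultimately have "(K + 1) * card I \<le> g * card M" using 1 by linarith
    also have "\<dots> \<le> g * ((1 + 2 * r * g) * (2 * (1 + 2 * g) * card I))"
      using cardM I(3) by (meson le_trans mult_le_mono2)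
    also have "\<dots> = K * card I" by (simp only: K mult.assoc)
    finally have "card I = 0" by simp
    with I(3) A(2) finA show False by simp
  qed
  then obtain v where v: "v \<in> A" "card (N v) \<le> K" by blast
  show ?thesis
    by (rule bexI[OF _ v(1)], rule exI[of _ "N v"]) (use v finN hits[OF v(1)] in blast)
qed

text \<open>The vertex found by \<open>sparse_hitting_vertex\<close> is removed from
  \<open>A\<close> and placed last, repeatedly. Removed vertices remain available inside walks, so
  \<open>A\<close> shrinks while the graph stays fixed. Such hitting sets bound the r-admissibility
  of the order.\<close>

lemma sparse_elimination_order:
  fixes V :: "'a set"
  assumes V: "finite V" and E: "E \<subseteq> V \<times> V" "sym E" and g: "shallow_sparse V E (2 * r) g"
    and K: "K = g * (1 + 2 * r * g) * (2 * (1 + 2 * g))"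
    and A: "A \<subseteq> V"
  shows "\<exists>(ord :: 'a \<Rightarrow> nat) H. inj_on ord A \<and> (\<forall>v\<in>A. finite (H v) \<and> card (H v) \<le> K \<and>
    (\<forall>p. walk E (v # p) \<longrightarrow> length p \<le> r \<longrightarrow> p \<noteq> [] \<longrightarrow> last p \<in> A \<longrightarrow> ord (last p) < ord v \<longrightarrow>
       (\<forall>u\<in>set (butlast p) \<inter> A. ord v < ord u) \<longrightarrow> set p \<inter> H v \<noteq> {}))"
  using finite_subset[OF A V] A
proof (induction A rule: finite_psubset_induct)
  case (psubset A)
  show ?case
  proof (cases "A = {}")
    case False
    obtain v H0 where v: "v \<in> A" and H0: "finite H0" "card H0 \<le> K"
      "\<And>p. walk E (v # p) \<Longrightarrow> length p \<le> r \<Longrightarrow> p \<noteq> [] \<Longrightarrow> last p \<in> A - {v} \<Longrightarrow>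
       set (butlast p) \<inter> A = {} \<Longrightarrow> set p \<inter> H0 \<noteq> {}"
      using sparse_hitting_vertex[OF V E g psubset.prems False K] by blast
    have "A - {v} \<subset> A" "A - {v} \<subseteq> V" using v psubset.prems by auto
    from psubset.IH[OF this] obtain ord :: "'a \<Rightarrow> nat" and H where ord: "inj_on ord (A - {v})"
      and Hfin: "\<And>u. u \<in> A - {v} \<Longrightarrow> finite (H u) \<and> card (H u) \<le> K"
      and H: "\<And>u p. u \<in> A - {v} \<Longrightarrow> walk E (u # p) \<Longrightarrow> length p \<le> r \<Longrightarrow> p \<noteq> [] \<Longrightarrow> last p \<in> A - {v} \<Longrightarrow>
        ord (last p) < ord u \<Longrightarrow> (\<forall>w\<in>set (butlast p) \<inter> (A - {v}). ord u < ord w) \<Longrightarrow> set p \<inter> H u \<noteq> {}"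
      by metis
    define top where "top = Suc (Max (insert 0 (ord ` (A - {v}))))"
    have top: "ord u < top" if "u \<in> A - {v}" for u
      using that psubset.hyps by (auto simp: top_def less_Suc_eq_le intro!: Max_ge)
    define ord' where "ord' = ord(v := top)"
    define H' where "H' = H(v := H0)"
    have eq: "ord' u = ord u" "H' u = H u" if "u \<noteq> v" for u using that by (auto simp: ord'_def H'_def)
    have eqv: "ord' v = top" "H' v = H0" by (auto simp: ord'_def H'_def)
    have inj: "inj_on ord' A"
    proof (rule inj_onI)
      fix x y assume "x \<in> A" "y \<in> A" "ord' x = ord' y"
      then show "x = y" using top[of x] top[of y] inj_onD[OF ord, of x y]
        by (cases "x = v"; cases "y = v") (auto simp: eq eqv)
    qed
    have "set p \<inter> H' u \<noteq> {}"
      if u: "u \<in> A" and p: "walk E (u # p)" "length p \<le> r" "p \<noteq> []" "last p \<in> A" "ord' (last p) < ord' u"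
        "\<forall>w\<in>set (butlast p) \<inter> A. ord' u < ord' w" for u p
    proof (cases "u = v")
      case True
      have "set (butlast p) \<inter> A = {}"
      proof (rule ccontr)
        assume "\<not> ?thesis"
        then obtain w where "w \<in> set (butlast p)" "w \<in> A" by blast
        with p(6) True have "top < ord' w" by (auto simp: eqv)
        with top[of w] \<open>w \<in> A\<close> show False by (cases "w = v") (auto simp: eq eqv)
      qed
      moreover have "last p \<in> A - {v}" using p(4,5) True by auto
      ultimately show ?thesis using H0(3)[of p] p True by (simp add: eqv)
    next
      case False
      have uA: "u \<in> A - {v}" using u False by simp
      have "last p \<noteq> v"
      proof
        assume "last p = v"
        with p(5) have "ord' v < ord' u" by (simp only:)
        then have "top < ord u" by (simp only: eq(1)[OF False] eqv(1))
        with top[OF uA] show False by simp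
      qed
      with p False have l: "last p \<in> A - {v}" "ord (last p) < ord u" by (auto simp: eq)
      have "\<forall>w\<in>set (butlast p) \<inter> (A - {v}). ord u < ord w"
      proof
        fix w assume "w \<in> set (butlast p) \<inter> (A - {v})"
        then have "w \<noteq> v" "ord' u < ord' w" using p(6) by auto
        then show "ord u < ord w" by (simp only: eq(1)[OF False] eq(1)[of w] simp_thms)
      qed
      from H[OF uA p(1-3) l this] False show ?thesis by (simp add: eq)
    qed
    moreover have "finite (H' u) \<and> card (H' u) \<le> K" if "u \<in> A" for u
      using that Hfin[of u] H0 by (cases "u = v") (auto simp: eq eqv)
    ultimately show ?thesis using inj by blast
  qed simp
qed

text \<open>If the last vertex \<open>z\<close> of a walk from \<open>x\<close> comes before all others in the elimination order, then
  the part of the walk up to the first vertex below \<open>x\<close> meets \<open>H x\<close>; continuing from there, \<open>z\<close> is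
  found by iterating \<open>H\<close>.\<close>

primrec iterated_reach :: "('a \<Rightarrow> 'a set) \<Rightarrow> nat \<Rightarrow> 'a \<Rightarrow> 'a set" where
  "iterated_reach H 0 x = {x}"
| "iterated_reach H (Suc i) x = insert x (\<Union>h\<in>H x. iterated_reach H i h)"

lemma iterated_reach_self: "x \<in> iterated_reach H i x"
  by (cases i) auto

lemma iterated_reach_Suc: "iterated_reach H i x \<subseteq> iterated_reach H (Suc i) x"
proof (induction i arbitrary: x)
  case (Suc i)
  then show ?case by (simp only: iterated_reach.simps) blast
qed simp

lemma sparse_hitting_sets:
  fixes V :: "'a set"
  assumes V: "finite V" and E: "E \<subseteq> V \<times> V" "sym E" and g: "shallow_sparse V E (2 * r) g"
    and K: "K = g * (1 + 2 * r * g) * (2 * (1 + 2 * g))"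
  shows "\<exists>R. (\<forall>x\<in>V. x \<in> R x \<and> R x \<subseteq> V \<and> card (R x) \<le> (K + 1) ^ r) \<and>
    (\<forall>w. walk E w \<longrightarrow> w \<noteq> [] \<longrightarrow> set w \<subseteq> V \<longrightarrow> length w \<le> Suc r \<longrightarrow> set w \<inter> R (hd w) \<inter> R (last w) \<noteq> {})"
proof -
  obtain ord :: "'a \<Rightarrow> nat" and H0 where ord: "inj_on ord V"
    and H0fin: "\<And>v. v \<in> V \<Longrightarrow> finite (H0 v) \<and> card (H0 v) \<le> K"
    and H0: "\<And>v p. v \<in> V \<Longrightarrow> walk E (v # p) \<Longrightarrow> length p \<le> r \<Longrightarrow> p \<noteq> [] \<Longrightarrow> last p \<in> V \<Longrightarrow>
      ord (last p) < ord v \<Longrightarrow> (\<forall>u\<in>set (butlast p) \<inter> V. ord v < ord u) \<Longrightarrow> set p \<inter> H0 v \<noteq> {}"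
    using sparse_elimination_order[OF V E g K order_refl] by metis
  define H where "H v = H0 v \<inter> V" for v
  have Hfin: "finite (H v)" "card (H v) \<le> K" if "v \<in> V" for v
    using H0fin[OF that] card_mono[of "H0 v" "H v"] by (auto simp: H_def)
  let ?R = "iterated_reach H"
  have RV: "?R i x \<subseteq> V" if "x \<in> V" for i x
    using that by (induction i arbitrary: x) (auto simp: H_def)
  have card: "card (?R i x) \<le> (K + 1) ^ i" if "x \<in> V" for i x
    using that
  proof (induction i arbitrary: x)
    case (Suc i)
    have "card (?R (Suc i) x) \<le> Suc (card (\<Union>h\<in>H x. ?R i h))"
      by (simp add: card_insert_le_m1)
    also have "card (\<Union>h\<in>H x. ?R i h) \<le> (\<Sum>h\<in>H x. card (?R i h))"
      by (rule card_UN_le[OF Hfin(1)[OF Suc.prems]])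
    also have "\<dots> \<le> (\<Sum>h\<in>H x. (K + 1) ^ i)"
      by (intro sum_mono Suc.IH) (auto simp: H_def)
    also have "\<dots> \<le> K * (K + 1) ^ i" using Hfin(2)[OF Suc.prems] by simp
    also have "Suc (K * (K + 1) ^ i) \<le> (K + 1) ^ Suc i" by simp
    finally show ?case by simp
  qed simp
  \<comment> \<open>Each use of \<open>H\<close> moves strictly further along the walk, so as many
    iterations suffice as the walk has steps.\<close>
  have reach: "last (x # p) \<in> ?R i x"
    if "walk E (x # p)" "set (x # p) \<subseteq> V" "length p \<le> i" "i \<le> r"
      "\<forall>u\<in>set (butlast (x # p)). ord (last (x # p)) < ord u" for i x p
    using that
  proof (induction i arbitrary: x p)
    case (Suc i)
    show ?case
    proof (cases "p = [] \<or> x \<in> set p")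
      case True
      then show ?thesis
      proof
        \<comment> \<open>A walk that returns to \<open>x\<close> is shortened at the return,
          because \<open>H0\<close> asks the vertices before the first lower one to lie strictly
          above \<open>x\<close>.\<close>
        assume "x \<in> set p"
        then obtain q1 q2 where q: "p = q1 @ x # q2" by (meson split_list)
        have "last (x # q2) \<in> ?R i x"
        proof (rule Suc.IH)
          show "walk E (x # q2)" using Suc.prems(1) q successively_append_iff[of _ "x # q1" "x # q2"] by auto
          show "\<forall>u\<in>set (butlast (x # q2)). ord (last (x # q2)) < ord u"
            using Suc.prems(5) q by (auto simp: butlast_append split: if_splits)
        qed (use Suc.prems q in auto)
        then show ?thesis using iterated_reach_Suc[of H i x] q by auto
      qed simp
    next
      case False
      then have ne: "p \<noteq> []" and xp: "x \<notin> set p" by auto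
      let ?z = "last p"
      have zx: "ord ?z < ord x" using Suc.prems(5) ne by auto
      then obtain p1 m p2 where s: "p = p1 @ m # p2" "ord m < ord x" "\<forall>u\<in>set p1. \<not> ord u < ord x"
        using split_list_first_prop[of p "\<lambda>u. ord u < ord x"] ne last_in_set by blast
      have "set (p1 @ [m]) \<inter> H0 x \<noteq> {}"
      proof (rule H0)
        show "walk E (x # p1 @ [m])"
          using Suc.prems(1) s successively_append_iff[of _ "x # p1 @ [m]" "p2"] by auto
        show "\<forall>u\<in>set (butlast (p1 @ [m])) \<inter> V. ord x < ord u"
        proof
          fix u assume u: "u \<in> set (butlast (p1 @ [m])) \<inter> V"
          then have "u \<noteq> x" "\<not> ord u < ord x" using xp s by auto
          with inj_onD[OF ord, of u x] u Suc.prems(2) show "ord x < ord u" by force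
        qed
      qed (use Suc.prems s in auto)
      then obtain h where h: "h \<in> set p" "h \<in> H0 x" using s by auto
      then have hH: "h \<in> H x" using Suc.prems(2) by (auto simp: H_def)
      from h obtain q1 q2 where q: "p = q1 @ h # q2" by (meson split_list)
      have "last (h # q2) \<in> ?R i h"
      proof (rule Suc.IH)
        show "walk E (h # q2)" using Suc.prems(1) q successively_append_iff[of _ "x # q1" "h # q2"] by auto
        show "\<forall>u\<in>set (butlast (h # q2)). ord (last (h # q2)) < ord u"
          using Suc.prems(5) q by (auto simp: butlast_append split: if_splits)
      qed (use Suc.prems q in auto)
      with hH q show ?thesis by auto
    qed
  qed simp
  have hit: "set w \<inter> ?R r (hd w) \<inter> ?R r (last w) \<noteq> {}"
    if w: "walk E w" "w \<noteq> []" "set w \<subseteq> V" "length w \<le> Suc r" for w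
  proof -
    \<comment> \<open>Cutting at the first occurrence of \<open>z\<close> for the front end, and at
      the last one with reversal for the back end, leaves \<open>z\<close> strictly below all other
      vertices of the part used.\<close>
    define z where "z = arg_min_on ord (set w)"
    have z: "z \<in> set w" "\<And>u. u \<in> set w \<Longrightarrow> ord z \<le> ord u"
      using w(2) by (auto simp: z_def intro: arg_min_if_finite arg_min_least)
    have less: "ord z < ord u" if "u \<in> set w" "u \<noteq> z" for u
      using z(2)[OF that(1)] inj_onD[OF ord, of z u] that z(1) w(3) by fastforce
    have "z \<in> ?R r (hd w)"
    proof -
      obtain a b where a: "w = a @ z # b" "z \<notin> set a" using split_list_first[OF z(1)] by blast
      show ?thesis
      proof (cases a)
        case Nil
        with a show ?thesis by (simp add: iterated_reach_self)
      next
        case (Cons x a')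
        have "last (x # a' @ [z]) \<in> ?R r x"
        proof (rule reach)
          show "walk E (x # a' @ [z])" using w(1) a Cons successively_append_iff[of _ "x # a' @ [z]" b] by auto
          show "\<forall>u\<in>set (butlast (x # a' @ [z])). ord (last (x # a' @ [z])) < ord u"
            using less a Cons by (auto simp: butlast_append)
        qed (use w a Cons in auto)
        then show ?thesis using a Cons by simp
      qed
    qed
    moreover have "z \<in> ?R r (last w)"
    proof -
      obtain a b where a: "w = a @ z # b" "z \<notin> set b" using split_list_last[OF z(1)] by blast
      show ?thesis
      proof (cases b rule: rev_cases)
        case Nil
        with a show ?thesis by (simp add: iterated_reach_self)
      next
        case (snoc b' y)
        have "last (y # rev b' @ [z]) \<in> ?R r y"
        proof (rule reach)
          have "walk E (z # b' @ [y])" using w(1) a snoc successively_append_iff[of _ a "z # b' @ [y]"] by auto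
          from walk_rev[OF this E(2)] have "walk E (rev (z # b' @ [y]))" .
          then show "walk E (y # rev b' @ [z])" by simp
          show "\<forall>u\<in>set (butlast (y # rev b' @ [z])). ord (last (y # rev b' @ [z])) < ord u"
            using less a snoc by (auto simp: butlast_append)
        qed (use w a snoc in auto)
        then show ?thesis using a snoc by simp
      qed
    qed
    ultimately show ?thesis using z(1) by blast
  qed
  show ?thesis
  proof (intro exI[of _ "?R r"] conjI ballI allI impI)
    fix x assume "x \<in> V"
    then show "x \<in> ?R r x" "?R r x \<subseteq> V" "card (?R r x) \<le> (K + 1) ^ r"
      using RV card by (simp_all add: iterated_reach_self)
  qed (use hit in simp)
qed

section \<open>Graphs, shallow minors and distance formulas\<close>

lemma pair_graph_iff:
  "pair_graph G \<longleftrightarrow> finite (pverts G) \<and> parcs G \<subseteq> pverts G \<times> pverts G \<and> sym (parcs G) \<and>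
     (\<forall>x. (x, x) \<notin> parcs G)"
proof
  assume "pair_graph G"
  then interpret pair_graph G .
  show "finite (pverts G) \<and> parcs G \<subseteq> pverts G \<times> pverts G \<and> sym (parcs G) \<and>
     (\<forall>x. (x, x) \<notin> parcs G)"
    using finite_verts wellformed' arcs_symmetric no_loops'
    by (intro conjI allI notI symI subrelI) (blast | simp)+
next
  assume a: "finite (pverts G) \<and> parcs G \<subseteq> pverts G \<times> pverts G \<and> sym (parcs G) \<and>
     (\<forall>x. (x, x) \<notin> parcs G)"
  then have "finite (parcs G)" using finite_subset by blast
  with a show "pair_graph G"
    by unfold_locales (auto simp: symmetric_def)
qed

section \<open>Distances as bounded reachability\<close>

lemma awalk_imp_reach:
  assumes "pair_graph G" "pre_digraph.awalk (with_proj G) x p y"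
  shows "(x, y) \<in> reach (parcs G) (length p)"
proof -
  interpret pair_graph G by fact
  show ?thesis using assms(2)
  proof (induction p arbitrary: x)
    case (Cons e p)
    then have "(x, snd e) \<in> (parcs G)\<^sup>=" "(snd e, y) \<in> reach (parcs G) (length p)"
      by (auto simp: awalk_Cons_iff)
    from relpow_Suc_I2[OF this] show ?case by simp
  qed (simp add: awalk_Nil_iff)
qed

lemma reach_imp_awalk:
  assumes "pair_graph G" "x \<in> pverts G" "(x, y) \<in> reach (parcs G) d"
  shows "\<exists>p. pre_digraph.awalk (with_proj G) x p y \<and> length p \<le> d"
proof -
  interpret pair_graph G by fact
  show ?thesis using assms(2,3)
  proof (induction d arbitrary: x)
    case 0
    then show ?case by (intro exI[of _ "[]"]) (simp add: awalk_Nil_iff)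
  next
    case (Suc d)
    from relpow_Suc_D2[OF Suc.prems(2)] obtain z where z: "(x, z) \<in> (parcs G)\<^sup>="
      "(z, y) \<in> reach (parcs G) d" by blast
    show ?case
    proof (cases "x = z")
      case True
      with Suc.IH[OF Suc.prems(1)] z(2) show ?thesis by (auto intro: le_SucI)
    next
      case False
      with z have xz: "(x, z) \<in> parcs G" by simp
      with Suc.IH[OF _ z(2)] wellformed' obtain p where "awalk z p y" "length p \<le> d" by blast
      with xz show ?thesis by (intro exI[of _ "(x, z) # p"]) (simp add: awalk_Cons_iff)
    qed
  qed
qed

text \<open>The distance is an infimum of extended reals. Comparing it strictly with d + 1 produces
  an actual walk, whose integral length is then at most \<open>d\<close>.\<close>

lemma graph_dist_le_iff:
  assumes G: "pair_graph G" and x: "x \<in> pverts G"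
  shows "graph_dist G x y \<le> ereal (real d) \<longleftrightarrow> (x, y) \<in> reach (parcs G) d"
proof -
  interpret pair_graph G by fact
  have cost: "awalk_cost (\<lambda>_. 1) p = real (length p)" for p :: "('a \<times> 'a) list"
    by (induction p) auto
  have dist: "graph_dist G x y = (INF p\<in>{p. awalk x p y}. ereal (real (length p)))"
    unfolding graph_dist_def \<mu>_def cost ..
  show ?thesis
  proof
    assume "graph_dist G x y \<le> ereal (real d)"
    also have "\<dots> < ereal (real (Suc d))" by simp
    finally obtain p where "awalk x p y" "length p \<le> d"
      unfolding dist INF_less_iff by auto
    with awalk_imp_reach[OF G] reach_mono show "(x, y) \<in> reach (parcs G) d" by blast
  next
    assume "(x, y) \<in> reach (parcs G) d"
    from reach_imp_awalk[OF G x this] obtain p where p: "awalk x p y" "length p \<le> d" by blast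
    have "graph_dist G x y \<le> ereal (real (length p))"
      unfolding dist using p(1) by (intro INF_lower) simp
    also have "\<dots> \<le> ereal (real d)" using p(2) by simp
    finally show "graph_dist G x y \<le> ereal (real d)" .
  qed
qed

section \<open>Shallow minors as families of branch sets\<close>

lemma radius_le_center:
  assumes "pair_graph B" "radius B \<le> ereal (real d)"
  shows "\<exists>c\<in>pverts B. \<forall>v\<in>pverts B. (c, v) \<in> reach (parcs B) d"
proof -
  have "radius B < ereal (real (Suc d))" using assms(2) by (rule le_less_trans) simp
  then obtain c where c: "c \<in> pverts B" "(SUP v\<in>pverts B. graph_dist B c v) < ereal (real (Suc d))"
    unfolding radius_def INF_less_iff by blast
  have "(c, v) \<in> reach (parcs B) d" if "v \<in> pverts B" for v
  proof -
    interpret pair_graph B by fact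
    have "graph_dist B c v \<le> (SUP v\<in>pverts B. graph_dist B c v)" using that by (rule SUP_upper)
    also note c(2)
    finally have "\<exists>p. awalk c p v \<and> awalk_cost (\<lambda>_. 1) p < real (Suc d)"
      unfolding graph_dist_def \<mu>_def INF_less_iff by auto
    moreover have "awalk_cost (\<lambda>_. 1) p = real (length p)" for p :: "('a \<times> 'a) list"
      by (induction p) auto
    ultimately obtain p where "awalk c p v" "length p \<le> d" by auto
    with awalk_imp_reach[OF assms(1)] reach_mono show ?thesis by blast
  qed
  with c(1) show ?thesis by blast
qed

lemma subgraph_with_proj_iff:
  assumes "pair_graph H" "pair_graph G"
  shows "subgraph (with_proj H) (with_proj G) \<longleftrightarrow> pverts H \<subseteq> pverts G \<and> parcs H \<subseteq> parcs G"
proof -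
  interpret H: pair_graph H by fact
  interpret G: pair_graph G by fact
  show ?thesis
    unfolding subgraph_def compatible_def using H.wf_digraph G.wf_digraph by simp
qed

lemma average_degree_eq:
  assumes "finite (pverts H)" "parcs H \<subseteq> pverts H \<times> pverts H"
  shows "average_degree H = real (card (parcs H)) / real (card (pverts H))"
proof -
  have fin: "finite (parcs H)" using assms finite_subset by blast
  have "(\<Sum>v\<in>pverts H. out_degree (with_proj H) v) = (\<Sum>v\<in>pverts H. card {e \<in> parcs H. fst e = v})"
    by (simp add: out_degree_def out_arcs_def)
  also have "\<dots> = (\<Sum>v\<in>pverts H. \<Sum>e\<in>{e \<in> parcs H. fst e = v}. 1)" by simp
  also have "\<dots> = (\<Sum>e\<in>parcs H. 1)"
    using assms fin by (intro sum.group) auto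
  finally show ?thesis
    unfolding average_degree_def by (simp flip: of_nat_sum)
qed

lemma connected_if_center:
  assumes B: "pair_graph B" and c: "c \<in> pverts B" "\<And>w. w \<in> pverts B \<Longrightarrow> (c, w) \<in> reach (parcs B) d"
  shows "Digraph_Component.connected (with_proj B)"
proof -
  interpret pair_graph B by fact
  have sym: "sym (parcs B)" using B by (simp add: pair_graph_iff)
  have "mk_symmetric (with_proj B) = B"
    unfolding mk_symmetric_def using arcs_symmetric by (intro pair_pre_digraph.equality) auto
  moreover have "strongly_connected (with_proj B)"
    unfolding strongly_connected_def
  proof (intro conjI ballI)
    show "verts (with_proj B) \<noteq> {}" using c by auto
    fix u v assume uv: "u \<in> verts (with_proj B)" "v \<in> verts (with_proj B)"
    then have "(u, v) \<in> reach (parcs B) (d + d)"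
      using reach_add[OF reach_sym[OF sym c(2)] c(2)] by simp
    from reach_imp_awalk[OF B _ this] uv obtain p where "awalk u p v" by auto
    then show "u \<rightarrow>\<^sup>*\<^bsub>with_proj B\<^esub> v" by (rule reachable_awalkI)
  qed
  ultimately show ?thesis by (simp add: Digraph_Component.connected_def)
qed

lemma contract_arc_iff:
  "(S, T) \<in> parcs (contract G P) \<longleftrightarrow> S \<in> pverts (contract G P) \<and> T \<in> pverts (contract G P) \<and>
     S \<noteq> T \<and> (\<exists>a\<in>S. \<exists>b\<in>T. (a, b) \<in> parcs G)"
  by (simp add: contract_def Let_def)

text \<open>The minor is formed in the subgraph induced on the union of the branch sets: contraction
  keeps uncontracted vertices as singletons, and outside vertices would dilute the average
  degree.\<close>

lemma bounded_expansion_imp_shallow_sparse: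
  assumes F: "\<And>G. G \<in> \<F> \<Longrightarrow> pair_graph G" and be: "bounded_expansion \<F>"
  shows "\<exists>g. \<forall>G\<in>\<F>. shallow_sparse (pverts G) (parcs G) d g"
proof -
  obtain g :: "nat \<Rightarrow> real" where g: "\<And>r G H. G \<in> \<F> \<Longrightarrow> depth_minor r H G \<Longrightarrow> average_degree H \<le> g r"
    using be unfolding bounded_expansion_def by blast
  have "shallow_sparse (pverts G) (parcs G) d (nat \<lceil>g d\<rceil>)" if G: "G \<in> \<F>" for G
    unfolding shallow_sparse_def
  proof (intro allI impI)
    fix X and B :: "'a \<Rightarrow> 'a set"
    assume X: "X \<subseteq> pverts G" and m: "shallow_model (pverts G) (parcs G) d X B"
    let ?V = "pverts G" and ?E = "parcs G"
    have pg: "finite ?V" "?E \<subseteq> ?V \<times> ?V" "sym ?E" "\<And>x. (x, x) \<notin> ?E"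
      using F[OF G] by (auto simp: pair_graph_iff)
    have finX: "finite X" using m by (simp add: shallow_model_def)
    have BV: "B x \<subseteq> ?V" and center: "\<exists>c\<in>B x. \<forall>w\<in>B x. (c, w) \<in> reach (?E \<inter> B x \<times> B x) d"
      if "x \<in> X" for x using m that by (auto simp: shallow_model_def)
    have disj: "B x \<inter> B y = {}" if "x \<in> X" "y \<in> X" "x \<noteq> y" for x y
      using m that by (auto simp: shallow_model_def)
    have ne: "B x \<noteq> {}" if "x \<in> X" for x using center[OF that] by blast
    have inj: "inj_on B X"
      by (rule inj_onI) (use disj ne in blast)
    define ind where "ind S = \<lparr>pverts = S, parcs = ?E \<inter> S \<times> S\<rparr>" for S
    have ind_simps: "pverts (ind S) = S" "parcs (ind S) = ?E \<inter> S \<times> S" for S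
      by (simp_all add: ind_def)
    have pind: "pair_graph (ind S)" if "S \<subseteq> ?V" for S
      using pg that finite_subset[OF that] by (auto simp: pair_graph_iff ind_simps sym_def)
    define U where "U = (\<Union>x\<in>X. B x)"
    have UV: "U \<subseteq> ?V" using BV by (auto simp: U_def)
    define \<B> where "\<B> = (\<lambda>x. ind (B x)) ` X"
    have pverts_\<B>: "pverts ` \<B> = B ` X" by (auto simp: \<B>_def ind_simps image_image)
    define H where "H = contract (ind U) (B ` X)"
    have pH: "pverts H = B ` X"
      unfolding H_def contract_def Let_def by (auto simp: ind_simps U_def)
    have aH: "parcs H = (\<lambda>(x, y). (B x, B y)) ` adjacent_pairs ?E X B" (is "_ = ?R")
    proof (intro set_eqI iffI)
      fix e assume "e \<in> parcs H"
      then obtain S T a b where e: "e = (S, T)" "S \<in> pverts H" "T \<in> pverts H" "S \<noteq> T"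
        "a \<in> S" "b \<in> T" "(a, b) \<in> ?E"
        unfolding H_def by (cases e) (auto simp only: contract_arc_iff ind_simps)
      then obtain x y where "S = B x" "T = B y" "x \<in> X" "y \<in> X" by (auto simp: pH)
      with e show "e \<in> ?R" by (auto simp: adjacent_pairs_def intro!: image_eqI[of _ _ "(x, y)"])
    next
      fix e assume "e \<in> ?R"
      then obtain x y a b where e: "e = (B x, B y)" "x \<in> X" "y \<in> X" "x \<noteq> y" "a \<in> B x" "b \<in> B y" "(a, b) \<in> ?E"
        by (auto simp: adjacent_pairs_def)
      have "B x \<noteq> B y" using inj e by (auto dest: inj_onD)
      moreover have "B x \<in> pverts H" "B y \<in> pverts H" using e by (auto simp: pH)
      moreover have "(a, b) \<in> parcs (ind U)" using e by (auto simp: ind_simps U_def)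
      ultimately show "e \<in> parcs H"
        using e(1,5,6) unfolding H_def by (simp only: contract_arc_iff) blast
    qed
    have "depth_minor d H G"
      unfolding depth_minor_def
    proof (intro exI[of _ "ind U"] exI[of _ \<B>] conjI ballI impI)
      show "pair_graph (ind U)" by (rule pind[OF UV])
      then show "subgraph (with_proj (ind U)) (with_proj G)"
        using F[OF G] UV by (subst subgraph_with_proj_iff) (auto simp: ind_simps)
      show "H = contract (ind U) (pverts ` \<B>)" by (simp add: H_def pverts_\<B>)
    next
      fix C assume "C \<in> \<B>"
      then obtain x where x: "x \<in> X" "C = ind (B x)" by (auto simp: \<B>_def)
      show p: "pair_graph C" using pind[OF BV] x by simp
      show "subgraph (with_proj C) (with_proj (ind U))"
        using x p pind[OF UV] by (subst subgraph_with_proj_iff) (auto simp: ind_simps U_def)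
      obtain c where c: "c \<in> pverts C" "\<And>w. w \<in> pverts C \<Longrightarrow> (c, w) \<in> reach (parcs C) d"
        using center[OF x(1)] by (auto simp: x(2) ind_simps)
      show "Digraph_Component.connected (with_proj C)" by (rule connected_if_center[OF p c])
      have "(SUP v\<in>pverts C. graph_dist C c v) \<le> ereal (real d)"
        using c by (intro SUP_least) (simp add: graph_dist_le_iff[OF p])
      then show "radius C \<le> ereal (real d)"
        unfolding radius_def by (rule INF_lower2[OF c(1)])
    next
      fix C D assume "C \<in> \<B>" "D \<in> \<B>" "C \<noteq> D"
      then obtain x y where "x \<in> X" "y \<in> X" "C = ind (B x)" "D = ind (B y)" "x \<noteq> y"
        by (auto simp: \<B>_def)
      with disj show "pverts C \<inter> pverts D = {}" by (simp add: ind_simps)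
    qed
    from g[OF G this] have avg: "average_degree H \<le> g d" .
    have "inj_on (\<lambda>(x, y). (B x, B y)) (adjacent_pairs ?E X B)"
    proof (rule inj_onI)
      fix s t assume "s \<in> adjacent_pairs ?E X B" "t \<in> adjacent_pairs ?E X B"
        "(case s of (x, y) \<Rightarrow> (B x, B y)) = (case t of (x, y) \<Rightarrow> (B x, B y))"
      then show "s = t"
        using inj by (cases s; cases t) (simp add: adjacent_pairs_def inj_on_eq_iff)
    qed
    then have card_aH: "card (parcs H) = card (adjacent_pairs ?E X B)"
      unfolding aH by (rule card_image)
    have card_pH: "card (pverts H) = card X" unfolding pH by (rule card_image[OF inj])
    have "average_degree H = real (card (parcs H)) / real (card (pverts H))"
      by (rule average_degree_eq) (use finX in \<open>auto simp: pH aH adjacent_pairs_def\<close>)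
    with avg have le: "real (card (adjacent_pairs ?E X B)) / real (card X) \<le> g d"
      by (simp add: card_aH card_pH)
    show "card (adjacent_pairs ?E X B) \<le> nat \<lceil>g d\<rceil> * card X"
    proof (cases "X = {}")
      case True
      then show ?thesis by (simp add: adjacent_pairs_def)
    next
      case False
      then have pos: "real (card X) > 0" using finX by (simp add: card_gt_0_iff)
      have "g d \<le> real (nat \<lceil>g d\<rceil>)" by linarith
      with le have "real (card (adjacent_pairs ?E X B)) / real (card X) \<le> real (nat \<lceil>g d\<rceil>)" by linarith
      then have "real (card (adjacent_pairs ?E X B)) \<le> real (nat \<lceil>g d\<rceil> * card X)"
        using pos by (simp add: pos_divide_le_eq)
      then show ?thesis by (simp only: of_nat_le_iff)
    qed
  qed
  then show ?thesis by blast
qed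

text \<open>\<open>x\<close> is the current vertex, variable 1 the target. Started at 0, the formula
  binds only even variables, so the target is never captured. The negated conjunction is the
  disjunction of staying and following an edge.\<close>

primrec distance_formula :: "nat \<Rightarrow> nat \<Rightarrow> fo_formula" where
  "distance_formula 0 x = Equal x 1"
| "distance_formula (Suc d) x = Exists (x + 2)
     (Conj (Neg (Conj (Neg (Equal x (x + 2))) (Neg (Edge x (x + 2))))) (distance_formula d (x + 2)))"

lemma free_vars_distance_formula: "free_vars (distance_formula d x) \<subseteq> {x, 1}"
proof (induction d arbitrary: x)
  case (Suc d)
  then show ?case using Suc[of "x + 2"] by auto
qed simp

lemma unary_symbols_distance_formula: "unary_symbols (distance_formula d x) = {}"
  by (induction d arbitrary: x) auto

lemma fo_sat_distance_formula:
  assumes "E \<subseteq> V \<times> V" "\<sigma> x \<in> V" "x \<noteq> 1 \<and> even x"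
  shows "fo_sat V E R \<sigma> (distance_formula d x) \<longleftrightarrow> (\<sigma> x, \<sigma> 1) \<in> reach E d"
  using assms(2,3)
proof (induction d arbitrary: x \<sigma>)
  case (Suc d)
  have "fo_sat V E R \<sigma> (distance_formula (Suc d) x) \<longleftrightarrow>
      (\<exists>a\<in>V. (\<sigma> x, a) \<in> E\<^sup>= \<and> (a, \<sigma> 1) \<in> reach E d)"
  proof -
    have "fo_sat V E R (\<sigma>(x + 2 := a)) (distance_formula d (x + 2)) \<longleftrightarrow> (a, \<sigma> 1) \<in> reach E d"
      if "a \<in> V" for a
      using Suc.IH[of "\<sigma>(x + 2 := a)" "x + 2"] that Suc.prems by (auto simp del: fun_upd_apply simp: fun_upd_same fun_upd_other)
    then show ?thesis by (auto simp del: add_2_eq_Suc')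
  qed
  also have "\<dots> \<longleftrightarrow> (\<sigma> x, \<sigma> 1) \<in> reach E (Suc d)"
  proof
    assume "\<exists>a\<in>V. (\<sigma> x, a) \<in> E\<^sup>= \<and> (a, \<sigma> 1) \<in> reach E d"
    then show "(\<sigma> x, \<sigma> 1) \<in> reach E (Suc d)" by (blast intro: relpow_Suc_I2)
  next
    assume "(\<sigma> x, \<sigma> 1) \<in> reach E (Suc d)"
    from relpow_Suc_D2[OF this] obtain a where "(\<sigma> x, a) \<in> E\<^sup>=" "(a, \<sigma> 1) \<in> reach E d" by blast
    then show "\<exists>a\<in>V. (\<sigma> x, a) \<in> E\<^sup>= \<and> (a, \<sigma> 1) \<in> reach E d"
      using assms(1) Suc.prems by blast
  qed
  finally show ?case .
qed simp

lemma sketchable_cong: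
  assumes "\<And>G x y. G \<in> \<F> \<Longrightarrow> x \<in> pverts G \<Longrightarrow> y \<in> pverts G \<Longrightarrow> f G x y = f' G x y" "sketchable \<F> f"
  shows "sketchable \<F> f'"
proof -
  have "is_sketch \<F> f D s \<longleftrightarrow> is_sketch \<F> f' D s" for D s
    unfolding is_sketch_def using assms(1) by (simp cong: ball_cong)
  with assms(2) show ?thesis by (simp add: sketchable_def)
qed

lemma first_order_imp_small_distance_sketchable:
  assumes F: "\<And>G. G \<in> \<F> \<Longrightarrow> pair_graph G" and fo: "first_order_sketchable \<F>"
  shows "small_distance_sketchable \<F>"
  unfolding small_distance_sketchable_def
proof
  fix r
  let ?f = "\<lambda>G u v. Some (fo_sat (pverts G) (parcs G) (\<lambda>_. {}) ((\<lambda>_. v)(0 := u)) (distance_formula r 0))"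
  have "sketchable \<F> ?f"
    using fo[unfolded first_order_sketchable_def, rule_format, of "distance_formula r 0" 0 "\<lambda>_ _. {}"]
      free_vars_distance_formula[of r 0] by (simp add: unary_symbols_distance_formula)
  moreover have "?f G u v = Some (graph_dist G u v \<le> ereal (real r))"
    if G: "G \<in> \<F>" and uv: "u \<in> pverts G" for G u v
    using fo_sat_distance_formula[of "parcs G" "pverts G" "(\<lambda>_. v)(0 := u)" 0 "\<lambda>_. {}" r]
      F[OF G] uv by (simp add: graph_dist_le_iff pair_graph_iff)
  ultimately show "sketchable \<F> (\<lambda>G x y. Some (graph_dist G x y \<le> ereal (real r)))"
    by (rule sketchable_cong[rotated])
qed

section \<open>Sketchable classes have bounded expansion\<close>

text \<open>Averaging over all subsets of \<open>W\<close>: exactly a quarter of them separate a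
  given pair of distinct elements in the prescribed direction.\<close>

lemma large_directed_cut:
  assumes W: "finite W" and N: "N \<subseteq> W \<times> W" "\<And>x. (x, x) \<notin> N"
  shows "\<exists>X\<subseteq>W. card N \<le> 4 * card {(x, y) \<in> N. x \<in> X \<and> y \<notin> X}"
proof (cases "N = {}")
  case False
  have finN: "finite N" using N(1) W finite_subset by blast
  let ?cut = "\<lambda>X. {e \<in> N. fst e \<in> X \<and> snd e \<notin> X}"
  have separated: "4 * card {X \<in> Pow W. fst e \<in> X \<and> snd e \<notin> X} = 2 ^ card W" if e: "e \<in> N" for e
  proof -
    obtain x y where xy: "e = (x, y)" "x \<in> W" "y \<in> W" "x \<noteq> y" using e N by (cases e) auto
    let ?W = "W - {x, y}"
    have "{X \<in> Pow W. fst e \<in> X \<and> snd e \<notin> X} = insert x ` Pow ?W"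
    proof (intro set_eqI iffI)
      fix X assume "X \<in> {X \<in> Pow W. fst e \<in> X \<and> snd e \<notin> X}"
      then have "X = insert x (X - {x})" "X - {x} \<in> Pow ?W" using xy by auto
      then show "X \<in> insert x ` Pow ?W" by (rule image_eqI)
    qed (use xy in auto)
    moreover have "inj_on (insert x) (Pow ?W)"
    proof (rule inj_onI)
      fix A B assume "A \<in> Pow ?W" "B \<in> Pow ?W" "insert x A = insert x B"
      then show "A = B" using insert_ident[of x A B] by blast
    qed
    ultimately have "card {X \<in> Pow W. fst e \<in> X \<and> snd e \<notin> X} = 2 ^ card ?W"
      using W by (simp add: card_image card_Pow)
    moreover have "card W = card ?W + 2"
      using xy W card_Diff_subset[of "{x, y}" W] card_mono[OF W, of "{x, y}"] by simp
    ultimately show ?thesis by (simp add: power_add)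
  qed
  show ?thesis
  proof (rule ccontr)
    assume neg: "\<not> ?thesis"
    have small: "4 * card (?cut X) < card N" if "X \<in> Pow W" for X
    proof -
      have "{(x, y) \<in> N. x \<in> X \<and> y \<notin> X} = ?cut X" by auto
      with neg that show ?thesis by (auto simp: not_le)
    qed
    have "(\<Sum>X\<in>Pow W. 4 * card (?cut X)) < (\<Sum>X\<in>Pow W. card N)"
      using W small by (intro sum_strict_mono) auto
    also have "\<dots> = 2 ^ card W * card N" using W by (simp add: card_Pow)
    also have "\<dots> = (\<Sum>e\<in>N. 4 * card {X \<in> Pow W. fst e \<in> X \<and> snd e \<notin> X})"
      using separated by simp
    also have "\<dots> = 4 * (\<Sum>e\<in>N. \<Sum>X\<in>Pow W. if fst e \<in> X \<and> snd e \<notin> X then 1 else 0)"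
      using W by (simp add: sum_distrib_left sum.If_cases Int_def)
    also have "\<dots> = 4 * (\<Sum>X\<in>Pow W. \<Sum>e\<in>N. if fst e \<in> X \<and> snd e \<notin> X then 1 else 0)"
      by (subst sum.swap) simp
    also have "\<dots> = (\<Sum>X\<in>Pow W. 4 * card (?cut X))"
      using finN by (simp add: sum_distrib_left sum.If_cases Int_def)
    finally show False by simp
  qed
qed auto

lemma large_fiber:
  assumes "finite Q" "finite K" "f ` Q \<subseteq> K" "Q \<noteq> {}"
  shows "\<exists>k\<in>K. card Q \<le> card K * card {q \<in> Q. f q = k}"
proof (rule ccontr)
  assume neg: "\<not> ?thesis"
  have "K \<noteq> {}" using assms by auto
  have "card K * card Q = (\<Sum>k\<in>K. card K * card {q \<in> Q. f q = k})"
  proof -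
    have "card Q = (\<Sum>k\<in>K. \<Sum>q\<in>{q \<in> Q. f q = k}. 1)"
      using sum.group[OF assms(1-3), of "\<lambda>_. 1 :: nat"] by simp
    then show ?thesis by (simp add: sum_distrib_left)
  qed
  also have "\<dots> < (\<Sum>k\<in>K. card Q)"
    using neg \<open>K \<noteq> {}\<close> assms(2) by (intro sum_strict_mono) (auto simp: not_le)
  finally show False by simp
qed

lemma potential_bound:
  fixes h :: "'a \<Rightarrow> int"
  assumes "\<And>u v. (u, v) \<in> E \<Longrightarrow> h v \<le> h u + 1" "(x, y) \<in> reach E d"
  shows "h y \<le> h x + int d"
  using assms(2)
proof (induction d arbitrary: y)
  case (Suc d)
  then obtain z where z: "(x, z) \<in> reach E d" "z = y \<or> (z, y) \<in> E" by auto
  from Suc.IH[OF z(1)] z(2) assms(1)[of z y] show ?case by auto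
qed simp

text \<open>Deleting cross edges between cells is visible in the distances between the centres of the
  cells: if all cross edges leave a cell in \<open>X\<close> at depth \<open>i\<close> and enter a cell outside \<open>X\<close> at depth
  \<open>j\<close>, two centres of non-adjacent cells on different sides are at distance at least \<open>i + j + 3\<close>,
  which the potential \<open>h\<close> certifies.\<close>

lemma cell_distance:
  fixes \<C> :: "'a set set"
  assumes disj: "\<And>A B. A \<in> \<C> \<Longrightarrow> B \<in> \<C> \<Longrightarrow> A \<noteq> B \<Longrightarrow> A \<inter> B = {}"
    and inner: "\<And>u v. (u, v) \<in> I \<Longrightarrow> \<exists>A\<in>\<C>. u \<in> A \<and> v \<in> A" and symI: "sym I"
    and cen: "\<And>A. A \<in> \<C> \<Longrightarrow> cen A \<in> A"
    and depth: "\<And>A v. A \<in> \<C> \<Longrightarrow> v \<in> A \<Longrightarrow> (cen A, v) \<in> reach I (dep v)"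
      "\<And>A. A \<in> \<C> \<Longrightarrow> dep (cen A) = 0" "\<And>u v. (u, v) \<in> I \<Longrightarrow> dep v \<le> Suc (dep u)"
    and cross: "\<And>A B. (A, B) \<in> T \<Longrightarrow> A \<in> \<C> \<and> B \<in> \<C> \<and> A \<in> X \<and> B \<notin> X \<and>
       s (A, B) \<in> A \<and> t (A, B) \<in> B \<and> dep (s (A, B)) = i \<and> dep (t (A, B)) = j"
    and AB: "A \<in> \<C>" "B \<in> \<C>" "A \<in> X" "B \<notin> X"
    and E: "E = I \<union> (\<lambda>e. (s e, t e)) ` T \<union> (\<lambda>e. (t e, s e)) ` T"
  shows "(cen A, cen B) \<in> reach E (i + j + 1) \<longleftrightarrow> (A, B) \<in> T"
proof
  assume e: "(A, B) \<in> T"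
  have IE: "reach I d \<subseteq> reach E d" for d by (rule reach_mono_rel) (auto simp: E)
  have "(cen A, s (A, B)) \<in> reach E i" using depth(1)[OF AB(1), of "s (A, B)"] cross[OF e] IE by auto
  moreover have "(s (A, B), t (A, B)) \<in> reach E 1" using e by (auto simp: E)
  moreover have "(t (A, B), cen B) \<in> reach E j"
    using reach_sym[OF symI depth(1)[OF AB(2), of "t (A, B)"]] cross[OF e] IE by auto
  ultimately have "(cen A, cen B) \<in> reach E (i + 1 + j)" by (blast intro: reach_add)
  then show "(cen A, cen B) \<in> reach E (i + j + 1)" by (simp add: add.commute add.left_commute)
next
  assume r: "(cen A, cen B) \<in> reach E (i + j + 1)"
  show "(A, B) \<in> T"
  proof (rule ccontr)
    assume nT: "(A, B) \<notin> T"
    define cell where "cell v = (THE C. C \<in> \<C> \<and> v \<in> C)" for v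
    have cell: "cell v = C" if "C \<in> \<C>" "v \<in> C" for v C
      unfolding cell_def using that disj by (intro the_equality) blast+
    \<comment> \<open>Kept cross edges join the values i and i + 1 at \<open>A\<close>, i + 2 and i
      + 1 between other cells, i + 2 and i + 3 at \<open>B\<close>. Only an edge from
      \<open>A\<close> to \<open>B\<close> would jump by 3, so every detour crosses at least three
      times.\<close>
    define h :: "'a \<Rightarrow> int" where "h v =
      (if cell v = A then int (dep v) else if cell v = B then int (i + j + 3) - int (dep v)
       else if cell v \<in> X then int (i + 2) else int (i + 1))" for v
    have hA: "h v = int (dep v)" if "cell v = A" for v using that by (simp add: h_def)
    have hB: "h v = int (i + j + 3) - int (dep v)" if "cell v = B" for v using that AB by (auto simp: h_def)
    have hX: "h v = int (i + 2)" if "cell v \<in> X" "cell v \<noteq> A" for v using that AB by (auto simp: h_def)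
    have hY: "h v = int (i + 1)" if "cell v \<notin> X" "cell v \<noteq> B" for v using that AB by (auto simp: h_def)
    have inner_step: "h v \<le> h u + 1" if uv: "(u, v) \<in> I" for u v
    proof -
      obtain C where "C \<in> \<C>" "u \<in> C" "v \<in> C" using inner[OF uv] by blast
      then have c: "cell u = C" "cell v = C" by (simp_all add: cell)
      have d: "dep v \<le> Suc (dep u)" "dep u \<le> Suc (dep v)" using depth(3) uv symI by (auto dest: symD)
      show ?thesis unfolding h_def c using d by auto
    qed
    have cross_step: "h (s e) \<le> h (t e) + 1 \<and> h (t e) \<le> h (s e) + 1" if e: "e \<in> T" for e
    proof -
      obtain C D where CD: "e = (C, D)" by (meson surj_pair)
      note c = cross[OF e[unfolded CD]]
      have cells: "cell (s e) = C" "cell (t e) = D" using c by (simp_all add: CD cell)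
      consider "C = A" "D \<noteq> B" | "C \<noteq> A" "D = B" | "C \<noteq> A" "D \<noteq> B" using nT e CD by auto
      then show ?thesis
      proof cases
        case 1
        then show ?thesis using hA[of "s e"] hY[of "t e"] cells c CD by auto
      next
        case 2
        then show ?thesis using hX[of "s e"] hB[of "t e"] cells c CD by auto
      next
        case 3
        then show ?thesis using hX[of "s e"] hY[of "t e"] cells c CD by auto
      qed
    qed
    have "h (cen B) \<le> h (cen A) + int (i + j + 1)"
    proof (rule potential_bound[OF _ r])
      fix u v assume "(u, v) \<in> E"
      then show "h v \<le> h u + 1" unfolding E using inner_step cross_step by auto
    qed
    moreover have "cell (cen A) = A" "cell (cen B) = B" using AB cen cell by auto
    ultimately show False using depth(2) AB hA[of "cen A"] hB[of "cen B"] by simp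
  qed
qed

lemma small_distance_sketchable_imp_bounded_expansion:
  fixes \<F> :: "'a pair_pre_digraph set"
  assumes F: "\<And>G. G \<in> \<F> \<Longrightarrow> pair_graph G" and mono: "monotone_class \<F>"
    and sk: "small_distance_sketchable \<F>"
  shows "bounded_expansion \<F>"
proof -
  have "\<forall>d. \<exists>D c. is_sketch \<F> (\<lambda>G x y. Some (graph_dist G x y \<le> ereal (real d))) D (\<lambda>_. c)"
    using sk unfolding small_distance_sketchable_def sketchable_def .
  from choice[OF this] obtain D where
    "\<forall>d. \<exists>c. is_sketch \<F> (\<lambda>G x y. Some (graph_dist G x y \<le> ereal (real d))) (D d) (\<lambda>_. c)"
    by (elim exE)
  from choice[OF this] obtain c where sketch:
    "\<forall>d. is_sketch \<F> (\<lambda>G x y. Some (graph_dist G x y \<le> ereal (real d))) (D d) (\<lambda>_. c d)"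
    by (elim exE)
  \<comment> \<open>The factor 4 comes from the directed cut, (r + 1)^2 from fixing two depths, 13 *
    (c + 1) from the counting bound. The threshold i + j + 1 is at most 2 * r + 1, and the sum
    dominates the sketch size of each threshold in that range.\<close>
  define g where "g r = 4 * (Suc r * Suc r) * (13 * ((\<Sum>d\<le>2 * r + 1. c d) + 1))" for r
  have "average_degree H \<le> real (g r)" if G: "G \<in> \<F>" and minor: "depth_minor r H G" for r G H
  proof -
    obtain G' \<B> where dm: "pair_graph G' \<and> subgraph (with_proj G') (with_proj G) \<and>
        (\<forall>B\<in>\<B>. pair_graph B \<and> subgraph (with_proj B) (with_proj G') \<and>
           Digraph_Component.connected (with_proj B) \<and> radius B \<le> ereal (real r)) \<and>
        (\<forall>B\<in>\<B>. \<forall>C\<in>\<B>. B \<noteq> C \<longrightarrow> pverts B \<inter> pverts C = {}) \<and>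
        H = contract G' (pverts ` \<B>)"
      using minor unfolding depth_minor_def by (elim exE)
    have G': "pair_graph G'" "subgraph (with_proj G') (with_proj G)"
      and H: "H = contract G' (pverts ` \<B>)" using dm by simp_all
    have \<B>: "pair_graph B \<and> subgraph (with_proj B) (with_proj G') \<and> radius B \<le> ereal (real r)"
      if "B \<in> \<B>" for B using dm that by simp
    have \<B>disj: "pverts B \<inter> pverts C = {}" if "B \<in> \<B>" "C \<in> \<B>" "B \<noteq> C" for B C
      using dm that by simp
    have G'p: "finite (pverts G')" "parcs G' \<subseteq> pverts G' \<times> pverts G'" "sym (parcs G')" "\<And>x. (x, x) \<notin> parcs G'"
      using G'(1) by (auto simp: pair_graph_iff)
    have G'sub: "pverts G' \<subseteq> pverts G" "parcs G' \<subseteq> parcs G"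
      using G'(2) subgraph_with_proj_iff[OF G'(1) F[OF G]] by auto
    have Bsub: "pverts B \<subseteq> pverts G'" "parcs B \<subseteq> parcs G'" "parcs B \<subseteq> pverts B \<times> pverts B" "sym (parcs B)"
      if "B \<in> \<B>" for B
      using \<B>[OF that] subgraph_with_proj_iff[of B G'] G'(1) by (auto simp: pair_graph_iff)
    define \<C> where "\<C> = pverts H"
    have \<C>: "\<C> = pverts ` \<B> \<union> {{v} |v. v \<in> pverts G' - \<Union>(pverts ` \<B>)}"
      by (simp add: \<C>_def H contract_def Let_def)
    have \<C>sub: "C \<subseteq> pverts G'" if "C \<in> \<C>" for C using that Bsub(1) by (auto simp: \<C>)
    have fin\<C>: "finite \<C>"
      using \<C>sub G'p(1) by (intro finite_subset[of \<C> "Pow (pverts G')"]) auto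
    have \<C>disj: "A \<inter> B = {}" if AB: "A \<in> \<C>" "B \<in> \<C>" "A \<noteq> B" for A B
    proof (rule ccontr)
      assume "A \<inter> B \<noteq> {}"
      then obtain v where v: "v \<in> A" "v \<in> B" by blast
      have block: "C \<in> pverts ` \<B>" if "v \<in> \<Union>(pverts ` \<B>)" "C \<in> \<C>" "v \<in> C" for C
        using that unfolding \<C> by auto
      show False
      proof (cases "v \<in> \<Union>(pverts ` \<B>)")
        case True
        obtain B1 where B1: "B1 \<in> \<B>" "A = pverts B1" using block[OF True AB(1) v(1)] by (elim imageE)
        obtain B2 where B2: "B2 \<in> \<B>" "B = pverts B2" using block[OF True AB(2) v(2)] by (elim imageE)
        have "B1 \<noteq> B2" using AB(3) unfolding B1(2) B2(2) by blast
        with \<B>disj[OF B1(1) B2(1)] B1(2) B2(2) v show False by auto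
      next
        case False
        with AB v show False unfolding \<C> by auto
      qed
    qed
    \<comment> \<open>Other edges of \<open>G'\<close> inside a branch set are dropped, so depths
      are measured in the branch graphs alone and do not depend on the cross edges kept.\<close>
    define I where "I = (\<Union>B\<in>\<B>. parcs B)"
    have symI: "sym I" using Bsub(4) by (auto simp: I_def sym_def)
    have IG': "I \<subseteq> parcs G'" using Bsub(2) by (auto simp: I_def)
    have inner: "\<exists>A\<in>\<C>. u \<in> A \<and> v \<in> A" if "(u, v) \<in> I" for u v
      using that Bsub(3) by (fastforce simp: I_def \<C>)
    have center: "\<exists>x\<in>A. \<forall>v\<in>A. (x, v) \<in> reach I r" if A: "A \<in> \<C>" for A
    proof -
      consider B where "B \<in> \<B>" "A = pverts B" | v where "A = {v}" using A by (auto simp: \<C>)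
      then show ?thesis
      proof cases
        case 1
        have "reach (parcs B) r \<subseteq> reach I r" using 1 by (intro reach_mono_rel) (auto simp: I_def)
        with radius_le_center[of B r] \<B>[OF 1(1)] 1(2) show ?thesis by blast
      qed (simp add: reach_refl)
    qed
    define cen where "cen A = (SOME x. x \<in> A \<and> (\<forall>v\<in>A. (x, v) \<in> reach I r))" for A
    have cen: "cen A \<in> A" "\<And>v. v \<in> A \<Longrightarrow> (cen A, v) \<in> reach I r" if "A \<in> \<C>" for A
    proof -
      have "\<exists>x. x \<in> A \<and> (\<forall>v\<in>A. (x, v) \<in> reach I r)" using center[OF that] by blast
      from someI_ex[OF this] have "cen A \<in> A \<and> (\<forall>v\<in>A. (cen A, v) \<in> reach I r)"
        unfolding cen_def .
      then show "cen A \<in> A" "\<And>v. v \<in> A \<Longrightarrow> (cen A, v) \<in> reach I r" by simp_all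
    qed
    define cell where "cell v = (THE C. C \<in> \<C> \<and> v \<in> C)" for v
    have cell: "cell v = C" if "C \<in> \<C>" "v \<in> C" for v C
      unfolding cell_def
    proof (rule the_equality)
      show "C \<in> \<C> \<and> v \<in> C" using that by simp
      show "C' = C" if "C' \<in> \<C> \<and> v \<in> C'" for C'
        using that \<open>C \<in> \<C>\<close> \<open>v \<in> C\<close> \<C>disj[of C' C] by auto
    qed
    define dep where "dep v = (LEAST d. (cen (cell v), v) \<in> reach I d)" for v
    have dep_least: "dep v \<le> d" if "A \<in> \<C>" "v \<in> A" "(cen A, v) \<in> reach I d" for A v d
      unfolding dep_def cell[OF that(1,2)] using that(3) by (rule Least_le)
    have dep_reach: "(cen A, v) \<in> reach I (dep v)" if "A \<in> \<C>" "v \<in> A" for A v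
      unfolding dep_def cell[OF that] using cen(2)[OF that] by (rule LeastI)
    have dep_r: "dep v \<le> r" if "A \<in> \<C>" "v \<in> A" for A v
      using dep_least[OF that cen(2)[OF that]] .
    have dep0: "dep (cen A) = 0" if "A \<in> \<C>" for A
      using dep_least[OF that cen(1)[OF that], of 0] by simp
    have dep_step: "dep v \<le> Suc (dep u)" if uv: "(u, v) \<in> I" for u v
    proof -
      obtain A where A: "A \<in> \<C>" "u \<in> A" "v \<in> A" using inner[OF uv] by blast
      have "(cen A, v) \<in> reach I (Suc (dep u))"
        using dep_reach[OF A(1,2)] uv by (auto intro: relpow_Suc_I)
      then show ?thesis by (rule dep_least[OF A(1,3)])
    qed
    have arcH: "(A, B) \<in> parcs H \<longleftrightarrow> A \<in> \<C> \<and> B \<in> \<C> \<and> A \<noteq> B \<and> (\<exists>a\<in>A. \<exists>b\<in>B. (a, b) \<in> parcs G')" for A B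
      unfolding H contract_arc_iff \<C>_def ..
    have finH: "finite (parcs H)"
      using fin\<C> arcH by (intro finite_subset[of "parcs H" "\<C> \<times> \<C>"]) auto
    have ex_arc: "\<exists>ab. fst ab \<in> fst e \<and> snd ab \<in> snd e \<and> ab \<in> parcs G'" if "e \<in> parcs H" for e
    proof -
      have "(fst e, snd e) \<in> parcs H" using that by simp
      then obtain a b where "a \<in> fst e" "b \<in> snd e" "(a, b) \<in> parcs G'" unfolding arcH by blast
      then show ?thesis by (intro exI[of _ "(a, b)"]) simp
    qed
    \<comment> \<open>One edge of \<open>G'\<close> represents each arc of the minor. Opposite arcs
      may get different representatives, but the directed cut retains at most one of the
      two.\<close>
    define arc where "arc e = (SOME ab. fst ab \<in> fst e \<and> snd ab \<in> snd e \<and> ab \<in> parcs G')" for e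
    have arc: "fst (arc e) \<in> fst e \<and> snd (arc e) \<in> snd e \<and> arc e \<in> parcs G'" if "e \<in> parcs H" for e
      unfolding arc_def by (rule someI_ex[OF ex_arc[OF that]])
    show ?thesis
    proof (cases "parcs H = {}")
      case True
      then have "average_degree H = 0" using average_degree_eq[of H] fin\<C> by (simp add: \<C>_def)
      then show ?thesis by simp
    next
      case False
      have "\<exists>X\<subseteq>\<C>. card (parcs H) \<le> 4 * card {(x, y) \<in> parcs H. x \<in> X \<and> y \<notin> X}"
        by (rule large_directed_cut[OF fin\<C>]) (use arcH in auto)
      then obtain X where X: "card (parcs H) \<le> 4 * card {(x, y) \<in> parcs H. x \<in> X \<and> y \<notin> X}" by blast
      define N where "N = {(x, y) \<in> parcs H. x \<in> X \<and> y \<notin> X}"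
      have NH: "N \<subseteq> parcs H" by (auto simp: N_def)
      have finN: "finite N" using NH finH finite_subset by blast
      have "N \<noteq> {}" using X False finH by (auto simp: N_def[symmetric])
      have "\<exists>k\<in>{..r} \<times> {..r}. card N \<le> card ({..r} \<times> {..r}) *
          card {e \<in> N. (dep (fst (arc e)), dep (snd (arc e))) = k}"
      proof (rule large_fiber[OF finN _ _ \<open>N \<noteq> {}\<close>])
        show "(\<lambda>e. (dep (fst (arc e)), dep (snd (arc e)))) ` N \<subseteq> {..r} \<times> {..r}"
        proof (rule image_subsetI)
          fix e assume "e \<in> N"
          then have "e \<in> parcs H" using NH by blast
          moreover from this have "fst e \<in> \<C>" "snd e \<in> \<C>" using arcH[of "fst e" "snd e"] by auto
          ultimately show "(dep (fst (arc e)), dep (snd (arc e))) \<in> {..r} \<times> {..r}"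
            using arc dep_r by auto
        qed
      qed simp
      then obtain i j where ij: "i \<le> r" "j \<le> r"
        and cardN: "card N \<le> Suc r * Suc r * card {e \<in> N. (dep (fst (arc e)), dep (snd (arc e))) = (i, j)}"
        by auto
      define M where "M = {e \<in> N. (dep (fst (arc e)), dep (snd (arc e))) = (i, j)}"
      have MN: "M \<subseteq> N" by (auto simp: M_def)
      have Mprops: "A \<in> \<C> \<and> B \<in> \<C> \<and> A \<in> X \<and> B \<notin> X \<and> fst (arc (A, B)) \<in> A \<and> snd (arc (A, B)) \<in> B \<and>
          dep (fst (arc (A, B))) = i \<and> dep (snd (arc (A, B))) = j \<and> arc (A, B) \<in> parcs G'"
        if "(A, B) \<in> M" for A B
        using that arc[of "(A, B)"] arcH[of A B] by (auto simp: M_def N_def)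
      let ?d = "i + j + 1"
      have cen_inj: "inj_on cen \<C>"
      proof (rule inj_onI)
        fix A B assume "A \<in> \<C>" "B \<in> \<C>" "cen A = cen B"
        then show "A = B" using \<C>disj[of A B] cen(1)[of A] cen(1)[of B] by auto
      qed
      define cc where "cc = (\<lambda>(A, B). (cen A, cen B))"
      have cc_inj: "inj_on cc M"
      proof (rule inj_onI)
        fix e e' assume e: "e \<in> M" "e' \<in> M" "cc e = cc e'"
        obtain A B A' B' where "e = (A, B)" "e' = (A', B')" by (cases e; cases e')
        with e Mprops[of A B] Mprops[of A' B'] show "e = e'"
          using inj_onD[OF cen_inj] by (auto simp: cc_def)
      qed
      have "card (cc ` M) \<le> 13 * (c ?d + 1) * card (cen ` \<C>)"
      proof (rule sketchable_pairs_sparse[where D = "D ?d"])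
        show "finite (cen ` \<C>)" using fin\<C> by simp
        show "cc ` M \<subseteq> cen ` \<C> \<times> cen ` \<C>" using Mprops by (auto simp: cc_def)
        fix Q assume "Q \<subseteq> cc ` M"
        then obtain T where T: "T \<subseteq> M" "Q = cc ` T" by (meson subset_imageE)
        define s where "s e = fst (arc e)" for e
        define t where "t e = snd (arc e)" for e
        define E where "E = I \<union> (\<lambda>e. (s e, t e)) ` T \<union> (\<lambda>e. (t e, s e)) ` T"
        \<comment> \<open>The branch graphs stay whole and exactly the cross edges chosen by
          \<open>T\<close> survive; monotonicity puts the graph into the class, so its sketch has to
          decode \<open>T\<close>.\<close>
        define G2 where "G2 = \<lparr>pverts = pverts G', parcs = E\<rparr>"
        have G2s: "pverts G2 = pverts G'" "parcs G2 = E" by (simp_all add: G2_def)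
        have arcG': "(s e, t e) \<in> parcs G'" if "e \<in> T" for e
          using that T(1) Mprops[of "fst e" "snd e"] by (auto simp: s_def t_def)
        have arcG'': "(t e, s e) \<in> parcs G'" if "e \<in> T" for e
          by (rule symD[OF G'p(3) arcG'[OF that]])
        have EG': "E \<subseteq> parcs G'" using IG' arcG' arcG'' by (auto simp: E_def)
        have "sym E" using symI by (auto simp: E_def sym_def)
        then have pG2: "pair_graph G2" using EG' G'p by (auto simp: pair_graph_iff G2s)
        have "subgraph (with_proj G2) (with_proj G)"
          using EG' G'sub by (subst subgraph_with_proj_iff[OF pG2 F[OF G]]) (auto simp: G2s)
        then have G2F: "G2 \<in> \<F>" using mono G pG2 unfolding monotone_class_def by blast
        have dist: "graph_dist G2 (cen A) (cen B) \<le> ereal (real ?d) \<longleftrightarrow> (A, B) \<in> T" if AB: "(A, B) \<in> M" for A B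
        proof -
          note p = Mprops[OF AB]
          have "cen A \<in> pverts G2" using p cen(1)[of A] \<C>sub[of A] by (auto simp: G2s)
          then have "graph_dist G2 (cen A) (cen B) \<le> ereal (real ?d) \<longleftrightarrow> (cen A, cen B) \<in> reach E ?d"
            by (simp only: graph_dist_le_iff[OF pG2] G2s)
          also have "\<dots> \<longleftrightarrow> (A, B) \<in> T"
          proof (rule cell_distance[OF \<C>disj inner symI cen(1) dep_reach dep0 dep_step, where X = X])
            show "C \<in> \<C> \<and> C' \<in> \<C> \<and> C \<in> X \<and> C' \<notin> X \<and> s (C, C') \<in> C \<and> t (C, C') \<in> C' \<and>
                dep (s (C, C')) = i \<and> dep (t (C, C')) = j" if "(C, C') \<in> T" for C C'
              using Mprops[of C C'] that T(1) by (auto simp: s_def t_def)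
          qed (use p in \<open>simp_all add: E_def\<close>)
          finally show ?thesis .
        qed
        obtain P :: "('a \<Rightarrow> bool list) pmf" where P:
          "\<forall>s\<in>set_pmf P. \<forall>x\<in>pverts G2. length (s x) \<le> c ?d"
          "\<forall>x\<in>pverts G2. \<forall>y\<in>pverts G2. \<forall>b. Some (graph_dist G2 x y \<le> ereal (real ?d)) = Some b \<longrightarrow>
            measure_pmf.prob P {s. D ?d (s x) (s y) = b} \<ge> 2 / 3"
          using spec[OF sketch, of ?d, unfolded is_sketch_def, THEN bspec, OF G2F] by (elim exE conjE)
        have cenG2: "cen A \<in> pverts G2" if "A \<in> \<C>" for A
          using cen(1)[OF that] \<C>sub[OF that] by (auto simp: G2s)
        show "\<exists>P :: ('a \<Rightarrow> bool list) pmf. (\<forall>sk\<in>set_pmf P. \<forall>x\<in>cen ` \<C>. length (sk x) \<le> c ?d) \<and>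
          (\<forall>x y. (x, y) \<in> cc ` M \<longrightarrow> 2 / 3 \<le> measure_pmf.prob P {sk. D ?d (sk x) (sk y) \<longleftrightarrow> (x, y) \<in> Q})"
        proof (intro exI[of _ P] conjI ballI allI impI)
          show "length (s x) \<le> c ?d" if "s \<in> set_pmf P" "x \<in> cen ` \<C>" for s x
            using that P(1) cenG2 by auto
          fix x y assume "(x, y) \<in> cc ` M"
          then obtain A B where AB: "(A, B) \<in> M" "x = cen A" "y = cen B" by (auto simp: cc_def)
          have "(x, y) \<in> Q \<longleftrightarrow> (A, B) \<in> T"
            using inj_on_image_mem_iff[OF cc_inj AB(1) T(1)] by (simp add: T(2) AB cc_def)
          then have "graph_dist G2 x y \<le> ereal (real ?d) \<longleftrightarrow> (x, y) \<in> Q"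
            using dist[OF AB(1)] by (simp only: AB)
          moreover have "x \<in> pverts G2" "y \<in> pverts G2" using cenG2 Mprops[OF AB(1)] AB by simp_all
          ultimately show "2 / 3 \<le> measure_pmf.prob P {sk. D ?d (sk x) (sk y) \<longleftrightarrow> (x, y) \<in> Q}"
            using P(2) by blast
        qed
      qed
      then have cardM: "card M \<le> 13 * (c ?d + 1) * card \<C>"
        by (simp only: card_image[OF cc_inj] card_image[OF cen_inj])
      have "c ?d \<le> (\<Sum>d\<le>2 * r + 1. c d)" using ij by (intro member_le_sum) auto
      then have cardM': "card M \<le> 13 * ((\<Sum>d\<le>2 * r + 1. c d) + 1) * card \<C>"
        using cardM by (meson add_le_mono1 le_trans mult_le_mono1 mult_le_mono2)
      have "card (parcs H) \<le> 4 * card N" using X by (simp add: N_def)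
      also have "\<dots> \<le> 4 * (Suc r * Suc r * card M)" using cardN unfolding M_def by (rule mult_le_mono2)
      also have "\<dots> \<le> 4 * (Suc r * Suc r * (13 * ((\<Sum>d\<le>2 * r + 1. c d) + 1) * card \<C>))"
        using cardM' by (intro mult_le_mono2)
      also have "\<dots> = g r * card \<C>" by (simp only: g_def mult.assoc)
      finally have "real (card (parcs H)) \<le> real (g r) * real (card \<C>)" by (simp only: flip: of_nat_mult of_nat_le_iff)
      moreover have "card \<C> > 0" using False arcH fin\<C> by (auto simp: card_gt_0_iff)
      moreover have "average_degree H = real (card (parcs H)) / real (card \<C>)"
        unfolding \<C>_def by (rule average_degree_eq) (use fin\<C> arcH in \<open>auto simp: \<C>_def\<close>)
      ultimately show ?thesis by (simp add: pos_divide_le_eq)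
    qed
  qed
  then show ?thesis unfolding bounded_expansion_def by (intro exI[of _ "\<lambda>r. real (g r)"]) blast
qed

section \<open>Classes of bounded expansion are sketchable\<close>

primrec quantifier_depth :: "fo_formula \<Rightarrow> nat" where
  "quantifier_depth (Equal x y) = 0"
| "quantifier_depth (Edge x y) = 0"
| "quantifier_depth (Pred i x) = 0"
| "quantifier_depth (Neg \<phi>) = quantifier_depth \<phi>"
| "quantifier_depth (Conj \<phi> \<psi>) = max (quantifier_depth \<phi>) (quantifier_depth \<psi>)"
| "quantifier_depth (Exists x \<phi>) = Suc (quantifier_depth \<phi>)"

lemma ef_equiv_fo_sat:
  assumes "ef_equiv \<kappa> n (V, E, R) (V', E', R') P" "quantifier_depth \<phi> \<le> n" "unary_symbols \<phi> \<subseteq> {..<\<kappa>}"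
    "\<And>x. x \<in> free_vars \<phi> \<Longrightarrow> (\<sigma> x, \<tau> x) \<in> P"
  shows "fo_sat V E R \<sigma> \<phi> \<longleftrightarrow> fo_sat V' E' R' \<tau> \<phi>"
  using assms
proof (induction \<phi> arbitrary: n P \<sigma> \<tau>)
  case (Equal x y)
  from atomic_match_pairD[OF ef_equiv_atomic[OF Equal(1)], of "\<sigma> x" "\<tau> x" "\<sigma> y" "\<tau> y"] Equal(4)
  show ?case by simp
next
  case (Edge x y)
  from atomic_match_pairD[OF ef_equiv_atomic[OF Edge(1)], of "\<sigma> x" "\<tau> x" "\<sigma> y" "\<tau> y"] Edge(4)
  show ?case by simp
next
  case (Pred i x)
  from atomic_match_predD[OF ef_equiv_atomic[OF Pred(1)], of "\<sigma> x" "\<tau> x" i] Pred(3,4)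
  show ?case by simp
next
  case (Neg \<phi>)
  from Neg.IH[OF Neg.prems(1), of \<sigma> \<tau>] Neg.prems(2-4) show ?case by simp
next
  case (Conj \<phi> \<psi>)
  from Conj.IH(1)[OF Conj.prems(1), of \<sigma> \<tau>] Conj.IH(2)[OF Conj.prems(1), of \<sigma> \<tau>] Conj.prems(2-4)
  show ?case by simp
next
  case (Exists x \<phi>)
  then obtain m where m: "n = Suc m" "quantifier_depth \<phi> \<le> m" by (cases n) auto
  have step: "fo_sat V E R (\<sigma>(x := a)) \<phi> \<longleftrightarrow> fo_sat V' E' R' (\<tau>(x := b)) \<phi>"
    if "ef_equiv \<kappa> m (V, E, R) (V', E', R') (insert (a, b) P)" for a b
    by (rule Exists.IH[OF that m(2)]) (use Exists.prems(3,4) in auto)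
  have "\<forall>a\<in>V. \<exists>b\<in>V'. ef_equiv \<kappa> m (V, E, R) (V', E', R') (insert (a, b) P)"
    "\<forall>b\<in>V'. \<exists>a\<in>V. ef_equiv \<kappa> m (V, E, R) (V', E', R') (insert (a, b) P)"
    using Exists.prems(1) by (simp_all add: m(1))
  with step show ?case unfolding fo_sat.simps by meson
qed

section \<open>Finitely many types, and isolation of vertices\<close>

lemma finite_values_as_nat:
  assumes "finite S" "\<And>x. f x \<in> S"
  obtains h :: "'a \<Rightarrow> nat" and b where "\<And>x. h x < b" "\<And>x y. h x = h y \<Longrightarrow> f x = f y"
proof -
  obtain g :: "'b \<Rightarrow> nat" where g: "inj_on g S" using finite_imp_inj_to_nat_seg[OF assms(1)] by blast
  show thesis
  proof (rule that[of "\<lambda>x. g (f x)" "Suc (Max (g ` S))"])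
    show "g (f x) < Suc (Max (g ` S))" for x
      using assms by (auto simp: less_Suc_eq_le intro!: Max_ge)
    show "f x = f y" if "g (f x) = g (f y)" for x y
      using g that assms(2) by (auto dest: inj_onD)
  qed
qed

text \<open>The atomic diagram of a tuple, recorded by positions so that tuples of different
  structures can be compared and each length admits finitely many values.\<close>

definition atomic_data :: "nat \<Rightarrow> 'a struct \<Rightarrow> 'a list \<Rightarrow> (nat \<times> nat) set \<times> (nat \<times> nat) set \<times> (nat \<times> nat) set" where
  "atomic_data \<kappa> A as =
     ({(i, p). i < length as \<and> p < \<kappa> \<and> as ! i \<in> snd (snd A) p},
      {(i, j). i < length as \<and> j < length as \<and> as ! i = as ! j},
      {(i, j). i < length as \<and> j < length as \<and> (as ! i, as ! j) \<in> fst (snd A)})"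

lemma atomic_data_eq_imp_match:
  assumes eq: "atomic_data \<kappa> A as = atomic_data \<kappa> B bs" and len: "length as = length bs"
  shows "atomic_match \<kappa> A B (set (zip as bs))"
proof (rule atomic_matchI)
  fix a b p assume "(a, b) \<in> set (zip as bs)" and p: "p < \<kappa>"
  then obtain i where i: "i < length as" "a = as ! i" "b = bs ! i" using len by (auto simp: set_zip)
  have "(i, p) \<in> fst (atomic_data \<kappa> A as) \<longleftrightarrow> (i, p) \<in> fst (atomic_data \<kappa> B bs)" by (simp only: eq)
  with i p len show "a \<in> snd (snd A) p \<longleftrightarrow> b \<in> snd (snd B) p" by (simp add: atomic_data_def)
next
  fix a b a' b' assume "(a, b) \<in> set (zip as bs)" "(a', b') \<in> set (zip as bs)"
  then obtain i j where ij: "i < length as" "a = as ! i" "b = bs ! i"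
    "j < length as" "a' = as ! j" "b' = bs ! j" using len by (auto simp: set_zip)
  have "(i, j) \<in> fst (snd (atomic_data \<kappa> A as)) \<longleftrightarrow> (i, j) \<in> fst (snd (atomic_data \<kappa> B bs))"
    "(i, j) \<in> snd (snd (atomic_data \<kappa> A as)) \<longleftrightarrow> (i, j) \<in> snd (snd (atomic_data \<kappa> B bs))"
    by (simp_all only: eq)
  with ij len show "(a = a' \<longleftrightarrow> b = b') \<and> ((a, a') \<in> fst (snd A) \<longleftrightarrow> (b, b') \<in> fst (snd B))"
    by (simp add: atomic_data_def)
qed

text \<open>Hintikka types: the rank n + 1 type of a tuple is its atomic diagram together with the
  set of rank n types of its one-element extensions. The bound \<open>b\<close> serves all
  structures at once.\<close>

lemma finitely_many_ef_types:
  "\<exists>(h :: 'a struct \<times> 'a list \<Rightarrow> nat) b. (\<forall>X. h X < b) \<and>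
     (\<forall>A as B bs. length as = l \<longrightarrow> length bs = l \<longrightarrow> h (A, as) = h (B, bs) \<longrightarrow>
        ef_equiv \<kappa> n A B (set (zip as bs)))"
proof (induction n arbitrary: l)
  case 0
  \<comment> \<open>Tuples of the wrong length receive a dummy value, which keeps the range
    finite.\<close>
  let ?f = "\<lambda>(A :: 'a struct, as). if length as = l then atomic_data \<kappa> A as else ({}, {}, {})"
  let ?S = "Pow ({..<l} \<times> {..<\<kappa>}) \<times> Pow ({..<l} \<times> {..<l}) \<times> Pow ({..<l} \<times> {..<l})"
  have fin: "finite ?S" by simp
  have inS: "?f X \<in> ?S" for X by (cases X) (auto simp: atomic_data_def)
  obtain h :: "'a struct \<times> 'a list \<Rightarrow> nat" and b where h: "\<And>x. h x < b" "\<And>x y. h x = h y \<Longrightarrow> ?f x = ?f y"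
    by (rule finite_values_as_nat[OF fin inS]) (rule that)
  show ?case
  proof (intro exI[of _ h] exI[of _ b] conjI allI impI)
    fix A as and B :: "'a struct" and bs assume "length as = l" "length bs = l" "h (A, as) = h (B, bs)"
    with h(2)[of "(A, as)" "(B, bs)"] show "ef_equiv \<kappa> 0 A B (set (zip as bs))"
      by (auto intro: atomic_data_eq_imp_match)
  qed (rule h(1))
next
  case (Suc n)
  obtain h0 :: "'a struct \<times> 'a list \<Rightarrow> nat" and b0 where h0: "\<forall>X. h0 X < b0"
    "\<forall>A as B bs. length as = Suc l \<longrightarrow> length bs = Suc l \<longrightarrow> h0 (A, as) = h0 (B, bs) \<longrightarrow>
        ef_equiv \<kappa> n A B (set (zip as bs))"
    using Suc[of "Suc l"] by blast
  let ?f = "\<lambda>(A :: 'a struct, as). (if length as = l then atomic_data \<kappa> A as else ({}, {}, {}),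
    (\<lambda>a. h0 (A, a # as)) ` fst A)"
  let ?S = "(Pow ({..<l} \<times> {..<\<kappa>}) \<times> Pow ({..<l} \<times> {..<l}) \<times> Pow ({..<l} \<times> {..<l})) \<times> Pow {..<b0}"
  have fin: "finite ?S" by simp
  have inS: "?f X \<in> ?S" for X using h0(1) by (cases X) (auto simp: atomic_data_def)
  obtain h :: "'a struct \<times> 'a list \<Rightarrow> nat" and b where h: "\<And>x. h x < b" "\<And>x y. h x = h y \<Longrightarrow> ?f x = ?f y"
    by (rule finite_values_as_nat[OF fin inS]) (rule that)
  show ?case
  proof (intro exI[of _ h] exI[of _ b] conjI allI impI)
    fix A as and B :: "'a struct" and bs assume len: "length as = l" "length bs = l" and eq: "h (A, as) = h (B, bs)"
    from h(2)[OF eq] len have data: "atomic_data \<kappa> A as = atomic_data \<kappa> B bs"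
      and types: "(\<lambda>a. h0 (A, a # as)) ` fst A = (\<lambda>b. h0 (B, b # bs)) ` fst B" by simp_all
    have step: "ef_equiv \<kappa> n A B (insert (a, b) (set (zip as bs)))" if "h0 (A, a # as) = h0 (B, b # bs)" for a b
      using h0(2)[rule_format, of "a # as" "b # bs" A B] that len by simp
    have 1: "\<exists>b\<in>fst B. ef_equiv \<kappa> n A B (insert (a, b) (set (zip as bs)))" if "a \<in> fst A" for a
    proof -
      have "h0 (A, a # as) \<in> (\<lambda>b. h0 (B, b # bs)) ` fst B" using that types by blast
      then show ?thesis using step by blast
    qed
    have 2: "\<exists>a\<in>fst A. ef_equiv \<kappa> n A B (insert (a, b) (set (zip as bs)))" if "b \<in> fst B" for b
    proof -
      have "h0 (B, b # bs) \<in> (\<lambda>a. h0 (A, a # as)) ` fst A" using that types by blast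
      then obtain a where a: "h0 (B, b # bs) = h0 (A, a # as)" "a \<in> fst A" by (elim imageE)
      from step[OF a(1)[symmetric]] a(2) show ?thesis by (rule bexI)
    qed
    show "ef_equiv \<kappa> (Suc n) A B (set (zip as bs))"
      using atomic_data_eq_imp_match[OF data] len 1 2 unfolding ef_equiv.simps by simp
  qed (rule h(1))
qed

text \<open>Isolating \<open>ss\<close> loses no information: the removed edges are recovered from the new predicates,
  the neighbourhoods of the vertices of \<open>ss\<close> at the even and the vertices themselves at the odd
  positions above \<open>\<kappa>\<close>.\<close>

definition isolate :: "nat \<Rightarrow> 'a list \<Rightarrow> 'a struct \<Rightarrow> 'a struct" where
  "isolate \<kappa> ss A = (fst A, {(u, v). (u, v) \<in> fst (snd A) \<and> u \<notin> set ss \<and> v \<notin> set ss},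
     \<lambda>m. if m < \<kappa> then snd (snd A) m
          else if (m - \<kappa>) div 2 < length ss then
            (if even (m - \<kappa>) then {v. (v, ss ! ((m - \<kappa>) div 2)) \<in> fst (snd A)} else {ss ! ((m - \<kappa>) div 2)})
          else {})"

lemma isolate_simps:
  "fst (isolate \<kappa> ss A) = fst A"
  "(u, v) \<in> fst (snd (isolate \<kappa> ss A)) \<longleftrightarrow> (u, v) \<in> fst (snd A) \<and> u \<notin> set ss \<and> v \<notin> set ss"
  "m < \<kappa> \<Longrightarrow> snd (snd (isolate \<kappa> ss A)) m = snd (snd A) m"
  "i < length ss \<Longrightarrow> snd (snd (isolate \<kappa> ss A)) (\<kappa> + 2 * i) = {v. (v, ss ! i) \<in> fst (snd A)}"
  "i < length ss \<Longrightarrow> snd (snd (isolate \<kappa> ss A)) (Suc (\<kappa> + 2 * i)) = {ss ! i}"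
  by (simp_all add: isolate_def Suc_diff_le)

lemma graph_struct_isolate: "graph_struct A \<Longrightarrow> graph_struct (isolate \<kappa> ss A)"
  unfolding graph_struct_def by (auto simp: isolate_def sym_def)

lemma edge_isolate_iff:
  assumes "graph_struct A"
  shows "(u, v) \<in> fst (snd A) \<longleftrightarrow> (u, v) \<in> fst (snd (isolate \<kappa> ss A)) \<or>
    (\<exists>i<length ss. u \<in> snd (snd (isolate \<kappa> ss A)) (Suc (\<kappa> + 2 * i)) \<and> v \<in> snd (snd (isolate \<kappa> ss A)) (\<kappa> + 2 * i) \<or>
       v \<in> snd (snd (isolate \<kappa> ss A)) (Suc (\<kappa> + 2 * i)) \<and> u \<in> snd (snd (isolate \<kappa> ss A)) (\<kappa> + 2 * i))"
  (is "_ \<longleftrightarrow> _ \<or> ?ex")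
proof -
  have sym: "(u, v) \<in> fst (snd A) \<longleftrightarrow> (v, u) \<in> fst (snd A)" for u v
    using assms by (auto simp: graph_struct_def dest: symD)
  have ex: "?ex \<longleftrightarrow> (\<exists>i<length ss. u = ss ! i \<and> (v, u) \<in> fst (snd A) \<or> v = ss ! i \<and> (u, v) \<in> fst (snd A))"
    by (auto simp: isolate_simps)
  also have "\<dots> \<longleftrightarrow> (u \<in> set ss \<or> v \<in> set ss) \<and> (u, v) \<in> fst (snd A)"
    unfolding in_set_conv_nth using sym[of u v] by blast
  finally show ?thesis unfolding isolate_simps(2) by blast
qed

text \<open>The domains are unchanged, so a strategy carries over move by move once the atomic match
  does; original edges are expressed by the remaining edges and the new predicates. Each isolated
  position takes two of the 2 * L extra places.\<close>

lemma ef_equiv_isolate: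
  assumes A: "graph_struct A" and B: "graph_struct B" and len: "length ss = length ts" "length ss \<le> L"
  shows "ef_equiv (\<kappa> + 2 * L) n (isolate \<kappa> ss A) (isolate \<kappa> ts B) P \<Longrightarrow> ef_equiv \<kappa> n A B P"
proof (induction n arbitrary: P)
  have atomic: "atomic_match \<kappa> A B P"
    if m: "atomic_match (\<kappa> + 2 * L) (isolate \<kappa> ss A) (isolate \<kappa> ts B) P" for P
  proof (rule atomic_matchI)
    fix a b i assume ab: "(a, b) \<in> P" and i: "i < \<kappa>"
    then have "i < \<kappa> + 2 * L" by simp
    from atomic_match_predD[OF m ab this] i show "a \<in> snd (snd A) i \<longleftrightarrow> b \<in> snd (snd B) i"
      by (simp add: isolate_simps)
  next
    fix a b a' b' assume ab: "(a, b) \<in> P" "(a', b') \<in> P"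
    have pred: "x \<in> snd (snd (isolate \<kappa> ss A)) (\<kappa> + 2 * i) \<longleftrightarrow> y \<in> snd (snd (isolate \<kappa> ts B)) (\<kappa> + 2 * i)"
      "x \<in> snd (snd (isolate \<kappa> ss A)) (Suc (\<kappa> + 2 * i)) \<longleftrightarrow> y \<in> snd (snd (isolate \<kappa> ts B)) (Suc (\<kappa> + 2 * i))"
      if "(x, y) \<in> P" "i < length ss" for x y i
      by (rule atomic_match_predD[OF m that(1)]; use that(2) len(2) in linarith)+
    have "(a, a') \<in> fst (snd A) \<longleftrightarrow> (b, b') \<in> fst (snd B)"
      using pred[OF ab(1)] pred[OF ab(2)] atomic_match_pairD[OF m ab]
      unfolding edge_isolate_iff[OF A, of _ _ \<kappa> ss] edge_isolate_iff[OF B, of _ _ \<kappa> ts] len(1)[symmetric]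
      by blast
    with atomic_match_pairD[OF m ab]
    show "(a = a' \<longleftrightarrow> b = b') \<and> ((a, a') \<in> fst (snd A) \<longleftrightarrow> (b, b') \<in> fst (snd B))" by blast
  qed
  {
    case 0
    then show ?case using atomic by simp
  next
    case (Suc n)
    then have "atomic_match \<kappa> A B P" using atomic by simp
    with Suc show ?case by (simp add: isolate_simps) meson
  }
qed

section \<open>Labels from hitting sets\<close>

lemma walk_reach: "walk E (v # p) \<Longrightarrow> (v, last (v # p)) \<in> reach E (length p)"
  using walk_imp_reach[of E v p "{}"] by simp

lemma walk_through_reach:
  assumes w: "walk E w" "z \<in> set w" and E: "sym E"
  shows "\<exists>d e. d + e < length w \<and> (hd w, z) \<in> reach E d \<and> (last w, z) \<in> reach E e"
proof -
  obtain a b where ab: "w = a @ z # b" using split_list[OF w(2)] by blast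
  have "walk E (a @ [z])" "walk E (z # b)"
    using w(1) successively_append_iff[of _ "a @ [z]" b] successively_append_iff[of _ a "z # b"] by (auto simp: ab)
  then have "(hd w, z) \<in> reach E (length a)" "(z, last w) \<in> reach E (length b)"
    using walk_reach[of E "hd w" "tl a @ [z]"] walk_reach[of E z b]
    by (cases a; simp add: ab)+
  with reach_sym[OF E] show ?thesis by (intro exI[of _ "length a"] exI[of _ "length b"]) (auto simp: ab)
qed

lemma reach_nontrivial_walk:
  assumes "(x, y) \<in> reach E d" "x \<noteq> y"
  shows "\<exists>p. p \<noteq> [] \<and> last p = y \<and> walk E (x # p) \<and> length p \<le> d"
  using reach_imp_walk[of x y d E "{}"] assms by auto

text \<open>Hitting sets become lists of one common length by padding with \<open>x\<close>, a
  member of its own set. With \<open>x\<close> in front, the codes at position 0 decide equality of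
  two vertices.\<close>

lemma bounded_expansion_hitting_lists:
  assumes F: "\<And>G. G \<in> \<F> \<Longrightarrow> pair_graph G" and be: "bounded_expansion \<F>"
  shows "\<exists>k. k > 0 \<and> (\<forall>G\<in>\<F>. \<exists>q. \<forall>x\<in>pverts G. length (q x) = k \<and> q x ! 0 = x \<and> set (q x) \<subseteq> pverts G \<and>
    (\<forall>w. walk (parcs G) w \<longrightarrow> w \<noteq> [] \<longrightarrow> set w \<subseteq> pverts G \<longrightarrow> length w \<le> Suc r \<longrightarrow> hd w = x \<longrightarrow>
       set w \<inter> set (q x) \<inter> set (q (last w)) \<noteq> {}))"
proof -
  obtain g where g: "\<forall>G\<in>\<F>. shallow_sparse (pverts G) (parcs G) (2 * r) g"
    using bounded_expansion_imp_shallow_sparse[OF F be] by blast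
  define K where "K = g * (1 + 2 * r * g) * (2 * (1 + 2 * g))"
  define m where "m = (K + 1) ^ r"
  define k where "k = Suc m"
  have "\<exists>q. \<forall>x\<in>pverts G. length (q x) = k \<and> q x ! 0 = x \<and> set (q x) \<subseteq> pverts G \<and>
    (\<forall>w. walk (parcs G) w \<longrightarrow> w \<noteq> [] \<longrightarrow> set w \<subseteq> pverts G \<longrightarrow> length w \<le> Suc r \<longrightarrow> hd w = x \<longrightarrow>
       set w \<inter> set (q x) \<inter> set (q (last w)) \<noteq> {})" if G: "G \<in> \<F>" for G
  proof -
    have p: "finite (pverts G)" "parcs G \<subseteq> pverts G \<times> pverts G" "sym (parcs G)"
      using F[OF G] by (auto simp: pair_graph_iff)
    obtain R where R: "\<forall>x\<in>pverts G. x \<in> R x \<and> R x \<subseteq> pverts G \<and> card (R x) \<le> (K + 1) ^ r"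
      and hit: "\<forall>w. walk (parcs G) w \<longrightarrow> w \<noteq> [] \<longrightarrow> set w \<subseteq> pverts G \<longrightarrow> length w \<le> Suc r \<longrightarrow>
        set w \<inter> R (hd w) \<inter> R (last w) \<noteq> {}"
      using sparse_hitting_sets[OF p bspec[OF g G] K_def] by (elim exE conjE)
    have "\<exists>l. length l = k \<and> l ! 0 = x \<and> set l = R x" if x: "x \<in> pverts G" for x
    proof -
      have Rx: "x \<in> R x" "finite (R x)" "card (R x) \<le> (K + 1) ^ r"
        using R x p(1) finite_subset by blast+
      obtain l where l: "set l = R x" "distinct l" using finite_distinct_list[OF Rx(2)] by blast
      have len: "length l \<le> (K + 1) ^ r" using Rx(3) distinct_card[OF l(2)] l(1) by simp
      let ?l = "x # l @ replicate (m - length l) x"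
      have "length ?l = k" using len by (simp add: k_def m_def)
      moreover have "set ?l = R x" using l(1) Rx(1) by (auto simp: set_replicate_conv_if)
      moreover have "?l ! 0 = x" by simp
      ultimately show ?thesis by blast
    qed
    then have "\<forall>x\<in>pverts G. \<exists>l. length l = k \<and> l ! 0 = x \<and> set l = R x" by (rule ballI)
    from bchoice[OF this] obtain q where q: "\<forall>x\<in>pverts G. length (q x) = k \<and> q x ! 0 = x \<and> set (q x) = R x"
      by (elim exE)
    show ?thesis
    proof (intro exI[of _ q] ballI conjI allI impI)
      fix x w assume x: "x \<in> pverts G" and w: "walk (parcs G) w" "w \<noteq> []" "set w \<subseteq> pverts G"
        "length w \<le> Suc r" "hd w = x"
      have "last w \<in> pverts G" using w by auto
      with q x have "set (q x) = R x" "set (q (last w)) = R (last w)" by simp_all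
      moreover have "set w \<inter> R (hd w) \<inter> R (last w) \<noteq> {}" using hit w(1-4) by blast
      ultimately show "set w \<inter> set (q x) \<inter> set (q (last w)) \<noteq> {}" using w(5) by simp
    qed (use q R in simp_all)
  qed
  then show ?thesis by (intro exI[of _ k]) (simp add: k_def)
qed

text \<open>Vertices are natural numbers and serve as their own codes. The prefix is a table whose
  bit at i * (r + 1) + d tells whether \<open>x\<close> reaches its i-th code within d steps;
  \<open>S\<close> selects the index pairs with distances adding up to at most
  \<open>r\<close>.\<close>

lemma bounded_expansion_imp_disjunctive_scheme:
  fixes \<F> :: "nat pair_pre_digraph set"
  assumes F: "\<And>G. G \<in> \<F> \<Longrightarrow> pair_graph G" and be: "bounded_expansion \<F>"
  shows "\<exists>t. disjunctive_distance_scheme \<F> r t"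
proof -
  obtain k where k: "\<forall>G\<in>\<F>. \<exists>q. \<forall>x\<in>pverts G. length (q x) = k \<and> q x ! 0 = x \<and> set (q x) \<subseteq> pverts G \<and>
    (\<forall>w. walk (parcs G) w \<longrightarrow> w \<noteq> [] \<longrightarrow> set w \<subseteq> pverts G \<longrightarrow> length w \<le> Suc r \<longrightarrow> hd w = x \<longrightarrow>
       set w \<inter> set (q x) \<inter> set (q (last w)) \<noteq> {})"
    using bounded_expansion_hitting_lists[OF F be, of r] by blast
  define s where "s = k * Suc r"
  define S :: "bool list \<Rightarrow> bool list \<Rightarrow> (nat \<times> nat) set" where
    "S p p' = {(i, j). i < k \<and> j < k \<and> (\<exists>d e. d + e \<le> r \<and> p ! (i * Suc r + d) \<and> p' ! (j * Suc r + e))}" for p p'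
  have "\<exists>p q. (\<forall>x\<in>pverts G. length (p x) = s \<and> length (q x) = k) \<and>
      (\<forall>x\<in>pverts G. \<forall>y\<in>pverts G. disjunctive_output S (p x, q x) (p y, q y) \<longleftrightarrow>
         graph_dist G x y \<le> ereal (real r))" if G: "G \<in> \<F>" for G
  proof -
    let ?E = "parcs G"
    have symE: "sym ?E" and EV: "?E \<subseteq> pverts G \<times> pverts G" using F[OF G] by (auto simp: pair_graph_iff)
    obtain q where q: "\<forall>x\<in>pverts G. length (q x) = k \<and> q x ! 0 = x \<and> set (q x) \<subseteq> pverts G \<and>
      (\<forall>w. walk ?E w \<longrightarrow> w \<noteq> [] \<longrightarrow> set w \<subseteq> pverts G \<longrightarrow> length w \<le> Suc r \<longrightarrow> hd w = x \<longrightarrow>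
         set w \<inter> set (q x) \<inter> set (q (last w)) \<noteq> {})"
      using bspec[OF k G] by (elim exE)
    define p where "p x = map (\<lambda>m. (x, q x ! (m div Suc r)) \<in> reach ?E (m mod Suc r)) [0..<s]" for x
    have p_nth: "p x ! (i * Suc r + d) \<longleftrightarrow> (x, q x ! i) \<in> reach ?E d" if "i < k" "d \<le> r" for x i d
    proof -
      have "i * Suc r + d < Suc i * Suc r" using that by simp
      also have "\<dots> \<le> s" unfolding s_def using that by (intro mult_le_mono1) simp
      finally have "i * Suc r + d < s" .
      moreover have "(i * Suc r + d) div Suc r = i" "(i * Suc r + d) mod Suc r = d"
        using that by (simp_all del: mult_Suc_right)
      ultimately show ?thesis by (simp only: p_def nth_map_upt length_upt) simp
    qed
    have "disjunctive_output S (p x, q x) (p y, q y) \<longleftrightarrow> graph_dist G x y \<le> ereal (real r)"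
      if x: "x \<in> pverts G" and y: "y \<in> pverts G" for x y
    proof -
      have "disjunctive_output S (p x, q x) (p y, q y) \<longleftrightarrow>
          (\<exists>i j. (i, j) \<in> S (p x) (p y) \<and> q x ! i = q y ! j)"
        by (auto simp: disjunctive_output_def)
      also have "\<dots> \<longleftrightarrow> (\<exists>i<k. \<exists>j<k. \<exists>d e. d + e \<le> r \<and>
          p x ! (i * Suc r + d) \<and> p y ! (j * Suc r + e) \<and> q x ! i = q y ! j)"
        unfolding S_def mem_Collect_eq case_prod_conv by blast
      also have "\<dots> \<longleftrightarrow> (\<exists>i<k. \<exists>j<k. \<exists>d e. d + e \<le> r \<and>
          (x, q x ! i) \<in> reach ?E d \<and> (y, q y ! j) \<in> reach ?E e \<and> q x ! i = q y ! j)"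
        by (intro ex_cong1 conj_cong refl p_nth) simp_all
      also have "\<dots> \<longleftrightarrow> (x, y) \<in> reach ?E r"
      proof
        assume "\<exists>i<k. \<exists>j<k. \<exists>d e. d + e \<le> r \<and>
          (x, q x ! i) \<in> reach ?E d \<and> (y, q y ! j) \<in> reach ?E e \<and> q x ! i = q y ! j"
        then obtain z d e where "d + e \<le> r" "(x, z) \<in> reach ?E d" "(y, z) \<in> reach ?E e" by metis
        then show "(x, y) \<in> reach ?E r"
          using reach_add[OF _ reach_sym[OF symE], of x z d y e] reach_mono[of "d + e" r ?E] by blast
      next
        assume r: "(x, y) \<in> reach ?E r"
        obtain w where w: "walk ?E w" "w \<noteq> []" "hd w = x" "last w = y" "length w \<le> Suc r" "set w \<subseteq> pverts G"
        proof (cases "x = y")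
          case True
          then show ?thesis using that[of "[x]"] x by simp
        next
          case False
          from reach_nontrivial_walk[OF r False] obtain p where "p \<noteq> []" "last p = y" "walk ?E (x # p)" "length p \<le> r"
            by blast
          then show ?thesis using that[of "x # p"] x walk_vertices[OF _ EV, of x p] by simp
        qed
        then obtain z where z: "z \<in> set w" "z \<in> set (q x)" "z \<in> set (q y)" using q x by blast
        obtain i j where ij: "i < k" "j < k" "z = q x ! i" "z = q y ! j"
          using z(2,3) q x y by (metis in_set_conv_nth)
        obtain d e where "d + e < length w" "(x, z) \<in> reach ?E d" "(y, z) \<in> reach ?E e"
          using walk_through_reach[OF w(1) z(1) symE] w(3,4) by blast
        with ij w(5) show "\<exists>i<k. \<exists>j<k. \<exists>d e. d + e \<le> r \<and>
          (x, q x ! i) \<in> reach ?E d \<and> (y, q y ! j) \<in> reach ?E e \<and> q x ! i = q y ! j"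
        proof -
          have "d + e \<le> r" using \<open>d + e < length w\<close> w(5) by linarith
          moreover have "(x, q x ! i) \<in> reach ?E d" "(y, q y ! j) \<in> reach ?E e" "q x ! i = q y ! j"
            using \<open>(x, z) \<in> reach ?E d\<close> \<open>(y, z) \<in> reach ?E e\<close> by (simp_all only: ij(3)[symmetric] ij(4)[symmetric])
          ultimately show ?thesis using ij(1,2) by (intro exI conjI)
        qed
      qed
      also have "\<dots> \<longleftrightarrow> graph_dist G x y \<le> ereal (real r)" by (rule graph_dist_le_iff[OF F[OF G] x, symmetric])
      finally show ?thesis .
    qed
    then show ?thesis using q by (intro exI[of _ p] exI[of _ q]) (simp add: p_def)
  qed
  then have "disjunctive_distance_scheme \<F> r (max s k)"
    unfolding disjunctive_distance_scheme_def
    by (intro exI[of _ s] exI[of _ k] exI[of _ S]) (auto simp: S_def)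
  then show ?thesis by blast
qed

lemma disjunctive_scheme_imp_sketchable:
  fixes \<F> :: "'a pair_pre_digraph set"
  assumes F: "\<And>G. G \<in> \<F> \<Longrightarrow> pair_graph G" and scheme: "disjunctive_distance_scheme \<F> r t"
  shows "sketchable \<F> (\<lambda>G x y. Some (graph_dist G x y \<le> ereal (real r)))"
proof -
  obtain s k S where S: "\<forall>p p'. S p p' \<subseteq> {..<k} \<times> {..<k}" and
    sch: "\<forall>G\<in>\<F>. \<exists>p q. (\<forall>x\<in>pverts G. length (p x) = s \<and> length (q x) = k) \<and>
      (\<forall>x\<in>pverts G. \<forall>y\<in>pverts G. disjunctive_output S (p x, q x) (p y, q y) \<longleftrightarrow>
         graph_dist G x y \<le> ereal (real r))"
    using scheme unfolding disjunctive_distance_scheme_def by (elim exE conjE)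
  show ?thesis
  proof (rule equality_scheme_sketchable[where PP = "{p :: bool list. length p = s}"
        and D = "\<lambda>p p' Eq. S p p' \<inter> Eq \<noteq> {}" and k = k])
    show "finite {p :: bool list. length p = s}" using finite_lists_length_eq[of "UNIV :: bool set" s] by simp
    show "finite (pverts G)" if "G \<in> \<F>" for G using F[OF that] by (simp add: pair_graph_iff)
    fix G assume "G \<in> \<F>"
    then obtain p q where pq: "\<forall>x\<in>pverts G. length (p x) = s \<and> length (q x) = k"
      "\<forall>x\<in>pverts G. \<forall>y\<in>pverts G. disjunctive_output S (p x, q x) (p y, q y) \<longleftrightarrow>
         graph_dist G x y \<le> ereal (real r)"
      using sch by blast
    have "disjunctive_output S (p x, q x) (p y, q y) \<longleftrightarrow>
        S (p x) (p y) \<inter> {(i, j). i < k \<and> j < k \<and> q x ! i = q y ! j} \<noteq> {}" for x y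
    proof -
      have "S (p x) (p y) \<subseteq> {..<k} \<times> {..<k}" using S by blast
      then show ?thesis by (auto simp: disjunctive_output_def)
    qed
    with pq show "\<exists>p (q :: 'a \<Rightarrow> nat list). \<forall>x\<in>pverts G. p x \<in> {p :: bool list. length p = s} \<and> length (q x) = k \<and>
      (\<forall>y\<in>pverts G. \<forall>b. Some (graph_dist G x y \<le> ereal (real r)) = Some b \<longrightarrow>
         b = (S (p x) (p y) \<inter> {(i, j). i < k \<and> j < k \<and> q x ! i = q y ! j} \<noteq> {}))"
      by (intro exI[of _ p] exI[of _ q]) auto
  qed
qed

text \<open>Both ends of a remaining edge avoid \<open>ss\<close>, so a nontrivial walk in the
  isolated structure misses \<open>ss\<close> altogether, its first vertex included.\<close>

lemma isolate_separates:
  assumes A: "graph_struct A" and xy: "x \<noteq> y" "x \<in> fst A"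
    and hit: "\<And>w. walk (fst (snd A)) w \<Longrightarrow> w \<noteq> [] \<Longrightarrow> set w \<subseteq> fst A \<Longrightarrow> length w \<le> Suc r \<Longrightarrow> hd w = x \<Longrightarrow>
      last w = y \<Longrightarrow> set w \<inter> set ss \<noteq> {}"
  shows "(x, y) \<notin> reach (fst (snd (isolate \<kappa> ss A))) r"
proof
  let ?E = "fst (snd A)" and ?E' = "fst (snd (isolate \<kappa> ss A))"
  assume "(x, y) \<in> reach ?E' r"
  from reach_nontrivial_walk[OF this xy(1)] obtain p where p: "p \<noteq> []" "last p = y" "walk ?E' (x # p)" "length p \<le> r"
    by blast
  have wE: "walk ?E (x # p)" by (rule successively_mono[OF p(3)]) (simp add: isolate_simps)
  have EV: "?E' \<subseteq> (fst A - set ss) \<times> (fst A - set ss)"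
    using A by (auto simp: isolate_simps graph_struct_def)
  have "set p \<subseteq> fst A - set ss" by (rule walk_vertices[OF p(3) EV])
  moreover have "x \<notin> set ss" using p(1,3) EV by (cases p) auto
  ultimately have "set (x # p) \<subseteq> fst A" "set (x # p) \<inter> set ss = {}" using xy(2) by auto
  with hit[of "x # p"] p wE show False by simp
qed

text \<open>Locality for two clusters of one pair each; for all other indices the position is empty
  and arises by shrinking.\<close>

lemma ef_equiv_far_pair:
  fixes A B :: "'a struct"
  assumes loc: "\<forall>A B :: 'a struct. \<forall>C. graph_struct A \<longrightarrow> graph_struct B \<longrightarrow> finite C \<longrightarrow> card C \<le> 2 \<longrightarrow>
     clusters_match \<kappa> r N A B C \<longrightarrow> ef_equiv \<kappa> n A B (snd ` C)"
    and A: "graph_struct A" and B: "graph_struct B"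
    and uv: "u \<in> fst A" "v \<in> fst A" "(u, v) \<notin> reach (fst (snd A)) r"
    and xy: "x \<in> fst B" "y \<in> fst B" "(x, y) \<notin> reach (fst (snd B)) r"
    and eq: "ef_equiv \<kappa> N A B {(u, x)}" "ef_equiv \<kappa> N A B {(v, y)}"
  shows "ef_equiv \<kappa> n A B {(u, x), (v, y)}"
proof -
  let ?C = "{(0, u, x), (1, v, y)} :: (nat \<times> 'a \<times> 'a) set"
  have symA: "sym (fst (snd A))" and symB: "sym (fst (snd B))" using A B by (auto simp: graph_struct_def)
  have far: "(v, u) \<notin> reach (fst (snd A)) r" "(y, x) \<notin> reach (fst (snd B)) r"
    using uv(3) xy(3) reach_sym[OF symA] reach_sym[OF symB] by blast+
  have "ef_equiv \<kappa> N A B {(a, b). (c, a, b) \<in> ?C}" for c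
  proof -
    consider "c = 0" | "c = 1" | "c \<noteq> 0" "c \<noteq> 1" by blast
    then show ?thesis
    proof cases
      case 1
      then have e: "{(a, b). (c, a, b) \<in> ?C} = {(u, x)}" by auto
      show ?thesis unfolding e by (rule eq(1))
    next
      case 2
      then have e: "{(a, b). (c, a, b) \<in> ?C} = {(v, y)}" by auto
      show ?thesis unfolding e by (rule eq(2))
    next
      case 3
      then have e: "{(a, b). (c, a, b) \<in> ?C} = {}" by auto
      show ?thesis unfolding e by (rule ef_equiv_subset[OF eq(1)]) simp
    qed
  qed
  then have "clusters_match \<kappa> r N A B ?C"
    unfolding clusters_match_def using uv xy far by (intro conjI allI impI) auto
  from loc[rule_format, OF A B _ _ this] have "ef_equiv \<kappa> n A B (snd ` ?C)" by (simp add: card_insert_if)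
  then show ?thesis by simp
qed

text \<open>The prefix of the label of \<open>x\<close> lists the types of \<open>x\<close> after isolating any sequence of
  vertices of its hitting set. Two vertices \<open>x \<noteq> y\<close> find the common part of their hitting sets by
  comparing codes; isolating it makes them far apart, so their types determine the joint type.\<close>

lemma bounded_expansion_imp_first_order_sketchable:
  fixes \<F> :: "nat pair_pre_digraph set"
  assumes F: "\<And>G. G \<in> \<F> \<Longrightarrow> pair_graph G" and be: "bounded_expansion \<F>"
  shows "first_order_sketchable \<F>"
  unfolding first_order_sketchable_def
proof (intro allI impI)
  fix k0 \<phi> R
  assume \<phi>: "free_vars \<phi> \<subseteq> {0, 1} \<and> unary_symbols \<phi> \<subseteq> {1..k0}"
  \<comment> \<open>The games use the predicates below a bound, counted from 0, so the symbols up to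
    \<open>k0\<close> need k0 + 1 places.\<close>
  define \<kappa>0 where "\<kappa>0 = Suc k0"
  define n where "n = quantifier_depth \<phi>"
  have usym: "unary_symbols \<phi> \<subseteq> {..<\<kappa>0}" using \<phi> by (auto simp: \<kappa>0_def)
  \<comment> \<open>The order of choices matters: \<open>r\<close> and \<open>N\<close> from the
    quantifier depth, \<open>k\<close> from \<open>r\<close>, and only then \<kappa> from
    \<open>k\<close>.\<close>
  obtain r N where loc: "\<forall>\<kappa>. \<forall>A B :: nat struct. \<forall>C. graph_struct A \<longrightarrow> graph_struct B \<longrightarrow> finite C \<longrightarrow>
     card C \<le> 2 \<longrightarrow> clusters_match \<kappa> r N A B C \<longrightarrow> ef_equiv \<kappa> n A B (snd ` C)"
    using ef_locality[where l = 2 and q = n] by blast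
  obtain k where kpos: "k > 0" and k: "\<forall>G\<in>\<F>. \<exists>q. \<forall>x\<in>pverts G. length (q x) = k \<and> q x ! 0 = x \<and> set (q x) \<subseteq> pverts G \<and>
    (\<forall>w. walk (parcs G) w \<longrightarrow> w \<noteq> [] \<longrightarrow> set w \<subseteq> pverts G \<longrightarrow> length w \<le> Suc r \<longrightarrow> hd w = x \<longrightarrow>
       set w \<inter> set (q x) \<inter> set (q (last w)) \<noteq> {})"
    using bounded_expansion_hitting_lists[OF F be, of r] by blast
  \<comment> \<open>An equality pattern has at most k * k index pairs, which bounds the list of
    isolated vertices, repetitions included.\<close>
  define L where "L = k * k"
  define \<kappa> where "\<kappa> = \<kappa>0 + 2 * L"
  obtain h :: "nat struct \<times> nat list \<Rightarrow> nat" and b where hb: "\<forall>X. h X < b" and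
    h: "\<forall>A as B bs. length as = 1 \<longrightarrow> length bs = 1 \<longrightarrow> h (A, as) = h (B, bs) \<longrightarrow> ef_equiv \<kappa> N A B (set (zip as bs))"
    using finitely_many_ef_types[of 1 \<kappa> N] by blast
  have h1: "ef_equiv \<kappa> N A B {(u, x)}" if "h (A, [u]) = h (B, [x])" for A B u x
    using h[rule_format, of "[u]" "[x]" A B] that by simp
  obtain il where il: "set il = {is :: nat list. set is \<subseteq> {..<k} \<and> length is \<le> L}"
    using finite_list[OF finite_lists_length_le[of "{..<k}" L]] by auto
  define pos where "pos is = (SOME i. i < length il \<and> il ! i = is)" for "is"
  have pos: "pos is < length il \<and> il ! pos is = is" if "set is \<subseteq> {..<k}" "length is \<le> L" for "is"
  proof -
    have "is \<in> set il" using that by (simp add: il)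
    then show ?thesis unfolding pos_def in_set_conv_nth by (rule someI_ex)
  qed
  \<comment> \<open>The enumeration depends on the equality pattern alone, so the first components,
    read in the list of \<open>x\<close>, and the second ones, read in that of \<open>y\<close>,
    give the same vertices in the same order.\<close>
  define enum :: "(nat \<times> nat) set \<Rightarrow> (nat \<times> nat) list" where "enum Eq = (SOME l. set l = Eq \<and> distinct l)" for Eq
  have enum: "set (enum Eq) = Eq" "length (enum Eq) \<le> L" if "Eq \<subseteq> {..<k} \<times> {..<k}" for Eq
  proof -
    have fin: "finite Eq" using that finite_subset by blast
    have "set (enum Eq) = Eq \<and> distinct (enum Eq)"
      unfolding enum_def by (rule someI_ex) (use finite_distinct_list[OF fin] in blast)
    then show "set (enum Eq) = Eq" "length (enum Eq) \<le> L"
      using distinct_card[of "enum Eq"] card_mono[OF _ that] by (simp_all add: L_def)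
  qed
  define realizes :: "nat \<Rightarrow> nat \<Rightarrow> nat \<Rightarrow> nat struct \<Rightarrow> nat list \<Rightarrow> nat \<Rightarrow> nat \<Rightarrow> bool" where
    "realizes m t t' A ss u v \<longleftrightarrow> graph_struct A \<and> length ss = m \<and> u \<in> fst A \<and> v \<in> fst A \<and>
      (u, v) \<notin> reach (fst (snd (isolate \<kappa>0 ss A))) r \<and>
      h (isolate \<kappa>0 ss A, [u]) = t \<and> h (isolate \<kappa>0 ss A, [v]) = t'" for m t t' A ss u v
  define sat :: "nat struct \<Rightarrow> nat \<Rightarrow> nat \<Rightarrow> bool" where
    "sat A u v \<longleftrightarrow> fo_sat (fst A) (fst (snd A)) (snd (snd A)) ((\<lambda>_. v)(0 := u)) \<phi>" for A u v
  have determined: "sat A u v \<longleftrightarrow> sat B x y"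
    if m: "m \<le> L" and A: "realizes m t t' A ss u v" and B: "realizes m t t' B ts x y" for m t t' A B ss ts u v x y
  proof -
    have gA: "graph_struct A" and gB: "graph_struct B" using A B by (simp_all add: realizes_def)
    have len: "length ss = length ts" "length ss \<le> L" using A B m by (simp_all add: realizes_def)
    have "ef_equiv \<kappa> N (isolate \<kappa>0 ss A) (isolate \<kappa>0 ts B) {(u, x)}"
      "ef_equiv \<kappa> N (isolate \<kappa>0 ss A) (isolate \<kappa>0 ts B) {(v, y)}"
      using A B by (simp_all add: realizes_def h1)
    with A B have "ef_equiv \<kappa> n (isolate \<kappa>0 ss A) (isolate \<kappa>0 ts B) {(u, x), (v, y)}"
      by (intro ef_equiv_far_pair[OF spec[OF loc]]) (simp_all add: realizes_def graph_struct_isolate isolate_simps(1))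
    then have "ef_equiv \<kappa>0 n A B {(u, x), (v, y)}"
      unfolding \<kappa>_def by (rule ef_equiv_isolate[OF gA gB len])
    then have "ef_equiv \<kappa>0 n (fst A, fst (snd A), snd (snd A)) (fst B, fst (snd B), snd (snd B)) {(u, x), (v, y)}" by simp
    then show ?thesis unfolding sat_def by (rule ef_equiv_fo_sat) (use \<phi> usym in \<open>auto simp: n_def\<close>)
  qed
  \<comment> \<open>The pair (0, 0) signals x = y, for which the head of the prefix stores the truth
    value. Otherwise the decoder, which sees no graph, asks whether some structure realises the two
    types and satisfies the formula; by \<open>determined\<close>, all that realise them
    agree.\<close>
  define D :: "nat list \<Rightarrow> nat list \<Rightarrow> (nat \<times> nat) set \<Rightarrow> bool" where
    "D p p' Eq = (if (0, 0) \<in> Eq then hd p = 1 else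
       \<exists>A ss u v. realizes (length (enum Eq)) (tl p ! pos (map fst (enum Eq))) (tl p' ! pos (map snd (enum Eq))) A ss u v \<and>
         sat A u v)" for p p' Eq
  show "sketchable \<F> (\<lambda>G u v. Some (fo_sat (pverts G) (parcs G) (R G) ((\<lambda>_. v)(0 := u)) \<phi>))"
  \<comment> \<open>The bound b + 2 covers the types below \<open>b\<close> as well as the head
    entry 0 or 1.\<close>
  proof (rule equality_scheme_sketchable[where D = D and k = k
        and PP = "{xs. set xs \<subseteq> {..<b + 2} \<and> length xs = Suc (length il)}"])
    show "finite {xs. set xs \<subseteq> {..<b + 2} \<and> length xs = Suc (length il)}"
      by (rule finite_lists_length_eq) simp
    show "finite (pverts G)" if "G \<in> \<F>" for G using F[OF that] by (simp add: pair_graph_iff)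
    fix G assume G: "G \<in> \<F>"
    obtain q where q: "\<forall>x\<in>pverts G. length (q x) = k \<and> q x ! 0 = x \<and> set (q x) \<subseteq> pverts G \<and>
      (\<forall>w. walk (parcs G) w \<longrightarrow> w \<noteq> [] \<longrightarrow> set w \<subseteq> pverts G \<longrightarrow> length w \<le> Suc r \<longrightarrow> hd w = x \<longrightarrow>
         set w \<inter> set (q x) \<inter> set (q (last w)) \<noteq> {})"
      using bspec[OF k G] by (elim exE)
    define A where "A = (pverts G, parcs G, R G)"
    have A_simps: "fst A = pverts G" "fst (snd A) = parcs G" "snd (snd A) = R G" by (simp_all add: A_def)
    have gA: "graph_struct A" using F[OF G] by (simp add: graph_struct_def A_simps pair_graph_iff)
    define p where "p x = (if sat A x x then 1 else 0) #
      map (\<lambda>is. h (isolate \<kappa>0 (map ((!) (q x)) is) A, [x])) il" for x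
    have p_type: "tl (p x) ! pos is = h (isolate \<kappa>0 (map ((!) (q x)) is) A, [x])"
      if "set is \<subseteq> {..<k}" "length is \<le> L" for x "is"
      using pos[OF that] by (simp add: p_def)
    have correct: "sat A x y = D (p x) (p y) {(i, j). i < k \<and> j < k \<and> q x ! i = q y ! j}"
      if x: "x \<in> pverts G" and y: "y \<in> pverts G" for x y
    proof (cases "x = y")
      case True
      then show ?thesis using kpos by (simp add: D_def p_def)
    next
      case False
      define Eq where "Eq = {(i, j). i < k \<and> j < k \<and> q x ! i = q y ! j}"
      have Eq_sub: "Eq \<subseteq> {..<k} \<times> {..<k}" by (auto simp: Eq_def)
      have "(0, 0) \<notin> Eq" using False q x y by (auto simp: Eq_def)
      define ss where "ss = map ((!) (q x)) (map fst (enum Eq))"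
      have ss': "ss = map ((!) (q y)) (map snd (enum Eq))"
      proof -
        have "q x ! fst e = q y ! snd e" if "e \<in> set (enum Eq)" for e
          using that unfolding enum(1)[OF Eq_sub] by (auto simp: Eq_def)
        then show ?thesis by (simp add: ss_def)
      qed
      have ss_set: "set ss = set (q x) \<inter> set (q y)"
      proof
        show "set ss \<subseteq> set (q x) \<inter> set (q y)"
        proof
          fix z assume "z \<in> set ss"
          then obtain i j where "(i, j) \<in> Eq" "z = q x ! i" using enum(1)[OF Eq_sub] by (auto simp: ss_def)
          then have "i < length (q x)" "j < length (q y)" "z = q x ! i" "z = q y ! j" using q x y by (auto simp: Eq_def)
          then show "z \<in> set (q x) \<inter> set (q y)" by (metis IntI nth_mem)
        qed
        show "set (q x) \<inter> set (q y) \<subseteq> set ss"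
        proof
          fix z assume "z \<in> set (q x) \<inter> set (q y)"
          then obtain i j where "i < length (q x)" "z = q x ! i" "j < length (q y)" "z = q y ! j"
            by (metis IntE in_set_conv_nth)
          then have "(i, j) \<in> set (enum Eq)" "z = q x ! i" unfolding enum(1)[OF Eq_sub] using q x y by (auto simp: Eq_def)
          then show "z \<in> set ss" by (force simp: ss_def)
        qed
      qed
      have far: "(x, y) \<notin> reach (fst (snd (isolate \<kappa>0 ss A))) r"
      proof (rule isolate_separates[OF gA False])
        show "x \<in> fst A" using x by (simp add: A_simps)
        fix w assume "walk (fst (snd A)) w" "w \<noteq> []" "set w \<subseteq> fst A" "length w \<le> Suc r" "hd w = x" "last w = y"
        then have "set w \<inter> set (q x) \<inter> set (q y) \<noteq> {}" using q x unfolding A_simps by blast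
        then show "set w \<inter> set ss \<noteq> {}" unfolding ss_set by blast
      qed
      have idx: "set (map fst (enum Eq)) \<subseteq> {..<k}" "length (map fst (enum Eq)) \<le> L"
        "set (map snd (enum Eq)) \<subseteq> {..<k}" "length (map snd (enum Eq)) \<le> L"
        using enum[OF Eq_sub] Eq_sub by auto
      have real: "realizes (length (enum Eq)) (tl (p x) ! pos (map fst (enum Eq)))
          (tl (p y) ! pos (map snd (enum Eq))) A ss x y"
        unfolding realizes_def p_type[OF idx(1,2)] p_type[OF idx(3,4)]
      proof (intro conjI gA far)
        show "length ss = length (enum Eq)" by (simp add: ss_def)
        show "x \<in> fst A" "y \<in> fst A" using x y by (simp_all add: A_simps)
        show "h (isolate \<kappa>0 ss A, [x]) = h (isolate \<kappa>0 (map ((!) (q x)) (map fst (enum Eq))) A, [x])"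
          by (simp only: ss_def)
        show "h (isolate \<kappa>0 ss A, [y]) = h (isolate \<kappa>0 (map ((!) (q y)) (map snd (enum Eq))) A, [y])"
          by (simp only: ss')
      qed
      have "D (p x) (p y) Eq \<longleftrightarrow> (\<exists>B ts u v. realizes (length (enum Eq)) (tl (p x) ! pos (map fst (enum Eq)))
          (tl (p y) ! pos (map snd (enum Eq))) B ts u v \<and> sat B u v)"
        using \<open>(0, 0) \<notin> Eq\<close> by (simp only: D_def if_False)
      also have "\<dots> \<longleftrightarrow> sat A x y"
        using real determined[OF enum(2)[OF Eq_sub] _ real] by blast
      finally have "D (p x) (p y) Eq \<longleftrightarrow> sat A x y" .
      then show ?thesis by (simp add: Eq_def)
    qed
    show "\<exists>p (q :: nat \<Rightarrow> nat list). \<forall>x\<in>pverts G. p x \<in> {xs. set xs \<subseteq> {..<b + 2} \<and> length xs = Suc (length il)} \<and> length (q x) = k \<and>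
      (\<forall>y\<in>pverts G. \<forall>b. Some (fo_sat (pverts G) (parcs G) (R G) ((\<lambda>_. y)(0 := x)) \<phi>) = Some b \<longrightarrow>
         b = D (p x) (p y) {(i, j). i < k \<and> j < k \<and> q x ! i = q y ! j})"
    proof (rule exI[of _ p], rule exI[of _ q], intro ballI conjI allI impI)
      fix x assume x: "x \<in> pverts G"
      have "h (isolate \<kappa>0 (map ((!) (q x)) is) A, [x]) < b + 2" for "is"
        using spec[OF hb, of "(isolate \<kappa>0 (map ((!) (q x)) is) A, [x])"] by linarith
      then show "p x \<in> {xs. set xs \<subseteq> {..<b + 2} \<and> length xs = Suc (length il)}"
        by (auto simp: p_def)
      show "length (q x) = k" using q x by blast
      fix y c assume y: "y \<in> pverts G" and c: "Some (fo_sat (pverts G) (parcs G) (R G) ((\<lambda>_. y)(0 := x)) \<phi>) = Some c"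
      from c have "c = sat A x y" by (simp add: sat_def A_simps)
      with correct[OF x y] show "c = D (p x) (p y) {(i, j). i < k \<and> j < k \<and> q x ! i = q y ! j}" by simp
    qed
  qed
qed

theorem theorem4p7:
  fixes \<F> :: "nat pair_pre_digraph set"
  assumes "graph_class \<F>" and "monotone_class \<F>"
  shows "(small_distance_sketchable \<F> \<longleftrightarrow>
            (\<exists>f :: nat \<Rightarrow> nat. \<forall>r. disjunctive_distance_scheme \<F> r (f r))) \<and>
         ((\<exists>f :: nat \<Rightarrow> nat. \<forall>r. disjunctive_distance_scheme \<F> r (f r)) \<longleftrightarrow>
            first_order_sketchable \<F>) \<and>
         (first_order_sketchable \<F> \<longleftrightarrow> bounded_expansion \<F>)"
proof -
  have F: "pair_graph G" if "G \<in> \<F>" for G using assms(1) that by (simp add: graph_class_def)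
  have "bounded_expansion \<F>" if "small_distance_sketchable \<F>"
    using F assms(2) that by (rule small_distance_sketchable_imp_bounded_expansion)
  moreover have "\<exists>f. \<forall>r. disjunctive_distance_scheme \<F> r (f r)" if "bounded_expansion \<F>"
    by (rule choice) (use bounded_expansion_imp_disjunctive_scheme[OF F that] in blast)
  moreover have "first_order_sketchable \<F>" if "bounded_expansion \<F>"
    using F that by (rule bounded_expansion_imp_first_order_sketchable)
  moreover have "small_distance_sketchable \<F>" if "first_order_sketchable \<F>"
    using F that by (rule first_order_imp_small_distance_sketchable)
  moreover have "small_distance_sketchable \<F>" if "\<exists>f. \<forall>r. disjunctive_distance_scheme \<F> r (f r)"
    using that disjunctive_scheme_imp_sketchable[OF F] unfolding small_distance_sketchable_def by blast
  ultimately show ?thesis by blast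
qed

end
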